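(* Let $\Gamma$ be a finite directed rooted binary tree with $n_\Gamma$ edges and root edge $r$, let $K_e,H_e,a_e>0$ for $e\in\Gamma$, let $\lambda>0$, and let $f_{\boldsymbol P}$ be a probability density on $(0,\infty)^{n_\Gamma}$. Let $\boldsymbol X=[\boldsymbol Q;\boldsymbol R]$ be the solution of the linear stochastic differential equation $\mathrm d\boldsymbol X(t)=\mathbf M\boldsymbol X(t)\,\mathrm dt+\mathrm d\boldsymbol Y(t)$ described in the context. Assume that $\int_{\{|\boldsymbol y|\ge 1\}}\log(|\boldsymbol y|)\,f_{\boldsymbol Y_2}(\boldsymbol y)\,\mathrm d\boldsymbol y<\infty$, where $f_{\boldsymbol Y_2}$ is the density of the random vector $[H_ea_eP_{1,e}:e\in\Gamma]^{\intercal}$ and $\boldsymbol P_1=[P_{1,e}:e\in\Gamma]^{\intercal}$ has density $f_{\boldsymbol P}$. Then for every $e\in\Gamma$ the component $Q_e$ has a limiting invariant density $g_e$ (that is, $g_e$ is the density of the $Q_e$-marginal of the invariant distribution of $\boldsymbol X$, and the law of $Q_e(t)$ converges weakly to it as $t\to\infty$ for every initial condition $\boldsymbol X(0)=\boldsymbol x\in(0,\infty)^{2n_\Gamma}$), and its Laplace transform $\tilde g_e(s)=\int_0^\infty e^{-sx}g_e(x)\,\mathrm dx$ is $$\tilde g_e(s)=\exp\left\{-\frac{\lambda}{H_r}\int_0^1\frac{1-\tilde f_{\boldsymbol P}\big(s\,[H_{e'}a_{e'}(\boldsymbol m_e(u))_{e'}:e'\in\Gamma]^{\intercal}\big)}{u}\,\mathrm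 du\right\},\qquad s>0,$$ where $\tilde f_{\boldsymbol P}(\boldsymbol s)=\int_{(0,\infty)^{n_\Gamma}}e^{-\boldsymbol y\cdot\boldsymbol s}f_{\boldsymbol P}(\boldsymbol y)\,\mathrm d\boldsymbol y$, and $\boldsymbol m_e(u)\in\mathbb R^{n_\Gamma}$ consists of the last $n_\Gamma$ entries of the column of $u^{-\mathbf M^{\intercal}/H_r}:=\exp\big(-\tfrac{\log u}{H_r}\mathbf M^{\intercal}\big)$ corresponding to $Q_e$.
   Context: $\Gamma$ is a finite rooted binary tree modelling a river network: its $n_\Gamma$ edges are called links, $r$ is the root (most downstream) link, and each link $e$ either has two tributaries (the two links immediately upstream of it) or none. Vectors indexed by $\Gamma$ list the root first. The incidence matrix $\boldsymbol\Lambda_\Gamma\in\mathbb R^{n_\Gamma\times n_\Gamma}$ has $(\boldsymbol\Lambda_\Gamma)_{e,e}=1$ for all $e$, $(\boldsymbol\Lambda_\Gamma)_{e,e'}=-1$ if $e'$ is a tributary of $e$, and all other entries zero. Put $\mathbf K=\mathrm{diag}(K_e:e\in\Gamma)$, $\mathbf H=\mathrm{diag}(H_e:e\in\Gamma)$, and $$\mathbf M=\begin{bmatrix}-\mathbf K\boldsymbol\Lambda_\Gamma&\mathbf K\\ \mathbf O&-\mathbf H\end{bmatrix}\in\mathbb R^{2n_\Gamma\times 2n_\Gamma}.$$ Let $N$ be a Poisson process with rate $\lambda$ and jump times $T_1<T_2<\cdots$, and let $\boldsymbol P_n=[P_{n,e}:e\in\Gamma]^{\intercal}$, $n\ge1$,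 be i.i.d. random vectors with density $f_{\boldsymbol P}$ on $(0,\infty)^{n_\Gamma}$, independent of $N$. The driving process is $\boldsymbol Y(t)=\sum_{n=1}^{N(t)}\begin{bmatrix}\boldsymbol 0\\ [H_ea_eP_{n,e}:e\in\Gamma]^{\intercal}\end{bmatrix}$. The solution is $$\boldsymbol X(t)=\begin{bmatrix}\boldsymbol Q(t)\\ \boldsymbol R(t)\end{bmatrix}=e^{\mathbf Mt}\boldsymbol X(0)+\sum_{n=1}^{N(t)}e^{\mathbf M(t-T_n)}\begin{bmatrix}\boldsymbol 0\\ [H_ea_eP_{n,e}:e\in\Gamma]^{\intercal}\end{bmatrix},$$ with $\boldsymbol Q=[Q_e:e\in\Gamma]^{\intercal}$ (streamflows), $\boldsymbol R=[R_e:e\in\Gamma]^{\intercal}$ (runoffs), and state space $(0,\infty)^{2n_\Gamma}$. A probability distribution is invariant for $\boldsymbol X$ if $\boldsymbol X(t)$ has that distribution for all $t>0$ whenever $\boldsymbol X(0)$ does (with $\boldsymbol X(0)$ independent of $\boldsymbol Y$). The columns of $u^{-\mathbf M^{\intercal}/H_r}$ are indexed like the entries of $\boldsymbol X$, so the first $n_\Gamma$ columns correspond to $Q_e$, $e\in\Gamma$. *)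

theory Defs
  imports "HOL-Probability.Probability"
begin

section \<open>River networks\<close>

text \<open>
  The links are the elements of the finite type \<^typ>\<open>'e\<close>; \<open>trib e\<close> is the set of
  tributaries of the link \<open>e\<close>, and \<open>r\<close> is the root link. The last three conjuncts say that the
  links form a tree with root \<open>r\<close>.
\<close>

definition river_network :: "'e::finite \<Rightarrow> ('e \<Rightarrow> 'e set) \<Rightarrow> bool" where
  "river_network r trib \<longleftrightarrow>
     (\<forall>e. trib e = {} \<or> card (trib e) = 2) \<and>
     (\<forall>e. r \<notin> trib e) \<and>
     (\<forall>e e'. e \<noteq> e' \<longrightarrow> trib e \<inter> trib e' = {}) \<and>
     (\<forall>e. (r, e) \<in> {(d, u). u \<in> trib d}\<^sup>*)"

definition incidence_matrix :: "('e::finite \<Rightarrow> 'e set) \<Rightarrow> real^'e^'e" where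
  "incidence_matrix trib =
     (\<chi> e e'. if e' = e then 1 else if e' \<in> trib e then -1 else 0)"

definition diag_mat :: "('e::finite \<Rightarrow> real) \<Rightarrow> real^'e^'e" where
  "diag_mat d = (\<chi> e e'. if e = e' then d e else 0)"

definition block_mat ::
  "real^'e^'e \<Rightarrow> real^'e^'e \<Rightarrow> real^'e^'e \<Rightarrow> real^'e^'e \<Rightarrow> real^('e::finite + 'e)^('e + 'e)" where
  "block_mat A B C D =
     (\<chi> i j. case i of
        Inl e \<Rightarrow> (case j of Inl e' \<Rightarrow> A $ e $ e' | Inr e' \<Rightarrow> B $ e $ e')
      | Inr e \<Rightarrow> (case j of Inl e' \<Rightarrow> C $ e $ e' | Inr e' \<Rightarrow> D $ e $ e'))"

text \<open>
  A state vector is indexed by \<^typ>\<open>'e + 'e\<close>: the entry \<open>Inl e\<close> is the streamflow \<open>Q\<^sub>e\<close> and the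
  entry \<open>Inr e\<close> is the runoff \<open>R\<^sub>e\<close>.
\<close>

definition river_matrix ::
  "('e::finite \<Rightarrow> 'e set) \<Rightarrow> ('e \<Rightarrow> real) \<Rightarrow> ('e \<Rightarrow> real) \<Rightarrow> real^('e + 'e)^('e + 'e)" where
  "river_matrix trib K H =
     block_mat (- (diag_mat K ** incidence_matrix trib)) (diag_mat K) 0 (- diag_mat H)"

text \<open>
  The library's \<open>*\<close> and \<open>^\<close> on the type of matrices are entrywise, hence the explicit
  iteration of \<open>**\<close>.
\<close>

definition mat_exp :: "real^'n^'n \<Rightarrow> real^'n::finite^'n" where
  "mat_exp A = (\<Sum>k. ((\<lambda>B. A ** B) ^^ k) (mat 1) /\<^sub>R fact k)"

text \<open>\<open>u\<close> raised to the matrix \<open>A\<close>, for \<open>u > 0\<close>.\<close>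

definition mat_powr :: "real \<Rightarrow> real^'n^'n \<Rightarrow> real^'n::finite^'n" where
  "mat_powr u A = mat_exp (ln u *\<^sub>R A)"

definition m_vec ::
  "'e::finite \<Rightarrow> ('e \<Rightarrow> 'e set) \<Rightarrow> ('e \<Rightarrow> real) \<Rightarrow> ('e \<Rightarrow> real) \<Rightarrow> 'e \<Rightarrow> real \<Rightarrow> real^'e" where
  "m_vec r trib K H e u =
     (\<chi> e'. column (Inl e) (mat_powr u ((- 1 / H r) *\<^sub>R transpose (river_matrix trib K H))) $ Inr e')"

section \<open>Densities and Laplace transforms\<close>

definition pos_orthant :: "(real^'n::finite) set" where
  "pos_orthant = {x. \<forall>i. 0 < x $ i}"

definition density_on :: "'a::euclidean_space set \<Rightarrow> ('a \<Rightarrow> real) \<Rightarrow> bool" where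
  "density_on D f \<longleftrightarrow>
     f \<in> borel_measurable borel \<and> (\<forall>x. 0 \<le> f x) \<and> (\<forall>x. x \<notin> D \<longrightarrow> f x = 0) \<and>
     (\<integral>\<^sup>+x. ennreal (f x) \<partial>lborel) = 1"

definition laplace_orthant :: "(real^'e::finite \<Rightarrow> real) \<Rightarrow> real^'e \<Rightarrow> real" where
  "laplace_orthant f s = (LBINT y:pos_orthant. exp (- (y \<bullet> s)) * f y)"

definition laplace_half_line :: "(real \<Rightarrow> real) \<Rightarrow> real \<Rightarrow> real" where
  "laplace_half_line g s = (LBINT x:{0..}. exp (- s * x) * g x)"

section \<open>The driving process\<close>

text \<open>
  Independence of two random variables. The library's \<^term>\<open>prob_space.indep_var\<close> forces both
  to take values in the same type; this is the characterization \<open>prob_space.indep_var_eq\<close>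
  without that restriction.
\<close>

definition indep_rv ::
  "'w measure \<Rightarrow> 'a measure \<Rightarrow> ('w \<Rightarrow> 'a) \<Rightarrow> 'b measure \<Rightarrow> ('w \<Rightarrow> 'b) \<Rightarrow> bool" where
  "indep_rv \<Omega> S U T V \<longleftrightarrow>
     U \<in> measurable \<Omega> S \<and> V \<in> measurable \<Omega> T \<and>
     prob_space.indep_set \<Omega>
       {U -` A \<inter> space \<Omega> | A. A \<in> sets S} {V -` B \<inter> space \<Omega> | B. B \<in> sets T}"

text \<open>
  Only times \<open>t \<ge> 0\<close> matter. Jumps of size one need not be required: they follow almost surely.
\<close>

definition poisson_process :: "'w measure \<Rightarrow> real \<Rightarrow> (real \<Rightarrow> 'w \<Rightarrow> nat) \<Rightarrow> bool" where
  "poisson_process \<Omega> rate N \<longleftrightarrow>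
     (\<forall>t\<ge>0. N t \<in> measurable \<Omega> (count_space UNIV)) \<and>
     (\<forall>\<omega>\<in>space \<Omega>. N 0 \<omega> = 0 \<and> mono_on {0..} (\<lambda>t. N t \<omega>) \<and>
        (\<forall>t\<ge>0. continuous (at_right t) (\<lambda>u. N u \<omega>))) \<and>
     (\<forall>k (t :: nat \<Rightarrow> real). 0 \<le> t 0 \<and> mono t \<longrightarrow>
        prob_space.indep_vars \<Omega> (\<lambda>_. count_space UNIV)
          (\<lambda>i \<omega>. N (t (Suc i)) \<omega> - N (t i) \<omega>) {..<k}) \<and>
     (\<forall>s t. 0 \<le> s \<and> s < t \<longrightarrow>
        distr \<Omega> (count_space UNIV) (\<lambda>\<omega>. N t \<omega> - N s \<omega>) =
          measure_pmf (poisson_pmf (rate * (t - s))))"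

definition jump_time :: "(real \<Rightarrow> 'w \<Rightarrow> nat) \<Rightarrow> nat \<Rightarrow> 'w \<Rightarrow> real" where
  "jump_time N n \<omega> = Inf {t. 0 \<le> t \<and> n \<le> N t \<omega>}"

text \<open>The vectors \<open>P n\<close> matter for \<open>n \<ge> 1\<close> only.\<close>

definition marked_poisson ::
  "'w measure \<Rightarrow> real \<Rightarrow> (real^'e::finite \<Rightarrow> real) \<Rightarrow> (real \<Rightarrow> 'w \<Rightarrow> nat) \<Rightarrow> (nat \<Rightarrow> 'w \<Rightarrow> real^'e) \<Rightarrow> bool"
  where
  "marked_poisson \<Omega> rate f N P \<longleftrightarrow>
     prob_space \<Omega> \<and> poisson_process \<Omega> rate N \<and>
     prob_space.indep_vars \<Omega> (\<lambda>_. borel) P {1..} \<and>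
     (\<forall>n\<ge>1. distributed \<Omega> lborel (P n) (\<lambda>y. ennreal (f y))) \<and>
     indep_rv \<Omega> (PiM {0..} (\<lambda>_. count_space UNIV)) (\<lambda>\<omega>. \<lambda>t\<in>{0..}. N t \<omega>)
       (PiM {1..} (\<lambda>_. borel)) (\<lambda>\<omega>. \<lambda>n\<in>{1..}. P n \<omega>)"

definition scaled_mark ::
  "('e::finite \<Rightarrow> real) \<Rightarrow> ('e \<Rightarrow> real) \<Rightarrow> (nat \<Rightarrow> 'w \<Rightarrow> real^'e) \<Rightarrow> nat \<Rightarrow> 'w \<Rightarrow> real^'e" where
  "scaled_mark H a P n \<omega> = (\<chi> e. H e * a e * P n \<omega> $ e)"

definition jump ::
  "('e::finite \<Rightarrow> real) \<Rightarrow> ('e \<Rightarrow> real) \<Rightarrow> (nat \<Rightarrow> 'w \<Rightarrow> real^'e) \<Rightarrow> nat \<Rightarrow> 'w \<Rightarrow> real^('e + 'e)" where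
  "jump H a P n \<omega> = (\<chi> i. case i of Inl e \<Rightarrow> 0 | Inr e \<Rightarrow> scaled_mark H a P n \<omega> $ e)"

definition driving_process ::
  "('e::finite \<Rightarrow> real) \<Rightarrow> ('e \<Rightarrow> real) \<Rightarrow> (real \<Rightarrow> 'w \<Rightarrow> nat) \<Rightarrow> (nat \<Rightarrow> 'w \<Rightarrow> real^'e) \<Rightarrow>
     real \<Rightarrow> 'w \<Rightarrow> real^('e + 'e)" where
  "driving_process H a N P t \<omega> = (\<Sum>n=1..N t \<omega>. jump H a P n \<omega>)"

section \<open>The solution and its invariant distributions\<close>

text \<open>The value \<open>X(t)\<close>, where \<open>X0\<close> is the (possibly random) initial condition.\<close>

definition river_solution ::
  "('e::finite \<Rightarrow> 'e set) \<Rightarrow> ('e \<Rightarrow> real) \<Rightarrow> ('e \<Rightarrow> real) \<Rightarrow> ('e \<Rightarrow> real) \<Rightarrow>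
     (real \<Rightarrow> 'w \<Rightarrow> nat) \<Rightarrow> (nat \<Rightarrow> 'w \<Rightarrow> real^'e) \<Rightarrow> ('w \<Rightarrow> real^('e + 'e)) \<Rightarrow>
     real \<Rightarrow> 'w \<Rightarrow> real^('e + 'e)" where
  "river_solution trib K H a N P X0 t \<omega> =
     mat_exp (t *\<^sub>R river_matrix trib K H) *v X0 \<omega> +
     (\<Sum>n=1..N t \<omega>.
        mat_exp ((t - jump_time N n \<omega>) *\<^sub>R river_matrix trib K H) *v jump H a P n \<omega>)"

text \<open>
  The given probability space \<open>\<Omega>\<close> need not carry any \<open>X0\<close> with law \<open>\<mu>\<close> independent of the driving
  process, which would make the condition below vacuous. It is therefore imposed on
  \<open>\<mu> \<Otimes>\<^sub>M \<Omega>\<close>, where the first projection is such an \<open>X0\<close>.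
\<close>

definition invariant_distribution ::
  "('e::finite \<Rightarrow> 'e set) \<Rightarrow> ('e \<Rightarrow> real) \<Rightarrow> ('e \<Rightarrow> real) \<Rightarrow> ('e \<Rightarrow> real) \<Rightarrow> 'w measure \<Rightarrow>
     (real \<Rightarrow> 'w \<Rightarrow> nat) \<Rightarrow> (nat \<Rightarrow> 'w \<Rightarrow> real^'e) \<Rightarrow> (real^('e + 'e)) measure \<Rightarrow> bool" where
  "invariant_distribution trib K H a \<Omega> N P \<mu> \<longleftrightarrow>
     prob_space \<mu> \<and> sets \<mu> = sets borel \<and> (AE x in \<mu>. x \<in> pos_orthant) \<and>
     (let \<Omega>' = \<mu> \<Otimes>\<^sub>M \<Omega>; N' = (\<lambda>t. N t \<circ> snd); P' = (\<lambda>n. P n \<circ> snd) in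
      \<forall>X0. distr \<Omega>' borel X0 = \<mu> \<and>
           indep_rv \<Omega>' borel X0 (PiM {0..} (\<lambda>_. borel))
             (\<lambda>\<omega>. \<lambda>t\<in>{0..}. driving_process H a N' P' t \<omega>) \<longrightarrow>
           (\<forall>t>0. river_solution trib K H a N' P' X0 t \<in> borel_measurable \<Omega>' \<and>
                  distr \<Omega>' borel (river_solution trib K H a N' P' X0 t) = \<mu>))"

text \<open>
  Weak convergence as \<open>t \<rightarrow> \<infinity>\<close> is expressed by the library's sequential notion
  \<^const>\<open>weak_conv_m\<close> along every sequence of times tending to infinity. The invariant
  distribution is unique, so that the existential quantifier over \<open>\<mu>\<close> is a definite description.
\<close>

definition limiting_invariant_density ::
  "('e::finite \<Rightarrow> 'e set) \<Rightarrow> ('e \<Rightarrow> real) \<Rightarrow> ('e \<Rightarrow> real) \<Rightarrow> ('e \<Rightarrow> real) \<Rightarrow> 'w measure \<Rightarrow>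
     (real \<Rightarrow> 'w \<Rightarrow> nat) \<Rightarrow> (nat \<Rightarrow> 'w \<Rightarrow> real^'e) \<Rightarrow> 'e \<Rightarrow> (real \<Rightarrow> real) \<Rightarrow> bool" where
  "limiting_invariant_density trib K H a \<Omega> N P e g \<longleftrightarrow>
     density_on {0<..} g \<and>
     (\<exists>\<mu>. invariant_distribution trib K H a \<Omega> N P \<mu> \<and>
          (\<forall>\<nu>. invariant_distribution trib K H a \<Omega> N P \<nu> \<longrightarrow> \<nu> = \<mu>) \<and>
          distributed \<mu> lborel (\<lambda>x. x $ Inl e) (\<lambda>q. ennreal (g q))) \<and>
     (\<forall>x\<in>pos_orthant. \<forall>\<tau>. filterlim \<tau> at_top sequentially \<longrightarrow>
        weak_conv_m
          (\<lambda>n. distr \<Omega> borel (\<lambda>\<omega>. river_solution trib K H a N P (\<lambda>_. x) (\<tau> n) \<omega> $ Inl e))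
          (density lborel (\<lambda>q. ennreal (g q))))"

end

theory Submission
  imports Defs
begin

text \<open>
  Write \<open>\<Phi> v\<close> for \<open>exp (v M)\<close>, \<open>T n\<close> and \<open>J n\<close> for the times and the sizes of the jumps, so that the
  solution started at \<open>x\<close> is \<open>\<Phi> t x + Z t\<close>, where \<open>Z t\<close> is the sum of \<open>\<Phi> (t - T n) (J n)\<close> over
  \<open>n \<le> N t\<close>. Conditioning on the jump times shows that \<open>- ln (E exp (- s \<bullet> Z t))\<close> is \<open>\<lambda>\<close> times the
  integral of \<open>1 - E exp (- s \<bullet> \<Phi> v (J 1))\<close> over \<open>v \<in> {0..t}\<close>. This is invariant under
  \<open>v \<mapsto> t - v\<close>, so \<open>Z t\<close> has the law of \<open>W t\<close>, the sum of the \<open>\<Phi> (T n) (J n)\<close>, whose components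
  increase with \<open>t\<close>. A positive vector \<open>w\<close> with \<open>M w \<le> - c w\<close>, geometric in the distance to the root,
  makes \<open>\<Phi>\<close> decay exponentially; with the logarithmic moment the integral then converges for
  \<open>t \<rightarrow> \<infinity>\<close>, and \<open>W t\<close> has an almost surely finite limit. The law of the limit is invariant because
  \<open>\<Phi> (t + v) = \<Phi> t \<Phi> v\<close> makes the Laplace transforms a cocycle, and it is the only invariant law
  because \<open>\<Phi> t x \<rightarrow> 0\<close>. The substitution \<open>u = exp (- H r v)\<close> turns the exponent into the stated one.
\<close>

section \<open>Exponentials of real matrices\<close>

text \<open>All laws in question live on the orthant, where the transform at nonnegative arguments
  determines the law. Equality of laws, invariance and uniqueness thus reduce to identities between
  exponents, and the basic expectation is that of a product over jump times. The jump times are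
  never given a joint density: the product is a limit of products over the cells of a grid, for
  which independent Poisson increments suffice. Since \<open>W\<close> converges pathwise, the limit
  is a random variable and no tightness argument is required. The transform does not show that the
  streamflow has a density. This comes from the first mark: given the jump times and the other
  marks, its contribution is a nonzero linear functional of a vector with a density. Only the
  absence of jumps can charge a null set, and stationarity makes the time window as long as desired.
  Independence is assumed for whole paths (counting path and marks, initial state and driving
  process). Jump times and noise must therefore be exhibited as measurable functions of paths, which
  is why limits over grids recur.\<close>

definition mat_pow :: "real^'n^'n \<Rightarrow> nat \<Rightarrow> real^'n::finite^'n" where
  "mat_pow A k = ((\<lambda>B. A ** B) ^^ k) (mat 1)"

lemma mat_pow_0 [simp]: "mat_pow A 0 = mat 1"
  and mat_pow_Suc: "mat_pow A (Suc k) = A ** mat_pow A k"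
  by (simp_all add: mat_pow_def)

lemma mat_pow_add: "mat_pow A (a + b) = mat_pow A a ** mat_pow A b"
  by (induction a) (simp_all add: mat_pow_Suc matrix_mul_assoc)

lemma mat_pow_1 [simp]: "mat_pow A (Suc 0) = A"
  by (simp add: mat_pow_Suc)

lemma mat_pow_Suc_right: "mat_pow A (Suc k) = mat_pow A k ** A"
  using mat_pow_add[of A k "Suc 0"] by simp

lemma mat_pow_transpose: "mat_pow (transpose A) k = transpose (mat_pow A k)"
proof (induction k)
  case (Suc k)
  then show ?case
    by (simp only: mat_pow_Suc_right[of A] mat_pow_Suc[of "transpose A"] matrix_transpose_mul)
qed (simp add: transpose_mat)

lemma mat_pow_scaleR: "mat_pow (c *\<^sub>R A) k = c ^ k *\<^sub>R mat_pow A k"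
proof (induction k)
  case (Suc k)
  then show ?case
    by (simp add: mat_pow_Suc vec_eq_iff matrix_matrix_mult_def sum_distrib_left mult_ac)
qed simp

text \<open>The base adds up all entries of \<open>A\<close> in absolute value. It dominates every
  row sum, so each multiplication by \<open>A\<close> costs one factor.\<close>

lemma mat_pow_entry_le:
  fixes A :: "real^'n::finite^'n"
  shows "\<bar>mat_pow A k $ i $ j\<bar> \<le> (\<Sum>i\<in>UNIV. \<Sum>l\<in>UNIV. \<bar>A $ i $ l\<bar>) ^ k"
proof (induction k arbitrary: i)
  case 0
  then show ?case by (simp add: mat_def)
next
  case (Suc k)
  let ?c = "\<Sum>i\<in>UNIV. \<Sum>l\<in>UNIV. \<bar>A $ i $ l\<bar>"
  have c: "?c \<ge> 0" by (intro sum_nonneg) auto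
  have "\<bar>mat_pow A (Suc k) $ i $ j\<bar> \<le> (\<Sum>l\<in>UNIV. \<bar>A $ i $ l * mat_pow A k $ l $ j\<bar>)"
    by (simp add: mat_pow_Suc matrix_matrix_mult_def)
  also have "\<dots> \<le> (\<Sum>l\<in>UNIV. \<bar>A $ i $ l\<bar> * ?c ^ k)"
    unfolding abs_mult by (intro sum_mono mult_left_mono Suc.IH) auto
  also have "\<dots> = (\<Sum>l\<in>UNIV. \<bar>A $ i $ l\<bar>) * ?c ^ k" by (simp add: sum_distrib_right)
  also have "\<dots> \<le> ?c * ?c ^ k"
    using c by (intro mult_right_mono member_le_sum) (auto intro: sum_nonneg)
  finally show ?case by simp
qed

lemma summable_mat_pow_entry:
  fixes A :: "real^'n::finite^'n"
  shows "summable (\<lambda>k. mat_pow A k $ i $ j / fact k * t ^ k)"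
proof (rule summable_comparison_test')
  define c where "c = (\<Sum>i\<in>UNIV. \<Sum>l\<in>UNIV. \<bar>A $ i $ l\<bar>)"
  show "summable (\<lambda>k. inverse (fact k) * (c * \<bar>t\<bar>) ^ k)" by (rule summable_exp)
  fix k :: nat
  have "\<bar>mat_pow A k $ i $ j\<bar> * \<bar>t\<bar> ^ k / fact k \<le> c ^ k * \<bar>t\<bar> ^ k / fact k"
    unfolding c_def
    by (intro divide_right_mono mult_right_mono mat_pow_entry_le) auto
  then show "norm (mat_pow A k $ i $ j / fact k * t ^ k) \<le> inverse (fact k) * (c * \<bar>t\<bar>) ^ k"
    by (simp add: abs_mult power_abs power_mult_distrib field_simps)
qed

text \<open>The scalar \<open>t\<close> is kept apart from \<open>A\<close>, so that each entry is a
  power series in \<open>t\<close> with fixed coefficients. Continuity and Cauchy products then come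
  from real power series.\<close>

lemma mat_exp_sums:
  fixes A :: "real^'n::finite^'n"
  shows "(\<lambda>k. mat_pow A k $ i $ j / fact k * t ^ k) sums (mat_exp (t *\<^sub>R A) $ i $ j)"
proof -
  let ?E = "\<chi> i j. \<Sum>k. mat_pow A k $ i $ j / fact k * t ^ k"
  have *: "(\<lambda>k. mat_pow (t *\<^sub>R A) k /\<^sub>R fact k) sums ?E"
    unfolding sums_def
    by (intro vec_tendstoI)
      (use summable_LIMSEQ[OF summable_mat_pow_entry] in
        \<open>simp add: mat_pow_scaleR field_simps\<close>)
  then have "mat_exp (t *\<^sub>R A) = ?E"
    unfolding mat_exp_def mat_pow_def[symmetric] by (rule sums_unique[symmetric])
  then show ?thesis
    using summable_sums[OF summable_mat_pow_entry] by simp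
qed

lemma continuous_mat_exp_entry:
  fixes A :: "real^'n::finite^'n"
  shows "continuous_on S (\<lambda>t. mat_exp (t *\<^sub>R A) $ i $ j)"
proof -
  have "isCont (\<lambda>t. \<Sum>k. mat_pow A k $ i $ j / fact k * t ^ k) t" for t
    by (rule isCont_powser_converges_everywhere) (rule summable_mat_pow_entry)
  then show ?thesis
    unfolding sums_unique[OF mat_exp_sums] by (simp add: continuous_at_imp_continuous_on)
qed

lemma mat_exp_transpose: "mat_exp (t *\<^sub>R transpose A) = transpose (mat_exp (t *\<^sub>R A))"
proof -
  have "mat_exp (t *\<^sub>R transpose A) $ i $ j = mat_exp (t *\<^sub>R A) $ j $ i" for i j
  proof -
    have "mat_pow (transpose A) k $ i $ j = mat_pow A k $ j $ i" for k
      by (simp only: mat_pow_transpose) (simp add: transpose_def)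
    then show ?thesis
      using mat_exp_sums[of "transpose A" i j t] mat_exp_sums[of A j i t] by (simp add: sums_iff)
  qed
  then show ?thesis by (simp add: vec_eq_iff transpose_def)
qed

lemma abs_summable_mat_pow_entry:
  fixes A :: "real^'n::finite^'n"
  shows "summable (\<lambda>k. \<bar>mat_pow A k $ i $ j / fact k * t ^ k\<bar>)"
  \<comment> \<open>Absolute convergence at \<open>t\<close> follows from convergence at a point of
    strictly larger modulus; \<open>\<bar>t\<bar> + 1\<close> serves for every
    \<open>t\<close>.\<close>
  using powser_insidea[OF summable_mat_pow_entry[of A i j "\<bar>t\<bar> + 1"], of t] by simp

text \<open>Each entry of the product is a sum over the intermediate index \<open>l\<close> of
  Cauchy products. Summing over \<open>l\<close> inside the \<open>k\<close>-th term merges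
  \<open>mat_pow A m\<close> and \<open>mat_pow A (k - m)\<close> into \<open>mat_pow A k\<close>,
  and the binomial theorem collects the powers of \<open>s\<close> and \<open>t\<close>.\<close>

lemma mat_exp_add:
  fixes A :: "real^'n::finite^'n"
  shows "mat_exp ((s + t) *\<^sub>R A) = mat_exp (s *\<^sub>R A) ** mat_exp (t *\<^sub>R A)"
proof -
  let ?f = "\<lambda>t i j k. mat_pow A k $ i $ j / fact k * t ^ k"
  have "mat_exp ((s + t) *\<^sub>R A) $ i $ j = (mat_exp (s *\<^sub>R A) ** mat_exp (t *\<^sub>R A)) $ i $ j" for i j
  proof -
    have "(\<lambda>k. \<Sum>m\<le>k. ?f s i l m * ?f t l j (k - m)) sums
        (mat_exp (s *\<^sub>R A) $ i $ l * mat_exp (t *\<^sub>R A) $ l $ j)" for l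
      using Cauchy_product_sums[of "?f s i l" "?f t l j"]
      unfolding sums_unique[OF mat_exp_sums] real_norm_def by (simp only: abs_summable_mat_pow_entry)
    then have "(\<lambda>k. \<Sum>l\<in>UNIV. \<Sum>m\<le>k. ?f s i l m * ?f t l j (k - m)) sums
        (mat_exp (s *\<^sub>R A) ** mat_exp (t *\<^sub>R A)) $ i $ j"
      unfolding matrix_matrix_mult_def vec_lambda_beta by (intro sums_sum)
    moreover have "(\<Sum>l\<in>UNIV. \<Sum>m\<le>k. ?f s i l m * ?f t l j (k - m)) = ?f (s + t) i j k" for k
    proof -
      have **: "(\<Sum>l\<in>UNIV. ?f s i l m * ?f t l j (k - m)) =
          mat_pow A k $ i $ j * (s ^ m / fact m * (t ^ (k - m) / fact (k - m)))" if "m \<le> k" for m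
      proof -
        have *: "mat_pow A k $ i $ j = (\<Sum>l\<in>UNIV. mat_pow A m $ i $ l * mat_pow A (k - m) $ l $ j)"
          using mat_pow_add[of A m "k - m"] that by (simp add: matrix_matrix_mult_def)
        show ?thesis
          unfolding * sum_distrib_right by (intro sum.cong) simp_all
      qed
      have "(\<Sum>l\<in>UNIV. \<Sum>m\<le>k. ?f s i l m * ?f t l j (k - m)) =
          mat_pow A k $ i $ j * (\<Sum>m\<le>k. s ^ m / fact m * (t ^ (k - m) / fact (k - m)))"
        unfolding sum_distrib_left
        by (subst sum.swap) (intro sum.cong refl **, simp)
      also have "(\<Sum>m\<le>k. s ^ m / fact m * (t ^ (k - m) / fact (k - m))) = (s + t) ^ k / fact k"
        unfolding binomial_ring sum_divide_distrib
        by (intro sum.cong) (simp_all add: binomial_fact)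
      finally show ?thesis by simp
    qed
    ultimately have "?f (s + t) i j sums (mat_exp (s *\<^sub>R A) ** mat_exp (t *\<^sub>R A)) $ i $ j"
      by (simp only:)
    then show ?thesis
      by (rule sums_unique2[OF mat_exp_sums])
  qed
  then show ?thesis by (simp add: vec_eq_iff)
qed

lemma matrix_add_rdistrib:
  fixes A B :: "real^'n::finite^'m::finite"
  shows "(A + B) ** C = A ** C + B ** C"
  by (simp add: vec_eq_iff matrix_matrix_mult_def distrib_right sum.distrib)

text \<open>This is the binomial theorem for \<open>A\<close> and the scalar matrix
  \<open>x *\<^sub>R mat 1\<close>, which commute.\<close>

lemma mat_pow_shift_entry:
  fixes A :: "real^'n::finite^'n"
  shows "mat_pow (A + x *\<^sub>R mat 1) k $ i $ j =
    (\<Sum>m\<le>k. real (k choose m) * x ^ (k - m) * mat_pow A m $ i $ j)"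
proof (induction k arbitrary: i j)
  case 0
  then show ?case by simp
next
  case (Suc k)
  let ?p = "\<lambda>m. mat_pow A m $ i $ j"
  have "mat_pow (A + x *\<^sub>R mat 1) (Suc k) = A ** mat_pow (A + x *\<^sub>R mat 1) k + x *\<^sub>R mat_pow (A + x *\<^sub>R mat 1) k"
    unfolding mat_pow_Suc matrix_add_rdistrib scalar_matrix_assoc[symmetric] by simp
  then have "mat_pow (A + x *\<^sub>R mat 1) (Suc k) $ i $ j =
      (\<Sum>l\<in>UNIV. A $ i $ l * (\<Sum>m\<le>k. real (k choose m) * x ^ (k - m) * mat_pow A m $ l $ j)) +
      x * (\<Sum>m\<le>k. real (k choose m) * x ^ (k - m) * ?p m)"
    by (simp add: matrix_matrix_mult_def Suc.IH)
  also have "(\<Sum>l\<in>UNIV. A $ i $ l * (\<Sum>m\<le>k. real (k choose m) * x ^ (k - m) * mat_pow A m $ l $ j)) =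
      (\<Sum>m\<le>k. real (k choose m) * x ^ (k - m) * ?p (Suc m))"
    unfolding sum_distrib_left mat_pow_Suc matrix_matrix_mult_def vec_lambda_beta
    by (subst sum.swap) (intro sum.cong refl, simp)
  also have "x * (\<Sum>m\<le>k. real (k choose m) * x ^ (k - m) * ?p m) =
      (\<Sum>m\<le>k. real (k choose m) * x ^ (Suc k - m) * ?p m)"
    unfolding sum_distrib_left by (intro sum.cong) (auto simp: Suc_diff_le)
  \<comment> \<open>With \<open>m = 0\<close> split off, both sums run over
    \<open>?p (Suc m)\<close> and Pascal's rule adds their coefficients. The top term of the shifted
    sum vanishes because \<open>k choose Suc k = 0\<close>.\<close>
  also have "\<dots> = x ^ Suc k * ?p 0 + (\<Sum>m\<le>k. real (k choose Suc m) * x ^ (k - m) * ?p (Suc m))"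
    using sum.atMost_Suc_shift[of "\<lambda>m. real (k choose m) * x ^ (Suc k - m) * ?p m" k]
    by (simp add: binomial_eq_0)
  finally show ?case
    by (simp add: sum.atMost_Suc_shift sum.distrib distrib_right del: sum.atMost_Suc)
qed

text \<open>A multiple of the identity can be added to make all entries nonnegative, at the price of
  a scalar factor. This reduces Metzler matrices (nonnegative off the diagonal) to nonnegative
  ones.\<close>

lemma mat_exp_shift:
  fixes A :: "real^'n::finite^'n"
  shows "mat_exp (t *\<^sub>R (A + x *\<^sub>R mat 1)) = exp (t * x) *\<^sub>R mat_exp (t *\<^sub>R A)"
proof -
  have "mat_exp (t *\<^sub>R (A + x *\<^sub>R mat 1)) $ i $ j = mat_exp (t *\<^sub>R A) $ i $ j * exp (t * x)" for i j
  proof -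
    let ?f = "\<lambda>k. mat_pow A k $ i $ j / fact k * t ^ k"
    let ?g = "\<lambda>k. (t * x) ^ k /\<^sub>R fact k"
    have "(\<lambda>k. \<Sum>m\<le>k. ?f m * ?g (k - m)) sums (mat_exp (t *\<^sub>R A) $ i $ j * exp (t * x))"
    proof -
      have "(\<lambda>k. \<Sum>m\<le>k. ?f m * ?g (k - m)) sums (suminf ?f * suminf ?g)"
        using abs_summable_mat_pow_entry summable_norm_exp[of "t * x"]
        by (intro Cauchy_product_sums) (simp_all only: real_norm_def)
      then show ?thesis
        by (simp only: sums_unique[OF mat_exp_sums, symmetric] sums_unique[OF exp_converges, symmetric])
    qed
    moreover have "(\<Sum>m\<le>k. ?f m * ?g (k - m)) =
        mat_pow (A + x *\<^sub>R mat 1) k $ i $ j / fact k * t ^ k" for k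
    proof -
      have "?f m * ?g (k - m) = real (k choose m) * x ^ (k - m) * mat_pow A m $ i $ j / fact k * t ^ k"
        if "m \<le> k" for m
      proof -
        have "t ^ k = t ^ m * t ^ (k - m)" using that by (simp flip: power_add)
        then show ?thesis using that
          by (simp add: binomial_fact power_mult_distrib field_simps)
      qed
      then show ?thesis
        unfolding mat_pow_shift_entry sum_divide_distrib sum_distrib_right by simp
    qed
    ultimately have "(\<lambda>k. mat_pow (A + x *\<^sub>R mat 1) k $ i $ j / fact k * t ^ k) sums
        (mat_exp (t *\<^sub>R A) $ i $ j * exp (t * x))"
      by (simp only:)
    then show ?thesis
      by (rule sums_unique2[OF mat_exp_sums])
  qed
  then show ?thesis by (simp add: vec_eq_iff)
qed

section \<open>Nonnegative and Metzler matrices: positivity and decay of the exponential\<close>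

lemma mat_pow_nonneg:
  assumes "\<And>i j. 0 \<le> A $ i $ j"
  shows "0 \<le> mat_pow A k $ i $ j"
  by (induction k arbitrary: i j)
    (auto simp: mat_def mat_pow_Suc matrix_matrix_mult_def assms intro!: sum_nonneg)

text \<open>The left-hand side consists of the terms \<open>k = 0\<close> and \<open>k = 1\<close>
  of a series without negative terms.\<close>

lemma mat_exp_ge_linear:
  assumes "\<And>i j. 0 \<le> A $ i $ j" "0 \<le> t"
  shows "mat 1 $ i $ j + t * A $ i $ j \<le> mat_exp (t *\<^sub>R A) $ i $ j"
  using sum_le_suminf[OF summable_mat_pow_entry, of "{0, 1}" A i j t]
  unfolding sums_unique[OF mat_exp_sums] by (simp add: mat_pow_nonneg assms mult.commute)

lemma metzler_shift_nonneg:
  fixes A :: "real^'n::finite^'n"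
  assumes "\<And>i j. i \<noteq> j \<Longrightarrow> 0 \<le> A $ i $ j"
  shows "0 \<le> (A + (\<Sum>l\<in>UNIV. \<bar>A $ l $ l\<bar>) *\<^sub>R mat 1) $ i $ j"
proof (cases "i = j")
  case True
  have "\<bar>A $ i $ i\<bar> \<le> (\<Sum>l\<in>UNIV. \<bar>A $ l $ l\<bar>)" by (intro member_le_sum) auto
  with True show ?thesis by (simp add: mat_def)
qed (simp add: assms mat_def)

text \<open>The linear lower bound is applied to the shifted, nonnegative matrix and the shift is
  undone by an exponential factor. The off-diagonal first-order term is retained because strict
  positivity of the flow will come from it.\<close>

lemma metzler_mat_exp_ge:
  fixes A :: "real^'n::finite^'n"
  assumes "\<And>i j. i \<noteq> j \<Longrightarrow> 0 \<le> A $ i $ j" "0 \<le> t"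
  shows "exp (- (t * (\<Sum>l\<in>UNIV. \<bar>A $ l $ l\<bar>))) *
      (mat 1 $ i $ j + t * (if i = j then 0 else A $ i $ j)) \<le> mat_exp (t *\<^sub>R A) $ i $ j"
proof -
  let ?x = "\<Sum>l\<in>UNIV. \<bar>A $ l $ l\<bar>"
  have nn: "0 \<le> (A + ?x *\<^sub>R mat 1) $ i $ j" for i j
    by (rule metzler_shift_nonneg[OF assms(1)])
  have "mat 1 $ i $ j + t * (if i = j then 0 else A $ i $ j) \<le>
      mat 1 $ i $ j + t * (A + ?x *\<^sub>R mat 1) $ i $ j"
    using nn[of i i] assms(2) by (auto simp: mat_def intro!: mult_nonneg_nonneg)
  also have "\<dots> \<le> exp (t * ?x) * mat_exp (t *\<^sub>R A) $ i $ j"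
    using mat_exp_ge_linear[OF nn assms(2), of i j] unfolding mat_exp_shift by simp
  finally show ?thesis
    by (simp add: exp_minus field_simps)
qed

lemma metzler_mat_exp_nonneg:
  fixes A :: "real^'n::finite^'n"
  assumes "\<And>i j. i \<noteq> j \<Longrightarrow> 0 \<le> A $ i $ j" "0 \<le> t"
  shows "0 \<le> mat_exp (t *\<^sub>R A) $ i $ j"
  using assms by (intro order_trans[OF _ metzler_mat_exp_ge]) (auto simp: mat_def)

text \<open>After the shift, \<open>B *v w\<close> is at most \<open>(x - c)\<close> times
  \<open>w\<close> in each entry. As \<open>B\<close> is nonnegative this can be iterated, and
  summing the exponential series and undoing the shift gives the bound. Multiplying by powers of
  \<open>x - c\<close> requires \<open>0 \<le> x - c\<close>, which holds because
  \<open>B *v w\<close> is itself nonnegative.\<close>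

lemma metzler_mat_exp_decay:
  fixes A :: "real^'n::finite^'n"
  assumes metzler: "\<And>i j. i \<noteq> j \<Longrightarrow> 0 \<le> A $ i $ j" and t: "0 \<le> t"
    and w: "\<And>i. 0 < w $ i" and Aw: "\<And>i. (A *v w) $ i \<le> - c * w $ i"
  shows "(mat_exp (t *\<^sub>R A) *v w) $ i \<le> exp (- (c * t)) * w $ i"
proof -
  define x where "x = (\<Sum>l\<in>UNIV. \<bar>A $ l $ l\<bar>)"
  define B where "B = A + x *\<^sub>R mat 1"
  have nn: "0 \<le> B $ i $ j" for i j
    unfolding B_def x_def by (rule metzler_shift_nonneg[OF metzler])
  have Bw_eq: "B *v w = A *v w + x *\<^sub>R w"
    by (simp add: B_def matrix_vector_mult_add_rdistrib scaleR_matrix_vector_assoc[symmetric])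
  have Bw: "(B *v w) $ i \<le> (x - c) * w $ i" for i
    using Aw[of i] by (simp add: Bw_eq algebra_simps)
  have "0 \<le> (B *v w) $ i" for i
    unfolding matrix_vector_mult_def using nn w by (auto intro!: sum_nonneg mult_nonneg_nonneg intro: less_imp_le)
  with Bw[of i] w[of i] have xc: "0 \<le> x - c"
    by (meson dual_order.trans mult_neg_pos not_le)
  have pw: "(mat_pow B k *v w) $ i \<le> (x - c) ^ k * w $ i" for k i
  proof (induction k arbitrary: i)
    case (Suc k)
    have "(mat_pow B (Suc k) *v w) $ i = (\<Sum>j\<in>UNIV. B $ i $ j * (mat_pow B k *v w) $ j)"
      unfolding mat_pow_Suc matrix_vector_mul_assoc[symmetric]
      by (simp add: matrix_vector_mult_def[of B])
    also have "\<dots> \<le> (\<Sum>j\<in>UNIV. B $ i $ j * ((x - c) ^ k * w $ j))"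
      by (intro sum_mono mult_left_mono Suc.IH nn)
    also have "\<dots> = (x - c) ^ k * (B *v w) $ i"
      by (simp add: matrix_vector_mult_def sum_distrib_left mult_ac)
    also have "\<dots> \<le> (x - c) ^ k * ((x - c) * w $ i)"
      using xc by (intro mult_left_mono Bw) auto
    finally show ?case by (simp add: mult_ac)
  qed simp
  have s1: "(\<lambda>k. (mat_pow B k *v w) $ i / fact k * t ^ k) sums (mat_exp (t *\<^sub>R B) *v w) $ i"
  proof -
    have "(\<lambda>k. \<Sum>j\<in>UNIV. mat_pow B k $ i $ j / fact k * t ^ k * w $ j) sums (mat_exp (t *\<^sub>R B) *v w) $ i"
      unfolding matrix_vector_mult_def vec_lambda_beta by (intro sums_sum sums_mult2 mat_exp_sums)
    moreover have "(\<Sum>j\<in>UNIV. mat_pow B k $ i $ j / fact k * t ^ k * w $ j) =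
        (mat_pow B k *v w) $ i / fact k * t ^ k" for k
      unfolding matrix_vector_mult_def vec_lambda_beta sum_divide_distrib sum_distrib_right
      by (intro sum.cong) simp_all
    ultimately show ?thesis by simp
  qed
  have s2: "(\<lambda>k. ((x - c) ^ k * w $ i) / fact k * t ^ k) sums (exp ((x - c) * t) * w $ i)"
  proof -
    have "((x - c) * t) ^ k /\<^sub>R fact k * w $ i = (x - c) ^ k * w $ i / fact k * t ^ k" for k
      by (simp add: power_mult_distrib divide_inverse)
    then show ?thesis
      using sums_mult2[OF exp_converges[of "(x - c) * t"], of "w $ i"] by simp
  qed
  have "(mat_exp (t *\<^sub>R B) *v w) $ i \<le> exp ((x - c) * t) * w $ i"
    by (rule sums_le[OF _ s1 s2]) (intro mult_right_mono divide_right_mono pw, use t in auto)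
  then have "exp (t * x) * (mat_exp (t *\<^sub>R A) *v w) $ i \<le> exp (x * t - c * t) * w $ i"
    unfolding B_def mat_exp_shift by (simp add: scaleR_matrix_vector_assoc[symmetric] algebra_simps)
  also have "\<dots> = exp (t * x) * (exp (- (c * t)) * w $ i)"
    by (simp add: exp_diff exp_minus field_simps)
  finally show ?thesis by simp
qed

section \<open>Laplace transforms of measures on the orthant\<close>

text \<open>The indicator of a nonempty closed set is a pointwise limit of continuous functions with
  values in the unit interval, built from \<open>infdist\<close>. Closed sets are stable under
  intersection and generate the Borel sets. The empty set is treated apart, since
  \<open>infdist\<close> to it is zero everywhere.\<close>

lemma prob_measure_eqI_continuous:
  fixes M N :: "'a::metric_space measure"
  assumes M: "prob_space M" "sets M = sets borel" and N: "prob_space N" "sets N = sets borel"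
    and eq: "\<And>f. continuous_on UNIV f \<Longrightarrow> (\<And>x. 0 \<le> f x \<and> f x \<le> (1::real)) \<Longrightarrow>
      (\<integral>x. f x \<partial>M) = (\<integral>x. f x \<partial>N)"
  shows "M = N"
proof -
  interpret M: prob_space M by fact
  interpret N: prob_space N by fact
  have meas_eq: "measure M C = measure N C" if C: "closed C" "C \<noteq> {}" for C
  proof -
    define f where "f m x = max 0 (1 - real m * infdist x C)" for m x
    have f_bd: "0 \<le> f m x \<and> f m x \<le> 1" for m x
      by (auto simp: f_def infdist_nonneg)
    have f_cont: "continuous_on UNIV (f m)" for m
      unfolding f_def by (intro continuous_intros)
    have f_lim: "(\<lambda>m. f m x) \<longlonglongrightarrow> indicator C x" for x
    proof (cases "x \<in> C")
      case True
      then show ?thesis by (simp add: f_def infdist_zero)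
    next
      case False
      then have "infdist x C > 0"
        using C in_closed_iff_infdist_zero[of C x] infdist_nonneg[of x C] by fastforce
      then obtain k :: nat where k: "1 < real k * infdist x C"
        using ex_less_of_nat_mult by blast
      have "f m x = 0" if "m \<ge> k" for m
      proof -
        have "real k * infdist x C \<le> real m * infdist x C"
          using that by (intro mult_right_mono) (auto simp: infdist_nonneg)
        with k show ?thesis by (simp add: f_def)
      qed
      then have "eventually (\<lambda>m. f m x = 0) sequentially"
        unfolding eventually_sequentially by blast
      with False show ?thesis by (simp add: tendsto_eventually)
    qed
    have lim: "(\<lambda>m. \<integral>x. f m x \<partial>L) \<longlonglongrightarrow> measure L C" if L: "prob_space L" "sets L = sets borel" for L
    proof -
      interpret L: prob_space L by fact
      have f_meas: "f m \<in> borel_measurable L" for m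
        using borel_measurable_continuous_onI[OF f_cont[of m]]
        by (simp add: measurable_cong_sets[OF L(2) refl])
      have CL: "C \<in> sets L" using C L(2) by simp
      have "(\<lambda>m. \<integral>x. f m x \<partial>L) \<longlonglongrightarrow> (\<integral>x. indicator C x \<partial>L)"
        by (rule integral_dominated_convergence[where w = "\<lambda>_. 1"])
          (use f_meas f_lim f_bd CL in auto)
      then show ?thesis using CL by (simp add: L.emeasure_eq_measure)
    qed
    show ?thesis
      using LIMSEQ_unique[OF lim[OF M] lim[OF N, folded eq[OF f_cont f_bd]]] by simp
  qed
  show ?thesis
  proof (rule measure_eqI_generator_eq[where E = "Collect closed" and \<Omega> = UNIV and A = "\<lambda>_. UNIV"])
    show "Int_stable (Collect closed :: 'a set set)" by (auto intro!: Int_stableI)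
    show "emeasure M X = emeasure N X" if "X \<in> Collect closed" for X
      using that meas_eq[of X] by (cases "X = {}") (auto simp: M.emeasure_eq_measure N.emeasure_eq_measure)
    show "sets M = sigma_sets UNIV (Collect closed)" "sets N = sigma_sets UNIV (Collect closed)"
      using M N by (simp_all add: borel_eq_closed)
  qed auto
qed

lemma borel_measurable_vec_lambda:
  fixes f :: "'n::finite \<Rightarrow> 'a \<Rightarrow> real"
  assumes "\<And>i. f i \<in> borel_measurable M"
  shows "(\<lambda>x. \<chi> i. f i x) \<in> borel_measurable M"
  unfolding borel_measurable_euclidean_space[of "\<lambda>x. \<chi> i. f i x"]
  by (auto simp: Basis_vec_def inner_axis assms)

lemma integrable_laplace_exp:
  fixes M :: "(real^'n::finite) measure"
  assumes M: "finite_measure M" "sets M = sets borel" "AE x in M. \<forall>i. 0 \<le> x $ i"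
    and s: "\<And>i. 0 \<le> s $ i"
    and h: "h \<in> borel_measurable borel" "\<And>x. (\<forall>i. 0 \<le> x $ i) \<Longrightarrow> \<bar>h x\<bar> \<le> B"
  shows "integrable M (\<lambda>x. h x * exp (- (s \<bullet> x)))"
proof (rule finite_measure.integrable_const_bound[OF M(1), where B = B])
  have "\<bar>h x\<bar> * exp (- (s \<bullet> x)) \<le> B * 1" if "\<forall>i. 0 \<le> x $ i" for x
    using s that h(2)[OF that]
    using that s by (intro mult_mono) (auto simp: inner_vec_def intro!: sum_nonneg)
  then show "AE x in M. norm (h x * exp (- (s \<bullet> x))) \<le> B"
    using M(3) by (auto simp: abs_mult)
  have "h \<in> borel_measurable M" using h(1) by (simp add: measurable_cong_sets[OF M(2) refl])
  moreover have "(\<lambda>x. exp (- (s \<bullet> x))) \<in> borel_measurable M"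
    unfolding measurable_cong_sets[OF M(2) refl] by measurable
  ultimately show "(\<lambda>x. h x * exp (- (s \<bullet> x))) \<in> borel_measurable M" by simp
qed

lemma exp_minus_vec_in_cbox:
  "(\<forall>i. 0 \<le> x $ i) \<Longrightarrow> (\<chi> i. exp (- x $ i)) \<in> cbox 0 (1::real^'n::finite)"
  by (simp add: mem_box_cart)

text \<open>
  The map \<open>x \<mapsto> exp (- x)\<close> takes the orthant into the compact cube, where polynomials are dense;
  a polynomial in \<open>exp (- x)\<close> is a combination of the functions \<open>x \<mapsto> exp (- (s \<bullet> x))\<close>.
\<close>

lemma laplace_transform_unique:
  fixes M N :: "(real^'n::finite) measure"
  assumes M: "prob_space M" "sets M = sets borel" "AE x in M. \<forall>i. 0 \<le> x $ i"
    and N: "prob_space N" "sets N = sets borel" "AE x in N. \<forall>i. 0 \<le> x $ i"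
    and eq: "\<And>s. (\<And>i. 0 \<le> s $ i) \<Longrightarrow>
      (\<integral>x. exp (- (s \<bullet> x)) \<partial>M) = (\<integral>x. exp (- (s \<bullet> x)) \<partial>N)"
  shows "M = N"
proof -
  interpret M: prob_space M by fact
  interpret N: prob_space N by fact
  define y where "y x = (\<chi> i. exp (- x $ i))" for x :: "real^'n"
  \<comment> \<open>\<open>good h\<close> says that the transforms weighted by \<open>h\<close>
    agree. Quantifying over all nonnegative \<open>s\<close> closes the class under multiplication
    by a coordinate of \<open>y\<close>, which merely adds a unit vector to \<open>s\<close>;
    induction then yields all polynomials in \<open>y\<close>.\<close>
  define good where "good h \<longleftrightarrow> h \<in> borel_measurable borel \<and>
    (\<exists>B. \<forall>x. (\<forall>i. 0 \<le> x $ i) \<longrightarrow> \<bar>h x\<bar> \<le> B) \<and>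
    (\<forall>s. (\<forall>i. 0 \<le> s $ i) \<longrightarrow>
      (\<integral>x. h x * exp (- (s \<bullet> x)) \<partial>M) = (\<integral>x. h x * exp (- (s \<bullet> x)) \<partial>N))"
    for h :: "real^'n \<Rightarrow> real"
  have y_cont: "continuous_on UNIV y"
    unfolding y_def by (intro continuous_intros)
  have y_meas: "y \<in> borel_measurable borel"
    by (rule borel_measurable_continuous_onI[OF y_cont])
  have good_int: "integrable M (\<lambda>x. h x * exp (- (s \<bullet> x)))" "integrable N (\<lambda>x. h x * exp (- (s \<bullet> x)))"
    if "good h" "\<And>i. 0 \<le> s $ i" for h s
    using that integrable_laplace_exp[OF M.finite_measure_axioms M(2,3)]
      integrable_laplace_exp[OF N.finite_measure_axioms N(2,3)]
    unfolding good_def by metis+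
  have good_add: "good (\<lambda>x. f x + g x)" if f: "good f" and g: "good g" for f g
  proof -
    obtain B C where "\<forall>x. (\<forall>i. 0 \<le> x $ i) \<longrightarrow> \<bar>f x\<bar> \<le> B" "\<forall>x. (\<forall>i. 0 \<le> x $ i) \<longrightarrow> \<bar>g x\<bar> \<le> C"
      using f g unfolding good_def by blast
    then have "\<forall>x. (\<forall>i. 0 \<le> x $ i) \<longrightarrow> \<bar>f x + g x\<bar> \<le> B + C"
      by (meson abs_triangle_ineq add_mono order_trans)
    then show ?thesis
      using f g good_int[OF f] good_int[OF g] unfolding good_def distrib_right
      by (auto simp: good_def)
  qed
  have good_scale: "good (\<lambda>x. c * f x)" if f: "good f" for f c
  proof -
    obtain B where "\<forall>x. (\<forall>i. 0 \<le> x $ i) \<longrightarrow> \<bar>f x\<bar> \<le> B"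
      using f unfolding good_def by blast
    then have "\<forall>x. (\<forall>i. 0 \<le> x $ i) \<longrightarrow> \<bar>c * f x\<bar> \<le> \<bar>c\<bar> * B"
      by (simp add: abs_mult mult_left_mono)
    then show ?thesis
      using f unfolding good_def mult.assoc by auto
  qed
  have good_coord: "good (\<lambda>x. f x * y x $ i)" if f: "good f" for f i
  proof -
    obtain B where B: "\<forall>x. (\<forall>i. 0 \<le> x $ i) \<longrightarrow> \<bar>f x\<bar> \<le> B"
      using f unfolding good_def by blast
    have "\<bar>f x * y x $ i\<bar> \<le> B" if "\<forall>i. 0 \<le> x $ i" for x
      using mult_mono[of "\<bar>f x\<bar>" B "exp (- x $ i)" 1] B that
      by (auto simp: abs_mult y_def intro: order_trans[OF abs_ge_zero])
    moreover have "f x * y x $ i * exp (- (s \<bullet> x)) = f x * exp (- ((s + axis i 1) \<bullet> x))" for x s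
      by (simp add: y_def inner_add_left inner_axis_axis inner_axis' exp_add exp_diff exp_minus field_simps)
    moreover have "\<forall>j. 0 \<le> (s + axis i 1) $ j" if "\<forall>j. 0 \<le> s $ j" for s :: "real^'n"
      using that by (simp add: axis_def)
    moreover have "(\<lambda>x. f x * y x $ i) \<in> borel_measurable borel"
    proof -
      have "(\<lambda>x. y x $ i) \<in> borel_measurable borel"
        using measurable_compose[OF y_meas, of "\<lambda>v. v $ i" borel] by simp
      moreover have "f \<in> borel_measurable borel" using f by (simp add: good_def)
      ultimately show ?thesis by (intro borel_measurable_times)
    qed
    ultimately show ?thesis
      using f unfolding good_def by (simp only:) blast
  qed
  have good_zero: "good (\<lambda>x. 0)" by (auto simp: good_def)
  have good_sum: "good (\<lambda>x. \<Sum>i\<in>I. f i x)" if "finite I" "\<And>i. i \<in> I \<Longrightarrow> good (f i)" for f and I :: "'n set"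
    using that by (induction I rule: finite_induct) (auto intro: good_add good_zero)
  have good_poly: "good (\<lambda>x. h x * q (y x))" if "real_polynomial_function q" "good h" for q h
    using that
  proof (induction q arbitrary: h rule: real_polynomial_function.induct)
    case (linear f)
    have lin: "f z = (\<Sum>i\<in>UNIV. f (axis i 1) * z $ i)" for z
    proof -
      have "f z = f (\<Sum>i\<in>UNIV. z $ i *\<^sub>R axis i 1)"
        using basis_expansion[of z] by (simp add: scalar_mult_eq_scaleR)
      also have "\<dots> = (\<Sum>i\<in>UNIV. f (axis i 1) * z $ i)"
        using linear(1) by (simp add: bounded_linear.linear linear_sum linear_scale mult.commute)
      finally show ?thesis .
    qed
    have "good (\<lambda>x. \<Sum>i\<in>UNIV. f (axis i 1) * (h x * y x $ i))"
      by (intro good_sum good_scale good_coord linear) auto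
    then show ?case
      by (subst lin) (simp add: sum_distrib_left mult_ac)
  next
    case (const c)
    then show ?case using good_scale[of h c] by (simp add: mult.commute)
  next
    case (add f g)
    then show ?case by (simp add: distrib_left good_add)
  next
    case (mult f g)
    then show ?case by (simp add: mult.assoc[symmetric])
  qed
  have good_one: "good (\<lambda>x. 1)"
    using eq by (auto simp: good_def)
  have poly_eq: "(\<integral>x. q (y x) \<partial>M) = (\<integral>x. q (y x) \<partial>N)"
    and poly_int: "integrable M (\<lambda>x. q (y x))" "integrable N (\<lambda>x. q (y x))"
    if "real_polynomial_function q" for q
    using good_poly[OF that good_one] good_int[OF good_poly[OF that good_one], of 0]
    by (auto simp: good_def dest: spec[of _ 0])
  have cube: "AE x in M. y x \<in> cbox 0 1" "AE x in N. y x \<in> cbox 0 1"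
    unfolding y_def
    by (rule eventually_mono[OF M(3)], erule exp_minus_vec_in_cbox)
      (rule eventually_mono[OF N(3)], erule exp_minus_vec_in_cbox)
  have cont_eq: "(\<integral>x. f (y x) \<partial>M) = (\<integral>x. f (y x) \<partial>N)"
    if f: "continuous_on UNIV f" "\<And>z. 0 \<le> f z \<and> f z \<le> (1::real)" for f
  proof (rule ccontr)
    assume ne: "\<not> ?thesis"
    \<comment> \<open>Replacing \<open>f\<close> by a polynomial costs at most \<open>e\<close>
      under each measure, and two such errors cannot bridge a gap of \<open>3 * e\<close>.\<close>
    define e where "e = \<bar>(\<integral>x. f (y x) \<partial>M) - (\<integral>x. f (y x) \<partial>N)\<bar> / 3"
    have e: "e > 0" using ne by (simp add: e_def)
    obtain q where q: "real_polynomial_function q" "\<And>z. z \<in> cbox 0 1 \<Longrightarrow> \<bar>f z - q z\<bar> < e"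
      using Stone_Weierstrass_real_polynomial_function[OF compact_cbox continuous_on_subset[OF f(1)] e]
      by (metis subset_UNIV)
    have near: "\<bar>(\<integral>x. f (y x) \<partial>L) - (\<integral>x. q (y x) \<partial>L)\<bar> \<le> e"
      if L: "prob_space L" "sets L = sets borel" "AE x in L. y x \<in> cbox 0 1" "integrable L (\<lambda>x. q (y x))" for L
    proof -
      interpret L: prob_space L by fact
      have fy: "(\<lambda>x. f (y x)) \<in> borel_measurable L"
        unfolding measurable_cong_sets[OF L(2) refl]
        by (intro borel_measurable_continuous_onI continuous_on_compose2[OF f(1) y_cont]) auto
      have int: "integrable L (\<lambda>x. f (y x))"
        using f(2) by (intro L.integrable_const_bound[where B = 1] fy) auto
      have "\<bar>(\<integral>x. f (y x) \<partial>L) - (\<integral>x. q (y x) \<partial>L)\<bar> = \<bar>\<integral>x. f (y x) - q (y x) \<partial>L\<bar>"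
        using int L(4) by simp
      also have "\<dots> \<le> (\<integral>x. \<bar>f (y x) - q (y x)\<bar> \<partial>L)" by (rule integral_abs_bound)
      also have "\<dots> \<le> (\<integral>x. e \<partial>L)"
        using int L(3,4) q(2) by (intro integral_mono_AE) (auto elim!: eventually_mono intro: less_imp_le)
      finally show ?thesis by (simp add: L.prob_space)
    qed
    have "\<bar>(\<integral>x. f (y x) \<partial>M) - (\<integral>x. f (y x) \<partial>N)\<bar> \<le> 2 * e"
      using near[OF M(1,2) cube(1) poly_int(1)[OF q(1)]] near[OF N(1,2) cube(2) poly_int(2)[OF q(1)]]
        poly_eq[OF q(1)] by linarith
    then show False using e by (simp add: e_def)
  qed
  have yM: "y \<in> measurable M borel" and yN: "y \<in> measurable N borel"
    using y_meas unfolding measurable_cong_sets[OF M(2) refl] measurable_cong_sets[OF N(2) refl] by auto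
  have distr_eq: "distr M borel y = distr N borel y"
  proof (rule prob_measure_eqI_continuous)
    fix f :: "real^'n \<Rightarrow> real"
    assume f: "continuous_on UNIV f" "\<And>x. 0 \<le> f x \<and> f x \<le> 1"
    then have "f \<in> borel_measurable borel" by (intro borel_measurable_continuous_onI)
    then show "(\<integral>x. f x \<partial>distr M borel y) = (\<integral>x. f x \<partial>distr N borel y)"
      using cont_eq[OF f] by (simp add: integral_distr yM yN)
  qed (auto intro: M.prob_space_distr N.prob_space_distr yM yN)
  \<comment> \<open>A measurable left inverse of \<open>y\<close> recovers \<open>M\<close> and
    \<open>N\<close> from their images under \<open>y\<close>.\<close>
  define yinv where "yinv z = (\<chi> i. - ln (z $ i))" for z :: "real^'n"
  have inv: "yinv \<in> borel_measurable borel"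
    unfolding yinv_def by (intro borel_measurable_vec_lambda) measurable
  have "yinv \<circ> y = id" by (auto simp: yinv_def y_def fun_eq_iff vec_eq_iff)
  then have id: "distr (distr L borel y) borel yinv = L"
    if "sets L = sets borel" "y \<in> measurable L borel" for L
    using distr_distr[OF inv that(2)] distr_id2[OF that(1)[symmetric]] by (simp add: id_def)
  have "M = distr (distr M borel y) borel yinv" by (rule id[OF M(2) yM, symmetric])
  also have "\<dots> = N" unfolding distr_eq by (rule id[OF N(2) yN])
  finally show ?thesis .
qed

section \<open>Jump times of a Poisson process\<close>

abbreviation grid :: "real \<Rightarrow> nat \<Rightarrow> nat \<Rightarrow> real" where
  "grid t m i \<equiv> t * real i / real m"

text \<open>The index of the cell containing \<tau> among the \<open>m\<close> cells of the grid on
  \<open>{0..t}\<close>. Cells are numbered from 0, hence the \<open>- 1\<close>. They are open on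
  the left and closed on the right, matching the fact that a jump time is at most \<open>u\<close>
  exactly if the jump is counted by \<open>N u\<close>.\<close>

definition cell :: "real \<Rightarrow> real \<Rightarrow> nat \<Rightarrow> nat" where
  "cell t \<tau> m = nat \<lceil>\<tau> * real m / t\<rceil> - 1"

lemma
  assumes "0 < \<tau>" "\<tau> \<le> t" "0 < m"
  shows cell_less: "cell t \<tau> m < m"
    and cell_iff: "grid t m i < \<tau> \<and> \<tau> \<le> grid t m (Suc i) \<longleftrightarrow> i = cell t \<tau> m"
proof -
  define x where "x = \<tau> * real m / t"
  have t: "0 < t" using assms by simp
  have x: "0 < x" "x \<le> real m" using assms t by (simp_all add: x_def field_simps)
  have c: "0 < \<lceil>x\<rceil>" "\<lceil>x\<rceil> \<le> int m" using x by (simp_all add: ceiling_le_iff)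
  show "cell t \<tau> m < m" using c assms(3) unfolding cell_def x_def[symmetric] by linarith
  have "grid t m i < \<tau> \<longleftrightarrow> real i < x" "\<tau> \<le> grid t m (Suc i) \<longleftrightarrow> x \<le> real (Suc i)"
    using t assms(3) by (simp_all add: x_def field_simps)
  moreover have "real i < x \<and> x \<le> real (Suc i) \<longleftrightarrow> \<lceil>x\<rceil> = int i + 1"
    by (auto simp: ceiling_eq_iff)
  moreover have "\<lceil>x\<rceil> = int i + 1 \<longleftrightarrow> i = nat \<lceil>x\<rceil> - 1"
    using c by linarith
  ultimately show "grid t m i < \<tau> \<and> \<tau> \<le> grid t m (Suc i) \<longleftrightarrow> i = cell t \<tau> m"
    unfolding cell_def x_def[symmetric] by (simp only:)
qed

text \<open>A cell has width \<open>t / m\<close>, so any point chosen in the cell of \<tau> is that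
  close to \<tau>. The choice \<xi> is left free: it will be the right endpoint or a mean value
  point.\<close>

lemma tendsto_cell:
  assumes "0 < \<tau>" "\<tau> \<le> t"
    and \<xi>: "\<And>m i. i < m \<Longrightarrow> \<xi> m i \<in> {grid t m i .. grid t m (Suc i)}"
    and G: "continuous_on {0..t} G"
  shows "(\<lambda>m. G (\<xi> m (cell t \<tau> m))) \<longlonglongrightarrow> G \<tau>"
proof -
  have t: "0 < t" using assms by simp
  have near: "\<bar>\<xi> m (cell t \<tau> m) - \<tau>\<bar> \<le> t * (1 / real m) \<and> \<xi> m (cell t \<tau> m) \<in> {0..t}" if "0 < m" for m
  proof -
    let ?i = "cell t \<tau> m"
    have c: "?i < m" "t * real ?i / real m < \<tau>" "\<tau> \<le> t * real (Suc ?i) / real m"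
      using cell_less[OF assms(1,2) that] cell_iff[OF assms(1,2) that, of ?i] by auto
    have "real (Suc ?i) \<le> real m" using c(1) by simp
    then have "t * real (Suc ?i) \<le> t * real m" using t by (intro mult_left_mono) auto
    then have "t * real (Suc ?i) / real m \<le> t" using that by (simp add: pos_divide_le_eq)
    moreover have "0 \<le> t * real ?i / real m" using t by simp
    moreover have "t * real (Suc ?i) / real m = t * real ?i / real m + t * (1 / real m)"
      by (simp add: distrib_left add_divide_distrib)
    ultimately show ?thesis using \<xi>[OF c(1)] c(2,3) unfolding atLeastAtMost_iff by linarith
  qed
  have "(\<lambda>m. t * (1 / real m)) \<longlonglongrightarrow> t * 0"
    by (intro tendsto_mult tendsto_const lim_const_over_n)
  then have null: "(\<lambda>m. t * (1 / real m)) \<longlonglongrightarrow> 0" by (simp only: mult_zero_right)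
  have "eventually (\<lambda>m. norm (\<xi> m (cell t \<tau> m) - \<tau>) \<le> t * (1 / real m)) sequentially"
    by (rule eventually_sequentiallyI[of 1], unfold real_norm_def, rule near[THEN conjunct1]) simp
  then have "(\<lambda>m. \<xi> m (cell t \<tau> m) - \<tau>) \<longlonglongrightarrow> 0"
    using null by (rule Lim_null_comparison)
  then have "(\<lambda>m. \<xi> m (cell t \<tau> m)) \<longlonglongrightarrow> \<tau>" by (simp add: LIM_zero_iff)
  then show ?thesis
  proof (rule continuous_on_tendsto_compose[OF G])
    show "\<tau> \<in> {0..t}" using assms(1,2) by simp
    show "eventually (\<lambda>m. \<xi> m (cell t \<tau> m) \<in> {0..t}) sequentially"
      by (rule eventually_sequentiallyI[of 1], rule near[THEN conjunct2]) simp
  qed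
qed

text \<open>This is the mean value theorem for the antiderivative. The integral over
  \<open>{a..b}\<close> is written as a difference of integrals from 0 so that adjacent cells
  telescope.\<close>

lemma mean_value_integral:
  fixes g :: "real \<Rightarrow> real"
  assumes "continuous_on {0..t} g" "0 \<le> a" "a < b" "b \<le> t"
  obtains x where "x \<in> {a..b}" "integral {0..b} g - integral {0..a} g = (b - a) * g x"
proof -
  have "((\<lambda>x. integral {0..x} g) has_derivative (*) (g x)) (at x within {a..b})" if "x \<in> {a..b}" for x
  proof -
    have "((\<lambda>x. integral {0..x} g) has_real_derivative g x) (at x within {0..t})"
      using that assms by (intro integral_has_real_derivative) auto
    then have "((\<lambda>x. integral {0..x} g) has_real_derivative g x) (at x within {a..b})"
      by (rule DERIV_subset) (use assms in auto)
    then show ?thesis by (simp only: has_field_derivative_def)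
  qed
  then obtain x where "x \<in> {a<..<b}" "integral {0..b} g - integral {0..a} g = g x * (b - a)"
    using mvt_simple[OF assms(3), of "\<lambda>x. integral {0..x} g" "\<lambda>x. (*) (g x)"] by (metis atLeastAtMost_iff)
  then show ?thesis by (intro that[of x]) (auto simp: mult.commute)
qed

lemma poisson_pmf_pgf:
  assumes "0 < \<mu>"
  shows "measure_pmf.expectation (poisson_pmf \<mu>) (\<lambda>k. z ^ k) = exp (- (\<mu> * (1 - z)))"
proof -
  have eq: "pmf (poisson_pmf \<mu>) k * z ^ k = ((\<mu> * z) ^ k /\<^sub>R fact k) * exp (- \<mu>)" for k
    using assms by (simp add: pmf_poisson power_mult_distrib field_simps)
  have "(\<lambda>k. pmf (poisson_pmf \<mu>) k * z ^ k) sums (exp (\<mu> * z) * exp (- \<mu>))"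
    unfolding eq by (intro sums_mult2 exp_converges)
  moreover have "integrable (count_space UNIV) (\<lambda>k. pmf (poisson_pmf \<mu>) k * z ^ k)"
  proof -
    have "summable (\<lambda>k. norm ((\<mu> * z) ^ k /\<^sub>R fact k) * exp (- \<mu>))"
      by (intro summable_mult2 summable_norm_exp)
    then show ?thesis
      unfolding integrable_count_space_nat_iff eq by (simp add: abs_mult)
  qed
  ultimately have "(\<integral>k. pmf (poisson_pmf \<mu>) k * z ^ k \<partial>count_space UNIV) = exp (\<mu> * z) * exp (- \<mu>)"
    using sums_integral_count_space_nat sums_unique2 by blast
  also have "\<dots> = exp (- (\<mu> * (1 - z)))"
    by (simp flip: exp_add add: algebra_simps)
  finally show ?thesis
    by (simp add: measure_pmf_eq_density integral_density)
qed

locale poisson_clock = prob_space \<Omega> for \<Omega> :: "'w measure" +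
  fixes rate :: real and N :: "real \<Rightarrow> 'w \<Rightarrow> nat"
  assumes poisson_process: "poisson_process \<Omega> rate N" and rate_pos: "0 < rate"
begin

lemma N_measurable: "0 \<le> t \<Longrightarrow> N t \<in> measurable \<Omega> (count_space UNIV)"
  using poisson_process by (simp add: poisson_process_def)

lemma increment_measurable:
  assumes "0 \<le> s" "0 \<le> t"
  shows "(\<lambda>w. N t w - N s w) \<in> measurable \<Omega> (count_space UNIV)"
  using N_measurable[OF assms(1)] N_measurable[OF assms(2)] by measurable

lemma N_0: "w \<in> space \<Omega> \<Longrightarrow> N 0 w = 0"
  using poisson_process by (simp add: poisson_process_def)

lemma indep_increments:
  "0 \<le> s 0 \<Longrightarrow> mono s \<Longrightarrow>
    indep_vars (\<lambda>_. count_space UNIV) (\<lambda>i w. N (s (Suc i)) w - N (s i) w) {..<k}"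
  using poisson_process by (simp add: poisson_process_def)

lemma increment_distr:
  "0 \<le> s \<Longrightarrow> s < t \<Longrightarrow> distr \<Omega> (count_space UNIV) (\<lambda>w. N t w - N s w) =
    measure_pmf (poisson_pmf (rate * (t - s)))"
  using poisson_process by (simp add: poisson_process_def)

lemma N_mono: "w \<in> space \<Omega> \<Longrightarrow> 0 \<le> s \<Longrightarrow> s \<le> t \<Longrightarrow> N s w \<le> N t w"
  using poisson_process by (auto simp: poisson_process_def mono_on_def)

text \<open>The infimum in \<open>jump_time\<close> is attained: a right-continuous path with
  integer values is constant just after the jump time, so points of the set close to the infimum
  already carry the value at the infimum. The bound \<open>n \<le> N t w\<close> makes the set
  nonempty.\<close>

lemma jump_time_le_iff:
  assumes w: "w \<in> space \<Omega>" and t: "0 \<le> t" "n \<le> N t w" and u: "0 \<le> u"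
  shows "jump_time N n w \<le> u \<longleftrightarrow> n \<le> N u w"
proof
  let ?S = "{s. 0 \<le> s \<and> n \<le> N s w}"
  let ?T = "jump_time N n w"
  have ne: "t \<in> ?S" and bdd: "bdd_below ?S" using t by (auto intro: bdd_belowI)
  have T0: "0 \<le> ?T" unfolding jump_time_def by (rule cInf_greatest) (use ne in auto)
  show "?T \<le> u" if "n \<le> N u w"
    unfolding jump_time_def using that u bdd by (intro cInf_lower) auto
  assume "?T \<le> u"
  have "((\<lambda>u. N u w) \<longlongrightarrow> N ?T w) (at_right ?T)"
    using poisson_process w T0 unfolding poisson_process_def continuous_within by blast
  then have "eventually (\<lambda>u. N u w = N ?T w) (at_right ?T)"
    by (rule tendsto_discrete[THEN iffD1])
  then obtain b where b: "b > ?T" "\<And>u. ?T < u \<Longrightarrow> u < b \<Longrightarrow> N u w = N ?T w"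
    unfolding eventually_at_right_field by blast
  obtain s where s: "s \<in> ?S" "s < b"
    using b(1) cInf_less_iff[of ?S b] ne bdd unfolding jump_time_def by auto
  have "?T \<le> s" unfolding jump_time_def using s bdd by (intro cInf_lower)
  then have "n \<le> N ?T w"
    using s b(2)[of s] by (cases "s = ?T") auto
  also have "\<dots> \<le> N u w" using \<open>?T \<le> u\<close> T0 by (intro N_mono w)
  finally show "n \<le> N u w" .
qed

lemma jump_time_in:
  assumes "w \<in> space \<Omega>" "0 \<le> t" "n \<in> {1..N t w}"
  shows "0 < jump_time N n w" "jump_time N n w \<le> t"
  using jump_time_le_iff[OF assms(1,2), of n 0] jump_time_le_iff[OF assms(1,2), of n t]
    N_0[OF assms(1)] assms by (auto simp: not_le)

lemma cell_jump_time_iff: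
  assumes "w \<in> space \<Omega>" "0 \<le> t" "n \<in> {1..N t w}" "0 < m"
  shows "N (grid t m i) w < n \<and> n \<le> N (grid t m (Suc i)) w \<longleftrightarrow>
    i = cell t (jump_time N n w) m"
proof -
  have "n \<le> N (t * real k / real m) w \<longleftrightarrow> jump_time N n w \<le> t * real k / real m" for k
    using jump_time_le_iff[OF assms(1,2), of n "t * real k / real m"] assms by simp
  then show ?thesis
    using cell_iff[OF jump_time_in[OF assms(1-3)] assms(4), of i] by (simp only: not_le[symmetric])
qed

text \<open>Independence of the increments factors the expectation, and each factor is the
  generating function of a Poisson law.\<close>

lemma expectation_power_increments:
  assumes t: "0 < t" and m: "0 < m" and z: "\<And>i. i < m \<Longrightarrow> 0 \<le> z i \<and> z i \<le> 1"
  shows "expectation (\<lambda>w. \<Prod>i<m. z i ^ (N (grid t m (Suc i)) w - N (grid t m i) w)) =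
    (\<Prod>i<m. exp (- (rate * (t / real m) * (1 - z i))))"
proof -
  let ?p = "\<lambda>i. grid t m i"
  let ?D = "\<lambda>i w. N (?p (Suc i)) w - N (?p i) w"
  have p: "0 \<le> ?p i" "?p i < ?p (Suc i)" "?p (Suc i) - ?p i = t / real m" for i
    using t m by (simp_all add: field_simps)
  have "indep_vars (\<lambda>_. count_space UNIV) ?D {..<m}"
  proof -
    have "incseq ?p" using p(2) by (intro incseq_SucI less_imp_le)
    then show ?thesis
      using indep_increments[of ?p m] p(1)[of 0] by simp
  qed
  then have ind: "indep_vars (\<lambda>_. borel) (\<lambda>i w. z i ^ ?D i w) {..<m}"
    by (rule indep_vars_compose2) simp
  have D_meas: "?D i \<in> measurable \<Omega> (count_space UNIV)" for i
    by (intro increment_measurable p(1))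
  have int: "integrable \<Omega> (\<lambda>w. z i ^ ?D i w)" if "i < m" for i
    using z[OF that] D_meas[of i]
    by (intro integrable_const_bound[where B = 1]) (auto simp: power_le_one intro: measurable_compose)
  have "expectation (\<lambda>w. z i ^ ?D i w) = exp (- (rate * (t / real m) * (1 - z i)))" for i
  proof -
    have "expectation (\<lambda>w. z i ^ ?D i w) = (\<integral>k. z i ^ k \<partial>distr \<Omega> (count_space UNIV) (?D i))"
      using D_meas by (subst integral_distr) auto
    also have "distr \<Omega> (count_space UNIV) (?D i) = measure_pmf (poisson_pmf (rate * (t / real m)))"
      using increment_distr[OF p(1,2)[of i]] by (simp only: p(3))
    also have "(\<integral>k. z i ^ k \<partial>measure_pmf (poisson_pmf (rate * (t / real m)))) =
        exp (- (rate * (t / real m) * (1 - z i)))"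
      using rate_pos t m by (intro poisson_pmf_pgf) simp
    finally show ?thesis .
  qed
  then show ?thesis
    using indep_vars_lebesgue_integral[OF _ ind] int by simp
qed

text \<open>For each mesh the product over cells is a product over jumps, in which a jump
  contributes \<open>g\<close> at the point chosen in its cell. Jumps may share a cell, since the
  exponent counts them. What remains is a finite product of convergent factors.\<close>

lemma prod_jump_times_LIMSEQ:
  fixes g :: "real \<Rightarrow> real"
  assumes w: "w \<in> space \<Omega>" and t: "0 < t" and g: "continuous_on {0..t} g"
    and \<xi>: "\<And>m i. i < m \<Longrightarrow> \<xi> m i \<in> {grid t m i .. grid t m (Suc i)}"
  shows "(\<lambda>m. \<Prod>i<m. g (\<xi> m i) ^ (N (grid t m (Suc i)) w - N (grid t m i) w))
    \<longlonglongrightarrow> (\<Prod>n=1..N t w. g (jump_time N n w))"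
proof (rule Lim_transform_eventually)
  show "(\<lambda>m. \<Prod>n=1..N t w. g (\<xi> m (cell t (jump_time N n w) m)))
      \<longlonglongrightarrow> (\<Prod>n=1..N t w. g (jump_time N n w))"
    by (intro tendsto_prod tendsto_cell[where G = g] jump_time_in[OF w less_imp_le[OF t]] \<xi> g)
  have "(\<Prod>n=1..N t w. g (\<xi> m (cell t (jump_time N n w) m))) =
      (\<Prod>i<m. g (\<xi> m i) ^ (N (grid t m (Suc i)) w - N (grid t m i) w))"
    if m: "0 < m" for m
  proof -
    let ?p = "\<lambda>i. grid t m i"
    \<comment> \<open>The power is spread over all jumps up to time \<open>t\<close>, with factor 1
      for those outside the cell, so that the products over cells and over jumps can be
      interchanged.\<close>
    have "g (\<xi> m i) ^ (N (?p (Suc i)) w - N (?p i) w) =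
        (\<Prod>n=1..N t w. if N (?p i) w < n \<and> n \<le> N (?p (Suc i)) w then g (\<xi> m i) else 1)" if i: "i < m" for i
    proof -
      have "t * real (Suc i) \<le> t * real m" using i t by (intro mult_left_mono) auto
      then have "?p (Suc i) \<le> t" using m by (simp add: pos_divide_le_eq)
      then have "N (?p (Suc i)) w \<le> N t w" using t by (intro N_mono w) auto
      then have "{1..N t w} \<inter> {n. N (?p i) w < n \<and> n \<le> N (?p (Suc i)) w} =
          {N (?p i) w<..N (?p (Suc i)) w}"
        by auto
      then show ?thesis by (simp add: prod.If_cases del: of_nat_Suc)
    qed
    then have "(\<Prod>i<m. g (\<xi> m i) ^ (N (?p (Suc i)) w - N (?p i) w)) =
        (\<Prod>n=1..N t w. \<Prod>i<m. if N (?p i) w < n \<and> n \<le> N (?p (Suc i)) w then g (\<xi> m i) else 1)"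
      by (subst prod.swap) (simp del: of_nat_Suc)
    also have "\<dots> = (\<Prod>n=1..N t w. g (\<xi> m (cell t (jump_time N n w) m)))"
    proof (rule prod.cong[OF refl])
      fix n assume n: "n \<in> {1..N t w}"
      have "cell t (jump_time N n w) m < m"
        using jump_time_in[OF w _ n] t m by (intro cell_less) auto
      then show "(\<Prod>i<m. if N (?p i) w < n \<and> n \<le> N (?p (Suc i)) w then g (\<xi> m i) else 1) =
          g (\<xi> m (cell t (jump_time N n w) m))"
        using t by (simp only: cell_jump_time_iff[OF w less_imp_le[OF t] n m]) (simp add: prod.delta)
    qed
    finally show ?thesis by simp
  qed
  then show "eventually (\<lambda>m. (\<Prod>n=1..N t w. g (\<xi> m (cell t (jump_time N n w) m))) =
      (\<Prod>i<m. g (\<xi> m i) ^ (N (grid t m (Suc i)) w - N (grid t m i) w))) sequentially"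
    by (intro eventually_sequentiallyI[of 1]) auto
qed

text \<open>
  Evaluating \<open>g\<close> at mean value points of the cells makes the discretised expectation equal to the
  limit for every mesh.
\<close>

theorem expectation_prod_jump_times:
  fixes g :: "real \<Rightarrow> real"
  assumes t: "0 < t" and g: "continuous_on {0..t} g" "\<And>v. v \<in> {0..t} \<Longrightarrow> 0 \<le> g v \<and> g v \<le> 1"
  shows "expectation (\<lambda>w. \<Prod>n=1..N t w. g (jump_time N n w)) =
    exp (- (rate * integral {0..t} (\<lambda>v. 1 - g v)))"
proof -
  let ?p = "\<lambda>m i. grid t m i"
  let ?F = "\<lambda>b. integral {0..b} (\<lambda>v. 1 - g v)"
  have p_le: "?p m (Suc i) \<le> t" if "i < m" for m i
  proof -
    have "t * real (Suc i) \<le> t * real m" using that t by (intro mult_left_mono) auto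
    then show ?thesis using that by (simp add: pos_divide_le_eq)
  qed
  have ex: "\<exists>x. x \<in> {?p m i..?p m (Suc i)} \<and> ?F (?p m (Suc i)) - ?F (?p m i) = t / real m * (1 - g x)"
    if im: "i < m" for m i
  proof -
    have "?p m (Suc i) - ?p m i = t / real m" using im by (simp add: field_simps)
    moreover have "?p m i < ?p m (Suc i)" using im t by (simp add: divide_strict_right_mono)
    moreover have "continuous_on {0..t} (\<lambda>v. 1 - g v)" by (intro continuous_intros g)
    moreover have "0 \<le> ?p m i" using t by simp
    ultimately obtain x where "x \<in> {?p m i..?p m (Suc i)}"
      "?F (?p m (Suc i)) - ?F (?p m i) = (?p m (Suc i) - ?p m i) * (1 - g x)"
      using mean_value_integral[of t "\<lambda>v. 1 - g v" "?p m i" "?p m (Suc i)"] p_le[OF im] by blast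
    with \<open>?p m (Suc i) - ?p m i = t / real m\<close> show ?thesis by (intro exI[of _ x]) (simp only:)
  qed
  define \<xi> where "\<xi> m i = (SOME x. x \<in> {?p m i..?p m (Suc i)} \<and>
    ?F (?p m (Suc i)) - ?F (?p m i) = t / real m * (1 - g x))" for m i
  have \<xi>: "\<xi> m i \<in> {?p m i..?p m (Suc i)}"
    "?F (?p m (Suc i)) - ?F (?p m i) = t / real m * (1 - g (\<xi> m i))" if "i < m" for m i
    using someI_ex[OF ex[OF that]] unfolding \<xi>_def by blast+
  have \<xi>_in: "\<xi> m i \<in> {0..t}" if "i < m" for m i
  proof -
    have "0 \<le> ?p m i" using t by simp
    then show ?thesis using \<xi>(1)[OF that] p_le[OF that] unfolding atLeastAtMost_iff by linarith
  qed
  let ?R = "\<lambda>m w. \<Prod>i<m. g (\<xi> m i) ^ (N (?p m (Suc i)) w - N (?p m i) w)"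
  have R_exp: "expectation (?R m) = exp (- (rate * ?F t))" if m: "0 < m" for m
  proof -
    have "expectation (?R m) = (\<Prod>i<m. exp (- (rate * (t / real m) * (1 - g (\<xi> m i)))))"
      by (rule expectation_power_increments[OF t m, where z = "\<lambda>i. g (\<xi> m i)"]) (rule g(2)[OF \<xi>_in])
    also have "\<dots> = exp (\<Sum>i<m. - (rate * (?F (?p m (Suc i)) - ?F (?p m i))))"
      unfolding exp_sum[OF finite_lessThan] mult.assoc
      by (intro prod.cong refl, subst \<xi>(2)) auto
    also have "(\<Sum>i<m. - (rate * (?F (?p m (Suc i)) - ?F (?p m i)))) = - (rate * ?F t)"
      using sum_lessThan_telescope[of "\<lambda>i. ?F (?p m i)" m] m
      by (simp add: sum_negf sum_distrib_left[symmetric] del: of_nat_Suc)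
    finally show ?thesis .
  qed
  have R_meas: "?R m \<in> borel_measurable \<Omega>" for m
  proof -
    have D: "(\<lambda>w. N (?p m (Suc i)) w - N (?p m i) w) \<in> measurable \<Omega> (count_space UNIV)" for i
      using t by (intro increment_measurable) (simp_all del: of_nat_Suc)
    show ?thesis
      by (rule borel_measurable_prod, rule measurable_compose[OF D]) simp
  qed
  have lim: "(\<lambda>m. ?R m w) \<longlonglongrightarrow> (\<Prod>n=1..N t w. g (jump_time N n w))" if "w \<in> space \<Omega>" for w
    by (rule prod_jump_times_LIMSEQ[OF that t g(1) \<xi>(1)])
  have "(\<lambda>m. expectation (?R m)) \<longlonglongrightarrow> expectation (\<lambda>w. \<Prod>n=1..N t w. g (jump_time N n w))"
  proof (rule integral_dominated_convergence[where w = "\<lambda>_. 1"])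
    show "(\<lambda>w. \<Prod>n=1..N t w. g (jump_time N n w)) \<in> borel_measurable \<Omega>"
      using R_meas lim by (rule borel_measurable_LIMSEQ_real[rotated])
    show "AE w in \<Omega>. norm (?R m w) \<le> 1" for m
    proof (rule AE_I2)
      fix w
      have "0 \<le> ?R m w" "?R m w \<le> 1"
        using g(2)[OF \<xi>_in] by (auto intro!: prod_nonneg prod_le_1 simp: power_le_one)
      then show "norm (?R m w) \<le> 1" by simp
    qed
    show "AE w in \<Omega>. (\<lambda>m. ?R m w) \<longlonglongrightarrow> (\<Prod>n=1..N t w. g (jump_time N n w))"
      by (rule AE_I2) (rule lim)
  qed (rule R_meas, simp)
  moreover have "(\<lambda>m. expectation (?R m)) \<longlonglongrightarrow> exp (- (rate * ?F t))"
    using R_exp by (intro tendsto_eventually eventually_sequentiallyI[of 1]) auto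
  ultimately show ?thesis by (rule LIMSEQ_unique)
qed

lemma no_jump_sets: "0 \<le> t \<Longrightarrow> {w \<in> space \<Omega>. N t w = 0} \<in> sets \<Omega>"
  using measurable_sets[OF N_measurable[of t], of "{0}"] by (simp add: vimage_def Int_def conj_commute)

lemma prob_no_jump:
  assumes "0 < t"
  shows "prob {w \<in> space \<Omega>. N t w = 0} = exp (- (rate * t))"
proof -
  have "{w \<in> space \<Omega>. N t w = 0} = (\<lambda>w. N t w - N 0 w) -` {0} \<inter> space \<Omega>"
    by (auto simp: N_0)
  also have "prob \<dots> = measure (distr \<Omega> (count_space UNIV) (\<lambda>w. N t w - N 0 w)) {0}"
    using increment_measurable[of 0 t] assms by (subst measure_distr) auto
  also have "\<dots> = pmf (poisson_pmf (rate * t)) 0"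
    using increment_distr[of 0 t] assms by (simp add: measure_pmf_single)
  also have "\<dots> = exp (- (rate * t))"
    using rate_pos assms by (simp add: pmf_poisson)
  finally show ?thesis .
qed

end

section \<open>Independence and null sets\<close>

text \<open>Lebesgue measure is invariant under translation along \<open>d\<close>, and
  \<open>c \<bullet> d = 1\<close>, so replacing \<open>c \<bullet> p\<close> by
  \<open>c \<bullet> p + r\<close> leaves the measure \<open>?I\<close> unchanged. Averaging over
  \<open>r\<close> in the unit interval and exchanging the integrals reduces \<open>?I\<close> to
  integrals over translates of the null set \<open>B\<close>.\<close>

lemma AE_inner_notin_null:
  fixes c :: "'a::euclidean_space"
  assumes c: "c \<noteq> 0" and B: "B \<in> sets borel" "emeasure lborel B = 0"
  shows "AE p in lborel. c \<bullet> p \<notin> B"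
proof -
  define d where "d = c /\<^sub>R (c \<bullet> c)"
  have cd: "c \<bullet> d = 1" using c by (simp add: d_def)
  have [measurable]: "B \<in> sets borel" by fact
  let ?I = "\<integral>\<^sup>+p. indicator B (c \<bullet> p) \<partial>lborel"
  have shift: "(\<integral>\<^sup>+p. indicator B (c \<bullet> p + r) \<partial>lborel) = ?I" for r
  proof -
    have "?I = (\<integral>\<^sup>+p. indicator B (c \<bullet> p) \<partial>distr lborel borel ((+) (r *\<^sub>R d)))"
      by (simp add: lborel_distr_plus)
    also have "\<dots> = (\<integral>\<^sup>+p. indicator B (c \<bullet> (r *\<^sub>R d + p)) \<partial>lborel)"
      by (subst nn_integral_distr) simp_all
    also have "(\<lambda>p. c \<bullet> (r *\<^sub>R d + p)) = (\<lambda>p. c \<bullet> p + r)"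
      by (simp add: inner_add_right cd fun_eq_iff)
    finally show ?thesis by (simp add: inner_add_right cd add.commute)
  qed
  have null: "(\<integral>\<^sup>+r. indicator B (x + r) \<partial>lborel) = 0" for x :: real
  proof -
    have "(\<integral>\<^sup>+r. indicator B (x + r) \<partial>lborel) = (\<integral>\<^sup>+r. indicator B r \<partial>distr lborel borel ((+) x))"
      by (subst nn_integral_distr) simp_all
    then show ?thesis using B by (simp add: lborel_distr_plus)
  qed
  have "?I = (\<integral>\<^sup>+r. indicator {0..1::real} r * ?I \<partial>lborel)"
    by (subst nn_integral_multc) simp_all
  also have "\<dots> = (\<integral>\<^sup>+r. \<integral>\<^sup>+p. indicator {0..1} r * indicator B (c \<bullet> p + r) \<partial>lborel \<partial>lborel)"
    by (subst nn_integral_cmult) (simp_all add: shift)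
  also have "\<dots> = (\<integral>\<^sup>+p. \<integral>\<^sup>+r. indicator {0..1} r * indicator B (c \<bullet> p + r) \<partial>lborel \<partial>lborel)"
    by (rule lborel_pair.Fubini') simp
  also have "\<dots> \<le> (\<integral>\<^sup>+p. \<integral>\<^sup>+r. indicator B (c \<bullet> p + r) \<partial>lborel \<partial>lborel)"
    by (intro nn_integral_mono) (simp add: indicator_def)
  also have "\<dots> = 0" by (simp add: null)
  finally have "?I = 0" by simp
  then have "AE p in lborel. indicator B (c \<bullet> p) = (0::ennreal)"
    by (subst (asm) nn_integral_0_iff_AE) simp_all
  then show ?thesis by (rule eventually_mono) (simp add: indicator_def split: if_splits)
qed

lemma distr_pair_indep_rv:
  assumes M: "prob_space M" and ind: "indep_rv M S U T V"
  shows "distr M (S \<Otimes>\<^sub>M T) (\<lambda>w. (U w, V w)) = distr M S U \<Otimes>\<^sub>M distr M T V"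
proof -
  interpret prob_space M by fact
  have U[measurable]: "U \<in> measurable M S" and V[measurable]: "V \<in> measurable M T"
    using ind by (simp_all add: indep_rv_def)
  interpret U: prob_space "distr M S U" by (rule prob_space_distr) fact
  interpret V: prob_space "distr M T V" by (rule prob_space_distr) fact
  show ?thesis
  proof (rule pair_measure_eqI[symmetric])
    show "sigma_finite_measure (distr M S U)" "sigma_finite_measure (distr M T V)" ..
    show "sets (distr M S U \<Otimes>\<^sub>M distr M T V) = sets (distr M (S \<Otimes>\<^sub>M T) (\<lambda>w. (U w, V w)))"
      by simp
    fix A B assume "A \<in> sets (distr M S U)" "B \<in> sets (distr M T V)"
    then have A: "A \<in> sets S" and B: "B \<in> sets T" by simp_all
    have "prob ((U -` A \<inter> space M) \<inter> (V -` B \<inter> space M)) =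
        prob (U -` A \<inter> space M) * prob (V -` B \<inter> space M)"
      using ind A B unfolding indep_rv_def indep_sets2_eq by blast
    moreover have "(\<lambda>w. (U w, V w)) -` (A \<times> B) \<inter> space M = (U -` A \<inter> space M) \<inter> (V -` B \<inter> space M)"
      by auto
    ultimately show "emeasure (distr M S U) A * emeasure (distr M T V) B =
        emeasure (distr M (S \<Otimes>\<^sub>M T) (\<lambda>w. (U w, V w))) (A \<times> B)"
      using A B by (simp add: emeasure_distr emeasure_eq_measure ennreal_mult)
  qed
qed

text \<open>This is Fubini's theorem with \<open>V\<close> evaluated at a fresh sample point
  \<open>w'\<close>. It allows one variable to be frozen, later the counting path, while the other
  is averaged.\<close>

lemma indep_rv_decouple:
  fixes F :: "'a \<times> 'b \<Rightarrow> real"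
  assumes M: "prob_space M" and ind: "indep_rv M S U T V"
    and F: "F \<in> borel_measurable (S \<Otimes>\<^sub>M T)" "\<And>x. \<bar>F x\<bar> \<le> B"
  shows "(\<integral>w. F (U w, V w) \<partial>M) = (\<integral>w. (\<integral>w'. F (U w, V w') \<partial>M) \<partial>M)"
proof -
  interpret prob_space M by fact
  have U[measurable]: "U \<in> measurable M S" and V[measurable]: "V \<in> measurable M T"
    using ind by (simp_all add: indep_rv_def)
  note F(1)[measurable]
  interpret U: prob_space "distr M S U" by (rule prob_space_distr) fact
  interpret V: prob_space "distr M T V" by (rule prob_space_distr) fact
  interpret UV: pair_prob_space "distr M S U" "distr M T V" ..
  have F': "F \<in> borel_measurable (distr M S U \<Otimes>\<^sub>M distr M T V)"
    using F(1) by (simp cong: measurable_cong_sets)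
  have int: "integrable (distr M S U \<Otimes>\<^sub>M distr M T V) F"
    by (rule UV.P.integrable_const_bound[where B = B]) (use F F' in auto)
  have "(\<integral>w. F (U w, V w) \<partial>M) = (\<integral>x. F x \<partial>distr M (S \<Otimes>\<^sub>M T) (\<lambda>w. (U w, V w)))"
    by (subst integral_distr) simp_all
  also have "\<dots> = (\<integral>x. (\<integral>y. F (x, y) \<partial>distr M T V) \<partial>distr M S U)"
    unfolding distr_pair_indep_rv[OF M ind] by (rule UV.integral_fst'[OF int, symmetric])
  also have "\<dots> = (\<integral>w. (\<integral>y. F (U w, y) \<partial>distr M T V) \<partial>M)"
    by (subst integral_distr) (simp_all add: V.borel_measurable_lebesgue_integral)
  also have "\<dots> = (\<integral>w. (\<integral>w'. F (U w, V w') \<partial>M) \<partial>M)"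
  proof (rule Bochner_Integration.integral_cong[OF refl])
    fix w assume "w \<in> space M"
    then have "U w \<in> space S" using U by (rule measurable_space[rotated])
    then have "(\<lambda>y. F (U w, y)) \<in> borel_measurable T" by measurable
    then show "(\<integral>y. F (U w, y) \<partial>distr M T V) = (\<integral>w'. F (U w, V w') \<partial>M)"
      by (subst integral_distr) simp_all
  qed
  finally show ?thesis .
qed

lemma distr_pair_snd:
  assumes "prob_space M" "sigma_finite_measure N"
  shows "distr (M \<Otimes>\<^sub>M N) N snd = N"
proof (rule measure_eqI)
  interpret M: prob_space M by fact
  interpret N: sigma_finite_measure N by fact
  fix A assume "A \<in> sets (distr (M \<Otimes>\<^sub>M N) N snd)"
  then have A: "A \<in> sets N" by simp
  have "snd -` A \<inter> space (M \<Otimes>\<^sub>M N) = space M \<times> A"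
    using sets.sets_into_space[OF A] by (auto simp: space_pair_measure)
  then show "emeasure (distr (M \<Otimes>\<^sub>M N) N snd) A = emeasure N A"
    using A by (simp add: emeasure_distr N.emeasure_pair_measure_Times M.emeasure_space_1)
qed simp

text \<open>It makes the first projection an admissible initial state in
  \<open>invariant_distribution\<close>. There \<open>S\<close> is \<open>borel\<close>, which
  shares the measurable sets of \<open>M\<close> but is a different measure.\<close>

lemma indep_rv_fst_snd:
  assumes M: "prob_space M" and N: "prob_space N" and S: "sets S = sets M"
    and V: "V \<in> measurable N T"
  shows "indep_rv (M \<Otimes>\<^sub>M N) S fst T (\<lambda>x. V (snd x))"
proof -
  interpret M: prob_space M by fact
  interpret N: prob_space N by fact
  interpret MN: pair_prob_space M N ..
  have f: "fst \<in> measurable (M \<Otimes>\<^sub>M N) S"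
    using measurable_fst[of M N] by (simp add: measurable_cong_sets[OF refl S])
  have g: "(\<lambda>x. V (snd x)) \<in> measurable (M \<Otimes>\<^sub>M N) T"
    by (rule measurable_compose[OF measurable_snd V])
  have "MN.prob ((fst -` A \<inter> space (M \<Otimes>\<^sub>M N)) \<inter> ((\<lambda>x. V (snd x)) -` B \<inter> space (M \<Otimes>\<^sub>M N))) =
      MN.prob (fst -` A \<inter> space (M \<Otimes>\<^sub>M N)) * MN.prob ((\<lambda>x. V (snd x)) -` B \<inter> space (M \<Otimes>\<^sub>M N))"
    if "A \<in> sets S" "B \<in> sets T" for A B
  proof -
    have A: "A \<in> sets M" and B: "V -` B \<inter> space N \<in> sets N"
      using that S measurable_sets[OF V] by auto
    have sA: "A \<subseteq> space M" using sets.sets_into_space[OF A] .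
    have 1: "fst -` A \<inter> space (M \<Otimes>\<^sub>M N) = A \<times> space N"
      and 2: "(\<lambda>x. V (snd x)) -` B \<inter> space (M \<Otimes>\<^sub>M N) = space M \<times> (V -` B \<inter> space N)"
      using sA by (auto simp: space_pair_measure)
    have 3: "A \<times> space N \<inter> (space M \<times> (V -` B \<inter> space N)) = A \<times> (V -` B \<inter> space N)"
      using sA by auto
    show ?thesis
      unfolding 1 2 3 using A B
      by (simp add: measure_def N.emeasure_pair_measure_Times enn2real_mult M.emeasure_space_1 N.emeasure_space_1)
  qed
  then show ?thesis
    unfolding indep_rv_def MN.indep_sets2_eq
    using f g by (auto intro!: measurable_sets)
qed

text \<open>The infimum in \<^const>\<open>jump_time\<close> is not visibly measurable in the path; this limit is.\<close>

definition path_jump :: "real \<Rightarrow> nat \<Rightarrow> (real \<Rightarrow> nat) \<Rightarrow> real" where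
  "path_jump t n u = lim (\<lambda>m. \<Sum>i<m.
     if u (grid t m i) < n \<and> n \<le> u (grid t m (Suc i)) then grid t m (Suc i) else 0)"

lemma path_jump_measurable:
  assumes "0 \<le> t"
  shows "path_jump t n \<in> borel_measurable (PiM {0..} (\<lambda>_. count_space UNIV))"
proof -
  have comp: "(\<lambda>u. u (grid t m i)) \<in> measurable (PiM {0..} (\<lambda>_. count_space UNIV)) (count_space UNIV)"
    for i m
    using assms by (intro measurable_component_singleton) simp
  have "(\<lambda>u. if u (grid t m i) < n \<and> n \<le> u (grid t m (Suc i)) then grid t m (Suc i) else 0)
      \<in> borel_measurable (PiM {0..} (\<lambda>_. count_space (UNIV :: nat set)))" for i m
    using comp[of i m] comp[of "Suc i" m] by measurable
  then show ?thesis
    unfolding path_jump_def[abs_def] by (intro borel_measurable_lim_metric borel_measurable_sum)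
qed

text \<open>For every mesh exactly one summand survives, that of the cell containing the jump; it
  equals the right endpoint of that cell.\<close>

lemma (in poisson_clock) path_jump_eq:
  assumes w: "w \<in> space \<Omega>" and t: "0 < t" and n: "n \<in> {1..N t w}"
  shows "path_jump t n (\<lambda>s\<in>{0..}. N s w) = jump_time N n w"
  unfolding path_jump_def
proof (rule limI, rule Lim_transform_eventually)
  let ?\<tau> = "jump_time N n w"
  note \<tau> = jump_time_in[OF w less_imp_le[OF t] n]
  show "(\<lambda>m. t * real (Suc (cell t ?\<tau> m)) / real m) \<longlonglongrightarrow> ?\<tau>"
    by (rule tendsto_cell[OF \<tau>, where G = "\<lambda>x. x" and \<xi> = "\<lambda>m i. grid t m (Suc i)"])
      (use t in \<open>auto intro!: divide_right_mono mult_left_mono\<close>)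
  show "eventually (\<lambda>m. t * real (Suc (cell t ?\<tau> m)) / real m =
      (\<Sum>i<m. if (\<lambda>s\<in>{0..}. N s w) (grid t m i) < n \<and>
        n \<le> (\<lambda>s\<in>{0..}. N s w) (grid t m (Suc i)) then grid t m (Suc i) else 0)) sequentially"
  proof (rule eventually_sequentiallyI[of 1])
    fix m :: nat assume "1 \<le> m"
    then have m: "0 < m" by simp
    have p: "(\<lambda>s\<in>{0..}. N s w) (grid t m i) = N (grid t m i) w" for i
      using t by simp
    show "t * real (Suc (cell t ?\<tau> m)) / real m =
      (\<Sum>i<m. if (\<lambda>s\<in>{0..}. N s w) (grid t m i) < n \<and>
        n \<le> (\<lambda>s\<in>{0..}. N s w) (grid t m (Suc i)) then grid t m (Suc i) else 0)"
      unfolding p cell_jump_time_iff[OF w less_imp_le[OF t] n m]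
      using cell_less[OF \<tau> m] by (simp del: of_nat_Suc)
  qed
qed

section \<open>Shot noise with marks in the orthant\<close>

text \<open>Shot noise as a function of the pair of a counting path and a mark sequence, the two
  objects whose independence is assumed.\<close>

definition path_shot ::
  "(real \<Rightarrow> 'p \<Rightarrow> 'b::comm_monoid_add) \<Rightarrow> real \<Rightarrow> (real \<Rightarrow> nat) \<times> (nat \<Rightarrow> 'p) \<Rightarrow> 'b" where
  "path_shot G t x = (\<Sum>n=1..fst x t. G (path_jump t n (fst x)) (snd x n))"

lemma path_shot_measurable:
  fixes G :: "real \<Rightarrow> 'p::topological_space \<Rightarrow> 'b::{second_countable_topology, real_normed_vector}"
  assumes G: "case_prod G \<in> borel_measurable (borel \<Otimes>\<^sub>M borel)" and t: "0 \<le> t"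
  shows "path_shot G t \<in> borel_measurable (PiM {0..} (\<lambda>_. count_space UNIV) \<Otimes>\<^sub>M PiM {1..} (\<lambda>_. borel))"
proof -
  let ?S = "PiM {0..} (\<lambda>_. count_space UNIV) :: (real \<Rightarrow> nat) measure"
  let ?T = "PiM {1..} (\<lambda>_. borel) :: (nat \<Rightarrow> 'p) measure"
  have "(\<lambda>x. \<Sum>n=1..k. G (path_jump t n (fst x)) (snd x n)) \<in> borel_measurable (?S \<Otimes>\<^sub>M ?T)" for k
  proof (rule borel_measurable_sum)
    fix n assume "n \<in> {1..k}"
    then have "(\<lambda>v. v n) \<in> measurable ?T borel"
      by (intro measurable_component_singleton) simp
    then have "(\<lambda>x. (path_jump t n (fst x), snd x n)) \<in> measurable (?S \<Otimes>\<^sub>M ?T) (borel \<Otimes>\<^sub>M borel)"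
      using path_jump_measurable[OF t, of n] by measurable
    from measurable_compose[OF this G]
    show "(\<lambda>x. G (path_jump t n (fst x)) (snd x n)) \<in> borel_measurable (?S \<Otimes>\<^sub>M ?T)" by simp
  qed
  moreover have "(\<lambda>x. fst x t) \<in> measurable (?S \<Otimes>\<^sub>M ?T) (count_space UNIV)"
    using t by (intro measurable_compose[OF measurable_fst] measurable_component_singleton) simp
  ultimately show ?thesis
    unfolding path_shot_def[abs_def] by (rule measurable_compose_countable)
qed

locale shot_noise = poisson_clock \<Omega> rate N for \<Omega> :: "'w measure" and rate N +
  fixes P :: "nat \<Rightarrow> 'w \<Rightarrow> real^'e::finite" and f :: "real^'e \<Rightarrow> real"
  assumes marked: "marked_poisson \<Omega> rate f N P" and density: "density_on pos_orthant f"
begin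

abbreviation path :: "'w \<Rightarrow> real \<Rightarrow> nat" where
  "path w \<equiv> \<lambda>t\<in>{0..}. N t w"

abbreviation marks :: "'w \<Rightarrow> nat \<Rightarrow> real^'e" where
  "marks w \<equiv> \<lambda>n\<in>{1..}. P n w"

abbreviation pos_marks :: "'w \<Rightarrow> bool" where
  "pos_marks w \<equiv> \<forall>n\<ge>1. P n w \<in> pos_orthant"

text \<open>\<open>G v p\<close> is the contribution of a jump at time \<open>v\<close> with mark
  \<open>p\<close>. The codomain is left general because the noise is a vector while its inner
  products with a fixed vector are real.\<close>

definition shot :: "(real \<Rightarrow> real^'e \<Rightarrow> 'b::comm_monoid_add) \<Rightarrow> real \<Rightarrow> 'w \<Rightarrow> 'b" where
  "shot G t w = (\<Sum>n=1..N t w. G (jump_time N n w) (P n w))"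

lemma mark_distributed: "1 \<le> n \<Longrightarrow> distributed \<Omega> lborel (P n) (\<lambda>y. ennreal (f y))"
  using marked by (simp add: marked_poisson_def)

lemma mark_measurable: "1 \<le> n \<Longrightarrow> P n \<in> borel_measurable \<Omega>"
  using distributed_measurable[OF mark_distributed] by simp

lemma indep_marks: "indep_vars (\<lambda>_. borel) P {1..}"
  using marked by (simp add: marked_poisson_def)

lemma indep_path_marks:
  "indep_rv \<Omega> (PiM {0..} (\<lambda>_. count_space UNIV)) path (PiM {1..} (\<lambda>_. borel)) marks"
  using marked by (simp add: marked_poisson_def)

lemma density_measurable: "f \<in> borel_measurable borel" and density_nonneg: "0 \<le> f y"
  using density by (simp_all add: density_on_def)

lemma AE_mark_pos: "AE w in \<Omega>. pos_marks w"
proof -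
  have "AE w in \<Omega>. P n w \<in> pos_orthant" if n: "1 \<le> n" for n
  proof -
    have "AE y in density lborel (\<lambda>y. ennreal (f y)). y \<in> pos_orthant"
    proof (subst AE_density)
      show "(\<lambda>y. ennreal (f y)) \<in> borel_measurable lborel" using density_measurable by simp
      show "AE y in lborel. 0 < ennreal (f y) \<longrightarrow> y \<in> pos_orthant"
      proof (intro AE_I2 impI, rule ccontr)
        fix y assume "0 < ennreal (f y)" "y \<notin> pos_orthant"
        moreover from this have "f y = 0" using density by (simp add: density_on_def)
        ultimately show False by simp
      qed
    qed
    then have "AE y in distr \<Omega> lborel (P n). y \<in> pos_orthant"
      unfolding distributed_distr_eq_density[OF mark_distributed[OF n]] .
    then show ?thesis
      by (rule AE_distrD[rotated]) (use mark_measurable[OF n] in simp)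
  qed
  then have "AE w in \<Omega>. 1 \<le> n \<longrightarrow> P n w \<in> pos_orthant" for n
    by (cases "1 \<le> n") auto
  then show ?thesis by (simp add: AE_all_countable)
qed

lemma expectation_exp_mark:
  assumes "1 \<le> n"
  shows "expectation (\<lambda>w. exp (- (h \<bullet> P n w))) = laplace_orthant f h"
proof -
  have "expectation (\<lambda>w. exp (- (h \<bullet> P n w))) = (\<integral>y. f y * exp (- (h \<bullet> y)) \<partial>lborel)"
    using distributed_integral[OF mark_distributed[OF assms], of "\<lambda>y. exp (- (h \<bullet> y))"] density_nonneg
    by simp
  also have "\<dots> = laplace_orthant f h"
    unfolding laplace_orthant_def set_lebesgue_integral_def
    using density by (intro Bochner_Integration.integral_cong)
      (auto simp: density_on_def indicator_def inner_commute)
  finally show ?thesis .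
qed

lemma AE_exp_mark_le_1:
  assumes "1 \<le> n" "\<And>i. 0 \<le> h $ i"
  shows "AE w in \<Omega>. exp (- (h \<bullet> P n w)) \<le> 1"
  using AE_mark_pos
proof (rule eventually_mono)
  fix w assume "pos_marks w"
  then have "0 \<le> h \<bullet> P n w"
    using assms unfolding inner_vec_def pos_orthant_def
    by (intro sum_nonneg) (auto intro!: mult_nonneg_nonneg intro: less_imp_le)
  then show "exp (- (h \<bullet> P n w)) \<le> 1" by simp
qed

lemma exp_mark_measurable: "1 \<le> n \<Longrightarrow> (\<lambda>w. exp (- (h \<bullet> P n w))) \<in> borel_measurable \<Omega>"
  using mark_measurable[of n] by measurable

lemma integrable_exp_mark:
  assumes "1 \<le> n" "\<And>i. 0 \<le> h $ i"
  shows "integrable \<Omega> (\<lambda>w. exp (- (h \<bullet> P n w)))"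
  using AE_exp_mark_le_1[OF assms] exp_mark_measurable[OF assms(1)]
  by (intro integrable_const_bound[where B = 1]) simp_all

lemma laplace_orthant_bounds:
  assumes "\<And>i. 0 \<le> h $ i"
  shows "0 \<le> laplace_orthant f h" "laplace_orthant f h \<le> 1"
proof -
  show "0 \<le> laplace_orthant f h"
    unfolding expectation_exp_mark[of 1, symmetric, simplified] by (rule Bochner_Integration.integral_nonneg) simp
  have "expectation (\<lambda>w. exp (- (h \<bullet> P 1 w))) \<le> expectation (\<lambda>_. 1)"
    using integrable_exp_mark[of 1 h] AE_exp_mark_le_1[of 1 h] assms by (intro integral_mono_AE) auto
  then show "laplace_orthant f h \<le> 1" by (simp add: expectation_exp_mark prob_space)
qed

text \<open>Dominated convergence along sequences; on the nonnegative orthant the integrands are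
  almost surely at most 1.\<close>

lemma continuous_laplace_orthant: "continuous_on {h. \<forall>i. 0 \<le> h $ i} (laplace_orthant f)"
  unfolding continuous_on_sequentially
proof (intro allI ballI impI)
  fix h :: "nat \<Rightarrow> real^'e" and h'
  assume h': "h' \<in> {h. \<forall>i. 0 \<le> h $ i}" and h: "(\<forall>k. h k \<in> {h. \<forall>i. 0 \<le> h $ i}) \<and> h \<longlonglongrightarrow> h'"
  have "(\<lambda>k. expectation (\<lambda>w. exp (- (h k \<bullet> P 1 w)))) \<longlonglongrightarrow> expectation (\<lambda>w. exp (- (h' \<bullet> P 1 w)))"
  proof (rule integral_dominated_convergence[where w = "\<lambda>_. 1"])
    show "AE w in \<Omega>. (\<lambda>k. exp (- (h k \<bullet> P 1 w))) \<longlonglongrightarrow> exp (- (h' \<bullet> P 1 w))"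
      using h by (intro AE_I2 tendsto_intros) auto
    show "AE w in \<Omega>. norm (exp (- (h k \<bullet> P 1 w))) \<le> 1" for k
      using AE_exp_mark_le_1[of 1 "h k"] h by simp
    show "(\<lambda>w. exp (- (h k \<bullet> P 1 w))) \<in> borel_measurable \<Omega>" for k
      by (rule exp_mark_measurable) simp
    show "(\<lambda>w. exp (- (h' \<bullet> P 1 w))) \<in> borel_measurable \<Omega>"
      by (rule exp_mark_measurable) simp
  qed simp
  then show "(laplace_orthant f \<circ> h) \<longlonglongrightarrow> laplace_orthant f h'"
    by (simp add: expectation_exp_mark comp_def)
qed

text \<open>Path and marks may come from different sample points, as is the case after
  decoupling.\<close>

lemma path_shot_eq:
  assumes "w \<in> space \<Omega>" "0 < t"
  shows "path_shot G t (path w, marks w') = (\<Sum>n=1..N t w. G (jump_time N n w) (P n w'))"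
proof -
  have "(\<Sum>n=1..N t w. G (path_jump t n (path w)) (marks w' n)) =
      (\<Sum>n=1..N t w. G (jump_time N n w) (P n w'))"
    using path_jump_eq[OF assms] by (intro sum.cong refl) simp
  then show ?thesis
    using assms(2) by (simp add: path_shot_def)
qed

lemma shot_measurable:
  fixes G :: "real \<Rightarrow> real^'e \<Rightarrow> 'b::{second_countable_topology, real_normed_vector}"
  assumes G: "case_prod G \<in> borel_measurable (borel \<Otimes>\<^sub>M borel)" and t: "0 < t"
  shows "shot G t \<in> borel_measurable \<Omega>"
proof -
  have U: "path \<in> measurable \<Omega> (PiM {0..} (\<lambda>_. count_space UNIV))"
    and V: "marks \<in> measurable \<Omega> (PiM {1..} (\<lambda>_. borel))"
    using indep_path_marks by (auto simp: indep_rv_def)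
  have "(\<lambda>w. path_shot G t (path w, marks w)) \<in> borel_measurable \<Omega>"
    by (rule measurable_compose[OF measurable_Pair[OF U V] path_shot_measurable[OF G less_imp_le[OF t]]])
  then show ?thesis
    by (rule measurable_cong[THEN iffD1, rotated]) (simp add: path_shot_eq[OF _ t] shot_def del: One_nat_def)
qed

lemma inner_measurable:
  assumes "continuous_on UNIV c"
  shows "(\<lambda>(v, p). c v \<bullet> p) \<in> borel_measurable (borel \<Otimes>\<^sub>M (borel :: (real^'e) measure))"
proof -
  have [measurable]: "c \<in> borel_measurable borel" by (rule borel_measurable_continuous_onI[OF assms])
  show ?thesis by measurable
qed

text \<open>Decoupling freezes the path. The marks are independent with a common law, so the inner
  expectation is the product of their transform along the jump times, to which
  \<open>expectation_prod_jump_times\<close> applies.\<close>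

theorem expectation_exp_shot:
  assumes t: "0 < t" and c: "continuous_on UNIV c" "\<And>v i. v \<in> {0..t} \<Longrightarrow> 0 \<le> c v $ i"
  shows "expectation (\<lambda>w. exp (- shot (\<lambda>v p. c v \<bullet> p) t w)) =
    exp (- (rate * integral {0..t} (\<lambda>v. 1 - laplace_orthant f (c v))))"
proof -
  let ?G = "\<lambda>v p. c v \<bullet> p"
  \<comment> \<open>The absolute value bounds \<open>?F\<close> by 1 at every point of the path
    space, as decoupling demands. It changes nothing almost surely, because the marks are
    positive.\<close>
  let ?F = "\<lambda>x. exp (- \<bar>path_shot ?G t x\<bar>)"
  have nonneg: "0 \<le> (\<Sum>n=1..N t w. c (jump_time N n w) \<bullet> P n w')"
    if "w \<in> space \<Omega>" "\<forall>n\<ge>1. P n w' \<in> pos_orthant" for w w'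
  proof (rule sum_nonneg)
    fix n assume n: "n \<in> {1..N t w}"
    show "0 \<le> c (jump_time N n w) \<bullet> P n w'"
      using jump_time_in[OF that(1) less_imp_le[OF t] n] that(2) n unfolding inner_vec_def pos_orthant_def
      by (intro sum_nonneg) (auto intro!: mult_nonneg_nonneg c(2) intro: less_imp_le)
  qed
  have "expectation (\<lambda>w. exp (- shot ?G t w)) = expectation (\<lambda>w. ?F (path w, marks w))"
  proof (rule integral_cong_AE)
    show "(\<lambda>w. exp (- shot ?G t w)) \<in> borel_measurable \<Omega>"
      using shot_measurable[OF inner_measurable[OF c(1)] t] by measurable
    then have "shot ?G t \<in> borel_measurable \<Omega>"
      using shot_measurable[OF inner_measurable[OF c(1)] t] by simp
    then have "(\<lambda>w. exp (- \<bar>shot ?G t w\<bar>)) \<in> borel_measurable \<Omega>" by measurable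
    then show "(\<lambda>w. ?F (path w, marks w)) \<in> borel_measurable \<Omega>"
      by (rule measurable_cong[THEN iffD1, rotated]) (simp add: path_shot_eq[OF _ t] shot_def del: One_nat_def)
    show "AE w in \<Omega>. exp (- shot ?G t w) = ?F (path w, marks w)"
      using AE_mark_pos by (rule AE_mp)
        (rule AE_I2, simp add: path_shot_eq[OF _ t] shot_def nonneg del: One_nat_def)
  qed
  also have "\<dots> = expectation (\<lambda>w. expectation (\<lambda>w'. ?F (path w, marks w')))"
    by (rule indep_rv_decouple[OF prob_space_axioms indep_path_marks, where B = 1])
      (use measurable_compose[OF path_shot_measurable[OF inner_measurable[OF c(1)] less_imp_le[OF t]],
        of "\<lambda>r. exp (- \<bar>r\<bar>)" borel] in simp_all)
  also have "\<dots> = expectation (\<lambda>w. \<Prod>n=1..N t w. laplace_orthant f (c (jump_time N n w)))"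
  proof (rule Bochner_Integration.integral_cong[OF refl])
    fix w assume w: "w \<in> space \<Omega>"
    let ?c = "\<lambda>n. c (jump_time N n w)"
    have c_nonneg: "0 \<le> ?c n $ i" if "n \<in> {1..N t w}" for n i
      using jump_time_in[OF w less_imp_le[OF t] that] by (intro c(2)) auto
    have "expectation (\<lambda>w'. ?F (path w, marks w')) =
        expectation (\<lambda>w'. \<Prod>n=1..N t w. exp (- (?c n \<bullet> P n w')))"
    proof (rule integral_cong_AE)
      have "(\<lambda>w'. \<Sum>n=1..N t w. ?c n \<bullet> P n w') \<in> borel_measurable \<Omega>"
        by (intro borel_measurable_sum borel_measurable_inner measurable_const mark_measurable) auto
      then show "(\<lambda>w'. ?F (path w, marks w')) \<in> borel_measurable \<Omega>"
        unfolding path_shot_eq[OF w t] by measurable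
      show "(\<lambda>w'. \<Prod>n=1..N t w. exp (- (?c n \<bullet> P n w'))) \<in> borel_measurable \<Omega>"
        by (intro borel_measurable_prod exp_mark_measurable) simp
      show "AE w' in \<Omega>. ?F (path w, marks w') = (\<Prod>n=1..N t w. exp (- (?c n \<bullet> P n w')))"
        using AE_mark_pos by (rule AE_mp)
          (rule AE_I2, simp add: path_shot_eq[OF w t] nonneg w exp_sum[symmetric] sum_negf del: One_nat_def)
    qed
    also have "\<dots> = (\<Prod>n=1..N t w. laplace_orthant f (?c n))"
    proof -
      have "indep_vars (\<lambda>_. borel) (\<lambda>n w'. exp (- (?c n \<bullet> P n w'))) {1..N t w}"
        by (rule indep_vars_compose2[OF indep_vars_subset[OF indep_marks]]) auto
      then have "expectation (\<lambda>w'. \<Prod>n=1..N t w. exp (- (?c n \<bullet> P n w'))) =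
          (\<Prod>n=1..N t w. expectation (\<lambda>w'. exp (- (?c n \<bullet> P n w'))))"
        by (rule indep_vars_lebesgue_integral[rotated]) (auto intro!: integrable_exp_mark c_nonneg)
      also have "\<dots> = (\<Prod>n=1..N t w. laplace_orthant f (?c n))"
        by (intro prod.cong refl expectation_exp_mark) simp
      finally show ?thesis .
    qed
    finally show "expectation (\<lambda>w'. ?F (path w, marks w')) =
        (\<Prod>n=1..N t w. laplace_orthant f (?c n))" .
  qed
  also have "\<dots> = exp (- (rate * integral {0..t} (\<lambda>v. 1 - laplace_orthant f (c v))))"
  proof (rule expectation_prod_jump_times[OF t])
    show "continuous_on {0..t} (\<lambda>v. laplace_orthant f (c v))"
      by (rule continuous_on_compose2[OF continuous_laplace_orthant continuous_on_subset[OF c(1)]])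
        (auto simp: c(2))
    show "0 \<le> laplace_orthant f (c v) \<and> laplace_orthant f (c v) \<le> 1" if "v \<in> {0..t}" for v
      using laplace_orthant_bounds[of "c v"] c(2)[OF that] by simp
  qed
  finally show ?thesis .
qed

text \<open>The first mark does the smoothing: for any fixed value of the remaining sum,
  \<open>c 1 \<bullet> P 1\<close> avoids the corresponding translate of \<open>B\<close>, which is
  again a null set. Independence and Fubini combine these statements.\<close>

lemma prob_weighted_marks_null:
  assumes c: "c 1 \<noteq> 0" and k: "1 \<le> k" and B: "B \<in> sets borel" "emeasure lborel B = 0"
  shows "AE w in \<Omega>. (\<Sum>n=1..k. c n \<bullet> P n w) \<notin> B"
proof -
  let ?X = "\<lambda>n w. c n \<bullet> P n w"
  have [measurable]: "B \<in> sets borel" by fact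
  have "indep_vars (\<lambda>_. borel) ?X (insert 1 {2..k})"
    by (rule indep_vars_compose2[OF indep_vars_subset[OF indep_marks]]) auto
  from indep_vars_sum[OF _ _ this]
  have ind: "indep_var borel (?X 1) borel (\<lambda>w. \<Sum>n=2..k. ?X n w)" by simp
  let ?R = "\<lambda>w. \<Sum>n=2..k. ?X n w"
  have X[measurable]: "?X 1 \<in> borel_measurable \<Omega>" and R[measurable]: "?R \<in> borel_measurable \<Omega>"
    using ind by (simp_all add: indep_var_distribution_eq)
  interpret X: prob_space "distr \<Omega> borel (?X 1)" by (rule prob_space_distr) fact
  interpret R: prob_space "distr \<Omega> borel ?R" by (rule prob_space_distr) fact
  interpret XR: pair_prob_space "distr \<Omega> borel (?X 1)" "distr \<Omega> borel ?R" ..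
  have single: "AE x in distr \<Omega> borel (?X 1). x + y \<notin> B" for y
  proof -
    let ?B = "(\<lambda>x. x + y) -` B"
    have meas: "?B \<in> sets borel"
      using measurable_sets[of "\<lambda>x. x + y" borel borel B] by simp
    have "emeasure lborel ?B = emeasure (distr lborel borel ((+) y)) B"
      by (subst emeasure_distr) (simp_all add: vimage_def add.commute)
    then have "emeasure lborel ?B = 0" using B by (simp add: lborel_distr_plus)
    then have "AE p in lborel. c 1 \<bullet> p \<notin> ?B" by (rule AE_inner_notin_null[OF c meas])
    then have "AE p in density lborel (\<lambda>p. ennreal (f p)). c 1 \<bullet> p + y \<notin> B"
      using density_measurable by (subst AE_density) (auto elim: eventually_mono)
    then have "AE p in distr \<Omega> lborel (P 1). c 1 \<bullet> p + y \<notin> B"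
      unfolding distributed_distr_eq_density[OF mark_distributed[OF order_refl]] .
    then have "AE w in \<Omega>. c 1 \<bullet> P 1 w + y \<notin> B"
      by (rule AE_distrD[rotated]) (use mark_measurable[of 1] in simp)
    then show ?thesis by (subst AE_distr_iff[OF X]) auto
  qed
  have S: "{z \<in> space (distr \<Omega> borel (?X 1) \<Otimes>\<^sub>M distr \<Omega> borel ?R). fst z + snd z \<notin> B} \<in>
      sets (distr \<Omega> borel (?X 1) \<Otimes>\<^sub>M distr \<Omega> borel ?R)"
    by measurable
  have "AE z in distr \<Omega> borel (?X 1) \<Otimes>\<^sub>M distr \<Omega> borel ?R. fst z + snd z \<notin> B"
  proof (rule XR.AE_pair_measure)
    show "AE x in distr \<Omega> borel (?X 1). AE y in distr \<Omega> borel ?R. fst (x, y) + snd (x, y) \<notin> B"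
      unfolding fst_conv snd_conv using single by (subst XR.AE_commute[OF S]) (rule AE_I2)
  qed (rule S)
  then have "AE z in distr \<Omega> (borel \<Otimes>\<^sub>M borel) (\<lambda>w. (?X 1 w, ?R w)). fst z + snd z \<notin> B"
    by (simp only: ind[unfolded indep_var_distribution_eq, THEN conjunct2, THEN conjunct2])
  then have "AE w in \<Omega>. ?X 1 w + ?R w \<notin> B"
    by (subst (asm) AE_distr_iff) (auto simp del: One_nat_def intro!: measurable_Pair X R)
  moreover have "{1..k} = insert 1 {2..k}" using k by auto
  then have "(\<Sum>n=1..k. ?X n w) = ?X 1 w + ?R w" for w by simp
  ultimately show ?thesis by simp
qed

text \<open>With the path frozen, the first jump occurs at a positive time, where its weight is
  nonzero, so the preceding lemma applies. Without any jump the sum is 0, which may belong to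
  \<open>B\<close>.\<close>

theorem prob_shot_null:
  assumes t: "0 < t" and c: "continuous_on UNIV c" "\<And>v. 0 < v \<Longrightarrow> c v \<noteq> 0"
    and B: "B \<in> sets borel" "emeasure lborel B = 0"
  shows "AE w in \<Omega>. 1 \<le> N t w \<longrightarrow> shot (\<lambda>v p. c v \<bullet> p) t w \<notin> B"
proof -
  let ?G = "\<lambda>v p. c v \<bullet> p"
  let ?F = "\<lambda>x. indicator {1..} (fst x t) * indicator B (path_shot ?G t x) :: real"
  have [measurable]: "B \<in> sets borel" by fact
  note sm = shot_measurable[OF inner_measurable[OF c(1)] t]
  have F_eq: "?F (path w, marks w') = indicator {1..} (N t w) * indicator B (\<Sum>n=1..N t w. c (jump_time N n w) \<bullet> P n w')"
    if "w \<in> space \<Omega>" for w w'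
    using t by (simp add: path_shot_eq[OF that t] del: One_nat_def)
  have "expectation (\<lambda>w. indicat_real {1..} (N t w) * indicat_real B (shot ?G t w)) =
      expectation (\<lambda>w. ?F (path w, marks w))"
    by (intro Bochner_Integration.integral_cong refl) (simp only: F_eq shot_def)
  also have "\<dots> = expectation (\<lambda>w. expectation (\<lambda>w'. ?F (path w, marks w')))"
  proof (rule indep_rv_decouple[OF prob_space_axioms indep_path_marks, where B = 1])
    let ?ST = "PiM {0..} (\<lambda>_. count_space (UNIV :: nat set)) \<Otimes>\<^sub>M PiM {1..} (\<lambda>_. borel :: (real^'e) measure)"
    have "(\<lambda>x. fst x t) \<in> measurable ?ST (count_space UNIV)"
      using t by (intro measurable_compose[OF measurable_fst] measurable_component_singleton) simp
    then have "(\<lambda>x. indicator {1..} (fst x t) :: real) \<in> borel_measurable ?ST"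
      by (rule measurable_compose) simp
    moreover have "(\<lambda>x. indicator B (path_shot ?G t x) :: real) \<in> borel_measurable ?ST"
      by (rule measurable_compose[OF path_shot_measurable[OF inner_measurable[OF c(1)] less_imp_le[OF t]]]) simp
    ultimately show "?F \<in> borel_measurable ?ST"
      by (rule borel_measurable_times)
  qed (simp add: indicator_def)
  also have "\<dots> = expectation (\<lambda>w. 0)"
  proof (rule Bochner_Integration.integral_cong[OF refl])
    fix w assume w: "w \<in> space \<Omega>"
    show "expectation (\<lambda>w'. ?F (path w, marks w')) = 0"
    proof (cases "1 \<le> N t w")
      case True
      have "c (jump_time N 1 w) \<noteq> 0"
        using jump_time_in[OF w less_imp_le[OF t], of 1] True by (intro c(2)) simp
      then have "AE w' in \<Omega>. (\<Sum>n=1..N t w. c (jump_time N n w) \<bullet> P n w') \<notin> B"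
        by (rule prob_weighted_marks_null[OF _ True B])
      then have "AE w' in \<Omega>. ?F (path w, marks w') = 0"
        unfolding F_eq[OF w] by (rule eventually_mono) simp
      then show ?thesis by (rule integral_eq_zero_AE)
    qed (use t in \<open>simp del: One_nat_def\<close>)
  qed
  finally have "expectation (\<lambda>w. indicat_real {1..} (N t w) * indicat_real B (shot ?G t w)) = 0" by simp
  moreover have "(\<lambda>w. indicat_real {1..} (N t w) * indicat_real B (shot ?G t w) :: real) \<in> borel_measurable \<Omega>"
    by (intro borel_measurable_times measurable_compose[OF N_measurable[OF less_imp_le[OF t]], of "indicat_real {1..}"]
      measurable_compose[OF sm, of "indicat_real B"]) simp_all
  then have "integrable \<Omega> (\<lambda>w. indicat_real {1..} (N t w) * indicat_real B (shot ?G t w) :: real)"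
    by (intro integrable_const_bound[where B = 1]) (auto simp: indicator_def)
  ultimately have "AE w in \<Omega>. indicat_real {1..} (N t w) * indicat_real B (shot ?G t w) = (0::real)"
    by (subst (asm) integral_nonneg_eq_0_iff_AE) auto
  then show ?thesis by (rule eventually_mono) (auto simp: indicator_def split: if_splits)
qed

end

section \<open>The flow of a river network\<close>

lemma sum_UNIV_sum:
  fixes g :: "'a::finite + 'b::finite \<Rightarrow> 'c::comm_monoid_add"
  shows "(\<Sum>i\<in>UNIV. g i) = (\<Sum>x\<in>UNIV. g (Inl x)) + (\<Sum>y\<in>UNIV. g (Inr y))"
  using sum.Plus[of "UNIV :: 'a set" "UNIV :: 'b set" g] by (simp add: UNIV_Plus_UNIV comp_def)

lemma river_matrix_simps:
  "river_matrix trib K H $ Inl e $ Inl e' = - (K e * incidence_matrix trib $ e $ e')"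
  "river_matrix trib K H $ Inl e $ Inr e' = (if e = e' then K e else 0)"
  "river_matrix trib K H $ Inr e $ Inl e' = 0"
  "river_matrix trib K H $ Inr e $ Inr e' = (if e = e' then - H e else 0)"
proof -
  have "(diag_mat K ** incidence_matrix trib) $ e $ e' = K e * incidence_matrix trib $ e $ e'"
    by (simp add: diag_mat_def matrix_matrix_mult_def if_distrib[where f = "\<lambda>x. x * _"] sum.delta cong: if_cong)
  then show "river_matrix trib K H $ Inl e $ Inl e' = - (K e * incidence_matrix trib $ e $ e')"
    by (simp add: river_matrix_def block_mat_def)
qed (simp_all add: river_matrix_def block_mat_def diag_mat_def)

locale river =
  fixes r :: "'e::finite" and trib :: "'e \<Rightarrow> 'e set" and K H a :: "'e \<Rightarrow> real"
  assumes network: "river_network r trib"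
    and K_pos: "\<And>e. 0 < K e" and H_pos: "\<And>e. 0 < H e" and a_pos: "\<And>e. 0 < a e"
begin

abbreviation flow :: "real \<Rightarrow> real^('e + 'e)^('e + 'e)" where
  "flow v \<equiv> mat_exp (v *\<^sub>R river_matrix trib K H)"

lemma metzler: "i \<noteq> j \<Longrightarrow> 0 \<le> river_matrix trib K H $ i $ j"
  using K_pos by (cases i; cases j) (auto simp: river_matrix_simps incidence_matrix_def less_imp_le)

section \<open>A Lyapunov vector and the decay of the flow\<close>

definition depth :: "'e \<Rightarrow> nat" where
  "depth e = (LEAST n. (r, e) \<in> {(d, u). u \<in> trib d} ^^ n)"

text \<open>A shortest path from the root to \<open>u\<close> is nontrivial, as the root is no
  tributary, and its last step starts at \<open>e\<close>, the only link with tributary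
  \<open>u\<close>. Removing that step leaves a path to \<open>e\<close>.\<close>

lemma depth_tributary:
  assumes "u \<in> trib e"
  shows "Suc (depth e) \<le> depth u"
proof -
  let ?R = "{(d, u). u \<in> trib d}"
  have "\<exists>n. (r, u) \<in> ?R ^^ n"
    using network unfolding river_network_def rtrancl_power by blast
  then have u: "(r, u) \<in> ?R ^^ depth u" unfolding depth_def by (rule LeastI_ex)
  have "depth u \<noteq> 0"
  proof
    assume "depth u = 0"
    with u have "r = u" by simp
    with assms network show False by (simp add: river_network_def)
  qed
  then obtain m where m: "depth u = Suc m" by (cases "depth u") auto
  then obtain e' where e': "(r, e') \<in> ?R ^^ m" "u \<in> trib e'"
    using u by auto
  have "e' = e"
    using network e'(2) assms unfolding river_network_def by blast
  then have "depth e \<le> m" unfolding depth_def using e'(1) by (intro Least_le) simp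
  then show ?thesis using m by simp
qed

text \<open>With the factor 1/3 per level, two tributaries carry at most 2/3 of the weight of their
  link, so the drainage in row \<open>Inl e\<close> exceeds the inflow from upstream by at least
  \<open>K e / 3\<close> times that weight. A runoff weight of 1/6 uses up half of this margin and
  leaves \<open>K e / 6\<close>.\<close>

definition lyapunov :: "real^('e + 'e)" where
  "lyapunov = (\<chi> i. case i of Inl e \<Rightarrow> (1 / 3) ^ depth e | Inr e \<Rightarrow> (1 / 3) ^ depth e / 6)"

lemma lyapunov_pos: "0 < lyapunov $ i"
  by (cases i) (simp_all add: lyapunov_def)

lemma lyapunov_tributaries: "(\<Sum>u\<in>trib e. lyapunov $ Inl u) \<le> 2 / 3 * lyapunov $ Inl e"
proof -
  have "lyapunov $ Inl u \<le> lyapunov $ Inl e / 3" if "u \<in> trib e" for u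
  proof -
    have "(1 / 3 :: real) ^ depth u \<le> (1 / 3) ^ Suc (depth e)"
      using depth_tributary[OF that] by (intro power_decreasing) auto
    then show ?thesis by (simp add: lyapunov_def)
  qed
  then have "(\<Sum>u\<in>trib e. lyapunov $ Inl u) \<le> real (card (trib e)) * (lyapunov $ Inl e / 3)"
    by (rule sum_bounded_above)
  also have "\<dots> \<le> 2 * (lyapunov $ Inl e / 3)"
    using network lyapunov_pos[of "Inl e"]
    by (intro mult_right_mono) (auto simp: river_network_def less_imp_le, metis card.empty of_nat_0 of_nat_numeral order_refl zero_le_numeral)
  finally show ?thesis by simp
qed

lemma lyapunov_decrease:
  "(river_matrix trib K H *v lyapunov) $ Inl e \<le> - (K e / 6) * lyapunov $ Inl e"
  "(river_matrix trib K H *v lyapunov) $ Inr e = - H e * lyapunov $ Inr e"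
proof -
  let ?w = "\<lambda>e. lyapunov $ Inl e"
  have "?w e - (\<Sum>u\<in>trib e. ?w u) =
      (\<Sum>e'\<in>UNIV. (if e' = e then ?w e' else 0) - (if e' \<in> trib e then ?w e' else 0))"
    by (simp add: sum_subtractf sum.delta sum.If_cases)
  also have "\<dots> \<le> (\<Sum>e'\<in>UNIV. incidence_matrix trib $ e $ e' * ?w e')"
    using lyapunov_pos by (intro sum_mono) (auto simp: incidence_matrix_def less_imp_le)
  finally have inc: "?w e / 3 \<le> (\<Sum>e'\<in>UNIV. incidence_matrix trib $ e $ e' * ?w e')"
    using lyapunov_tributaries[of e] by simp
  have "(river_matrix trib K H *v lyapunov) $ Inl e =
      - (K e * (\<Sum>e'\<in>UNIV. incidence_matrix trib $ e $ e' * ?w e')) + K e * lyapunov $ Inr e"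
    by (simp add: matrix_vector_mult_def sum_UNIV_sum river_matrix_simps sum_distrib_left sum_negf mult.assoc
        if_distrib[where f = "\<lambda>x. x * _"] cong: if_cong)
  also have "\<dots> \<le> - (K e * (?w e / 3)) + K e * (?w e / 6)"
    using K_pos[of e] inc by (intro add_mono) (auto intro!: mult_left_mono simp: lyapunov_def)
  also have "\<dots> = - (K e / 6) * ?w e" by simp
  finally show "(river_matrix trib K H *v lyapunov) $ Inl e \<le> - (K e / 6) * ?w e" .
  show "(river_matrix trib K H *v lyapunov) $ Inr e = - H e * lyapunov $ Inr e"
    by (simp add: matrix_vector_mult_def sum_UNIV_sum river_matrix_simps
        if_distrib[where f = "\<lambda>x. x * _"] cong: if_cong)
qed

text \<open>The slowest of the rates \<open>K e / 6\<close> (streamflow rows) and \<open>H e\<close>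
  (runoff rows) in \<open>lyapunov_decrease\<close>.\<close>

definition decay :: real where
  "decay = Min (range (\<lambda>e. min (K e / 6) (H e)))"

lemma decay_pos: "0 < decay"
  unfolding decay_def using K_pos H_pos by (subst Min_gr_iff) auto

lemma decay_le: "decay \<le> K e / 6" "decay \<le> H e"
proof -
  have "decay \<le> min (K e / 6) (H e)"
    unfolding decay_def by (intro Min_le) auto
  then show "decay \<le> K e / 6" "decay \<le> H e" by simp_all
qed

lemma flow_nonneg: "0 \<le> v \<Longrightarrow> 0 \<le> flow v $ i $ j"
  by (rule metzler_mat_exp_nonneg[OF metzler])

text \<open>One entry of the flow times one entry of \<open>lyapunov\<close> is at most the
  corresponding entry of \<open>flow v *v lyapunov\<close>, all terms being nonnegative. The
  constant is the largest ratio of two entries of \<open>lyapunov\<close>, enlarged to at least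
  1.\<close>

lemma flow_decay:
  obtains C where "1 \<le> C" "\<And>v i j. 0 \<le> v \<Longrightarrow> flow v $ i $ j \<le> C * exp (- (decay * v))"
proof -
  define C where "C = Max (insert 1 (range (\<lambda>(i, j). lyapunov $ i / lyapunov $ j)))"
  have C1: "1 \<le> C" unfolding C_def by (intro Max_ge) auto
  have C: "lyapunov $ i / lyapunov $ j \<le> C" for i j
    unfolding C_def by (intro Max_ge) auto
  have dec: "(river_matrix trib K H *v lyapunov) $ i \<le> - decay * lyapunov $ i" for i
  proof (cases i)
    case (Inl e)
    have "- (K e / 6) * lyapunov $ Inl e \<le> - decay * lyapunov $ Inl e"
      using decay_le(1)[of e] lyapunov_pos[of "Inl e"] by (intro mult_right_mono) auto
    then show ?thesis using lyapunov_decrease(1)[of e] Inl by simp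
  next
    case (Inr e)
    have "- H e * lyapunov $ Inr e \<le> - decay * lyapunov $ Inr e"
      using decay_le(2)[of e] lyapunov_pos[of "Inr e"] by (intro mult_right_mono) auto
    then show ?thesis using lyapunov_decrease(2)[of e] Inr by simp
  qed
  have "flow v $ i $ j \<le> C * exp (- (decay * v))" if v: "0 \<le> v" for v i j
  proof -
    have "flow v $ i $ j * lyapunov $ j \<le> (flow v *v lyapunov) $ i"
      unfolding matrix_vector_mult_def vec_lambda_beta
      using flow_nonneg[OF v] lyapunov_pos
      by (intro member_le_sum[of j UNIV "\<lambda>j. flow v $ i $ j * lyapunov $ j"]) (auto intro!: mult_nonneg_nonneg intro: less_imp_le)
    also have "\<dots> \<le> exp (- (decay * v)) * lyapunov $ i"
      by (rule metzler_mat_exp_decay[OF metzler v lyapunov_pos dec])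
    finally have "flow v $ i $ j \<le> exp (- (decay * v)) * (lyapunov $ i / lyapunov $ j)"
      using lyapunov_pos[of j] by (simp add: field_simps)
    also have "\<dots> \<le> exp (- (decay * v)) * C" by (intro mult_left_mono C) simp
    finally show ?thesis by (simp add: mult.commute)
  qed
  with C1 show ?thesis by (rule that)
qed

text \<open>Runoff feeds the streamflow of its own link at first order: the matrix has entry
  \<open>K e\<close> there, and \<open>metzler_mat_exp_ge\<close> retains it. At
  \<open>v = 0\<close> the entry is zero.\<close>

lemma flow_pos_streamflow:
  assumes "0 < v" shows "0 < flow v $ Inl e $ Inr e"
  using assms K_pos[of e]
  by (intro less_le_trans[OF _ metzler_mat_exp_ge[OF metzler]]) (auto simp: mat_def river_matrix_simps)

lemma flow_pos_runoff:
  assumes "0 \<le> v" shows "0 < flow v $ Inr e $ Inr e"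
  using assms
  by (intro less_le_trans[OF _ metzler_mat_exp_ge[OF metzler]]) (auto simp: mat_def)

section \<open>Jumps of the state and their duals\<close>

text \<open>The jump caused by a single mark \<open>p\<close>: \<open>jump H a P n w\<close> is
  \<open>embed (P n w)\<close>.\<close>

definition embed :: "real^'e \<Rightarrow> real^('e + 'e)" where
  "embed p = (\<chi> i. case i of Inl e \<Rightarrow> 0 | Inr e \<Rightarrow> H e * a e * p $ e)"

text \<open>The adjoint of the map taking \<open>p\<close> to \<open>flow v *v embed p\<close>,
  applied to \<open>s\<close>: it carries a Laplace variable on the state space to one on the space
  of marks.\<close>

definition pull :: "real^('e + 'e) \<Rightarrow> real \<Rightarrow> real^'e" where
  "pull s v = (\<chi> e. H e * a e * (transpose (flow v) *v s) $ Inr e)"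

lemma inner_flow_embed: "s \<bullet> (flow v *v embed p) = pull s v \<bullet> p"
proof -
  have "s \<bullet> (flow v *v embed p) = (transpose (flow v) *v s) \<bullet> embed p"
    by (simp add: dot_lmul_matrix[symmetric] vector_transpose_matrix)
  also have "\<dots> = pull s v \<bullet> p"
    by (simp add: inner_vec_def embed_def pull_def sum_UNIV_sum mult_ac)
  finally show ?thesis .
qed

lemma pull_nonneg:
  assumes "\<And>i. 0 \<le> s $ i" "0 \<le> v"
  shows "0 \<le> pull s v $ e"
  unfolding pull_def matrix_vector_mult_def transpose_def
  using assms flow_nonneg[OF assms(2)] H_pos[of e] a_pos[of e]
  by (auto intro!: mult_nonneg_nonneg sum_nonneg intro: less_imp_le)

lemma continuous_flow_vec: "continuous_on S (\<lambda>v. flow v *v x)"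
  unfolding matrix_vector_mult_def
  by (intro continuous_intros continuous_mat_exp_entry)

lemma continuous_pull: "continuous_on S (pull s)"
  unfolding pull_def[abs_def] matrix_vector_mult_def transpose_def vec_lambda_beta
  by (intro continuous_intros continuous_mat_exp_entry)

text \<open>Transposing \<open>flow t ** flow v\<close> reverses the factors and puts
  \<open>transpose (flow t)\<close> next to \<open>s\<close>. This is the source of the cocycle
  identity of the exponents.\<close>

lemma pull_add: "pull s (t + v) = pull (transpose (flow t) *v s) v"
  unfolding pull_def mat_exp_add matrix_transpose_mul matrix_vector_mul_assoc ..

lemma transpose_flow_nonneg:
  assumes "\<And>i. 0 \<le> s $ i" "0 \<le> t"
  shows "0 \<le> (transpose (flow t) *v s) $ i"
  unfolding matrix_vector_mult_def transpose_def
  using assms flow_nonneg[OF assms(2)] by (auto intro!: sum_nonneg mult_nonneg_nonneg)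

lemma pull_scaleR: "pull (c *\<^sub>R s) v = c *\<^sub>R pull s v"
  by (simp add: pull_def vec_eq_iff matrix_vector_mult_scaleR)

end

section \<open>The noise in a river network\<close>

text \<open>\<open>ln (max 1 x)\<close> is the positive part of the logarithm for
  \<open>x > 0\<close> and vanishes at \<open>x = 0\<close>, so the logarithmic moment becomes an
  integral over all of \<Omega>.\<close>

locale river_noise = river r trib K H a + shot_noise \<Omega> rate N P f
  for r :: "'e::finite" and trib and K H a and \<Omega> :: "'w measure" and rate N P and f :: "real^'e \<Rightarrow> real" +
  assumes log_moment: "(\<integral>\<^sup>+w. ennreal (ln (max 1 (norm (embed (P 1 w))))) \<partial>\<Omega>) < \<infinity>"
begin

definition loss :: "real^('e + 'e) \<Rightarrow> real \<Rightarrow> real" where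
  "loss s v = 1 - laplace_orthant f (pull s v)"

text \<open>
  \<open>Z t\<close> is the contribution of the noise to the solution at time \<open>t\<close>. In \<open>W t\<close> a jump at time
  \<open>v\<close> is weighted by \<open>flow v\<close> instead of \<open>flow (t - v)\<close>: it has the same law, but converges pathwise.
\<close>

definition Z :: "real \<Rightarrow> 'w \<Rightarrow> real^('e + 'e)" where
  "Z t = shot (\<lambda>v p. flow (t - v) *v embed p) t"

definition W :: "real \<Rightarrow> 'w \<Rightarrow> real^('e + 'e)" where
  "W t = shot (\<lambda>v p. flow v *v embed p) t"

lemma embed_measurable: "embed \<in> borel_measurable borel"
  unfolding embed_def[abs_def]
proof (rule borel_measurable_vec_lambda)
  show "(\<lambda>p. case i of Inl e \<Rightarrow> 0 | Inr e \<Rightarrow> H e * a e * p $ e) \<in> borel_measurable borel" for i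
    by (cases i) simp_all
qed

lemma flow_embed_measurable:
  assumes [measurable]: "g \<in> borel_measurable borel"
  shows "(\<lambda>(v, p). flow (g v) *v embed p) \<in> borel_measurable (borel \<Otimes>\<^sub>M borel)"
proof -
  have [measurable]: "(\<lambda>v. flow v $ i $ j) \<in> borel_measurable borel" for i j
    by (intro borel_measurable_continuous_onI continuous_mat_exp_entry)
  note embed_measurable[measurable]
  have comp: "(\<lambda>p. embed p $ j) \<in> borel_measurable borel" for j
    by (rule measurable_compose[OF embed_measurable]) simp
  have "(\<lambda>x. \<chi> i. \<Sum>j\<in>UNIV. flow (g (fst x)) $ i $ j * embed (snd x) $ j) \<in> borel_measurable (borel \<Otimes>\<^sub>M borel)"
    by (intro borel_measurable_vec_lambda borel_measurable_sum borel_measurable_times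
      measurable_compose[OF measurable_snd comp]) measurable
  then show ?thesis by (simp add: matrix_vector_mult_def case_prod_beta)
qed

lemma Z_measurable: "0 < t \<Longrightarrow> Z t \<in> borel_measurable \<Omega>"
  and W_measurable: "0 < t \<Longrightarrow> W t \<in> borel_measurable \<Omega>"
  unfolding Z_def W_def by (intro shot_measurable flow_embed_measurable; simp)+

lemma inner_shot: "s \<bullet> shot G t w = shot (\<lambda>v p. s \<bullet> G v p) t w"
  by (simp add: shot_def inner_sum_right)

lemma expectation_exp_W:
  assumes "0 < t" "\<And>i. 0 \<le> s $ i"
  shows "expectation (\<lambda>w. exp (- (s \<bullet> W t w))) = exp (- (rate * integral {0..t} (loss s)))"
  unfolding W_def inner_shot inner_flow_embed loss_def[abs_def]
  using assms by (intro expectation_exp_shot continuous_pull pull_nonneg) auto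

lemma expectation_exp_Z:
  assumes "0 < t" "\<And>i. 0 \<le> s $ i"
  shows "expectation (\<lambda>w. exp (- (s \<bullet> Z t w))) = exp (- (rate * integral {0..t} (loss s)))"
proof -
  have "expectation (\<lambda>w. exp (- (s \<bullet> Z t w))) =
      exp (- (rate * integral {0..t} (\<lambda>v. 1 - laplace_orthant f (pull s (t - v)))))"
    unfolding Z_def inner_shot inner_flow_embed
    using assms by (intro expectation_exp_shot continuous_on_compose2[OF continuous_pull[of UNIV]] pull_nonneg continuous_intros) auto
  also have "integral {0..t} (\<lambda>v. 1 - laplace_orthant f (pull s (t - v))) = integral {0..t} (loss s)"
    using integral_shift_real_ivl[of "-t" "-t" 0 "\<lambda>x. loss s (- x)"]
      Henstock_Kurzweil_Integration.integral_reflect_real[of t 0 "loss s"]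
    by (simp add: loss_def)
  finally show ?thesis .
qed

lemma embed_nonneg: "p \<in> pos_orthant \<Longrightarrow> 0 \<le> embed p $ i"
  using H_pos a_pos by (cases i) (auto simp: embed_def pos_orthant_def intro!: mult_nonneg_nonneg intro: less_imp_le)

lemma flow_embed_nonneg: "p \<in> pos_orthant \<Longrightarrow> 0 \<le> v \<Longrightarrow> 0 \<le> (flow v *v embed p) $ i"
  unfolding matrix_vector_mult_def
  by (auto intro!: sum_nonneg mult_nonneg_nonneg flow_nonneg embed_nonneg)

lemma
  assumes w: "w \<in> space \<Omega>" "pos_marks w" and t: "0 \<le> t"
  shows Z_nonneg: "0 \<le> Z t w $ i" and W_nonneg: "0 \<le> W t w $ i"
  unfolding Z_def W_def shot_def sum_component using jump_time_in[OF w(1) t] w(2)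
  by (auto intro!: sum_nonneg flow_embed_nonneg intro: less_imp_le)

text \<open>The weight of a jump in \<open>W t\<close> does not involve \<open>t\<close>; a larger
  \<open>t\<close> only adds nonnegative terms.\<close>

lemma W_mono:
  assumes w: "w \<in> space \<Omega>" "pos_marks w" and t: "0 \<le> t" "t \<le> u"
  shows "W t w $ i \<le> W u w $ i"
proof -
  have u: "0 \<le> u" using t by simp
  have "N t w \<le> N u w" by (rule N_mono[OF w(1) t])
  then show ?thesis
    unfolding W_def shot_def sum_component using jump_time_in[OF w(1) u] w(2)
    by (intro sum_mono2) (auto intro!: flow_embed_nonneg intro: less_imp_le)
qed

lemma AE_good: "AE w in \<Omega>. w \<in> space \<Omega> \<and> pos_marks w"
  using AE_mark_pos AE_space by eventually_elim simp

lemma distr_Z_eq_W: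
  assumes t: "0 < t"
  shows "distr \<Omega> borel (Z t) = distr \<Omega> borel (W t)"
proof (rule laplace_transform_unique)
  have "AE w in \<Omega>. \<forall>i. 0 \<le> Z t w $ i" "AE w in \<Omega>. \<forall>i. 0 \<le> W t w $ i"
    by (rule eventually_mono[OF AE_good]; use Z_nonneg W_nonneg t in \<open>auto intro: less_imp_le\<close>)+
  then show "AE x in distr \<Omega> borel (Z t). \<forall>i. 0 \<le> x $ i" "AE x in distr \<Omega> borel (W t). \<forall>i. 0 \<le> x $ i"
    by (simp_all add: AE_distr_iff[OF Z_measurable[OF t]] AE_distr_iff[OF W_measurable[OF t]])
  fix s :: "real^('e + 'e)" assume "\<And>i. 0 \<le> s $ i"
  then show "(\<integral>x. exp (- (s \<bullet> x)) \<partial>distr \<Omega> borel (Z t)) = (\<integral>x. exp (- (s \<bullet> x)) \<partial>distr \<Omega> borel (W t))"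
    using t by (simp add: integral_distr Z_measurable W_measurable expectation_exp_Z expectation_exp_W)
qed (auto intro!: prob_space_distr Z_measurable W_measurable t)

lemma loss_bounds:
  assumes "\<And>i. 0 \<le> s $ i" "0 \<le> v"
  shows "0 \<le> loss s v" "loss s v \<le> 1"
  using laplace_orthant_bounds[of "pull s v"] pull_nonneg[OF assms] by (simp_all add: loss_def)

lemma continuous_loss: "(\<And>i. 0 \<le> s $ i) \<Longrightarrow> continuous_on {0..} (loss s)"
  unfolding loss_def[abs_def]
  by (intro continuous_intros continuous_on_compose2[OF continuous_laplace_orthant continuous_pull])
    (auto intro: pull_nonneg)

section \<open>Integrability of the loss over all times\<close>

lemma inner_pull_le:
  assumes s: "\<And>i. 0 \<le> s $ i"
  obtains C where "1 \<le> C" "\<And>v p. 0 \<le> v \<Longrightarrow> p \<in> pos_orthant \<Longrightarrow>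
    pull s v \<bullet> p \<le> C * exp (- (decay * v)) * norm (embed p)"
proof -
  obtain C0 where C0: "1 \<le> C0" "\<And>v i j. 0 \<le> v \<Longrightarrow> flow v $ i $ j \<le> C0 * exp (- (decay * v))"
    using flow_decay by blast
  define C where "C = max 1 (\<Sum>i\<in>UNIV. s $ i * (\<Sum>j\<in>(UNIV :: ('e + 'e) set). C0))"
  have "pull s v \<bullet> p \<le> C * exp (- (decay * v)) * norm (embed p)"
    if v: "0 \<le> v" and p: "p \<in> pos_orthant" for v p
  proof -
    let ?x = "exp (- (decay * v)) * norm (embed p)"
    have "pull s v \<bullet> p = (\<Sum>i\<in>UNIV. s $ i * (\<Sum>j\<in>UNIV. flow v $ i $ j * embed p $ j))"
      unfolding inner_flow_embed[symmetric] by (simp add: inner_vec_def matrix_vector_mult_def)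
    also have "\<dots> \<le> (\<Sum>i\<in>UNIV. s $ i * (\<Sum>j\<in>(UNIV :: ('e + 'e) set). C0 * ?x))"
    proof (intro sum_mono mult_left_mono s)
      fix i j
      have "embed p $ j \<le> norm (embed p)" using component_le_norm_cart[of "embed p" j] by simp
      then have "flow v $ i $ j * embed p $ j \<le> (C0 * exp (- (decay * v))) * norm (embed p)"
        using C0 v embed_nonneg[OF p] flow_nonneg[OF v] by (intro mult_mono) auto
      then show "flow v $ i $ j * embed p $ j \<le> C0 * ?x" by (simp add: mult_ac)
    qed
    also have "\<dots> = (\<Sum>i\<in>UNIV. s $ i * (\<Sum>j\<in>(UNIV :: ('e + 'e) set). C0)) * ?x"
      by (simp only: sum_distrib_right sum_distrib_left mult.assoc)
    also have "\<dots> \<le> C * ?x" unfolding C_def by (intro mult_right_mono) auto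
    finally show ?thesis by (simp add: mult_ac)
  qed
  moreover have "1 \<le> C" by (simp add: C_def)
  ultimately show ?thesis using that by blast
qed

lemma exp_uminus_mult_tendsto_0:
  assumes "0 < (c::real)"
  shows "((\<lambda>v. exp (- (c * v))) \<longlongrightarrow> 0) at_top"
proof (rule filterlim_compose[OF exp_at_bot])
  show "filterlim (\<lambda>v. - (c * v)) at_bot at_top"
    unfolding filterlim_uminus_at_bot minus_minus
    by (rule filterlim_tendsto_pos_mult_at_top[OF tendsto_const assms filterlim_ident])
qed

text \<open>The exponential falls to 1 at \<open>v = L / c\<close>. Before that time the integrand
  is at most 1, with area \<open>L / c\<close>; afterwards the exponential has area
  \<open>1 / c\<close>. The bound is linear in \<open>L\<close>, so that a logarithmic moment will
  be enough.\<close>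

lemma nn_integral_min_exp:
  assumes c: "0 < c" and L: "0 \<le> L"
  shows "(\<integral>\<^sup>+v. indicator {0..} v * ennreal (min 1 (exp (L - c * v))) \<partial>lborel) \<le> ennreal (L / c + 1 / c)"
proof -
  have "(\<integral>\<^sup>+v. indicator {0..} v * ennreal (min 1 (exp (L - c * v))) \<partial>lborel) \<le>
      (\<integral>\<^sup>+v. indicator {0..L / c} v + ennreal (exp (L - c * v)) * indicator {L / c..} v \<partial>lborel)"
  proof (rule nn_integral_mono)
    fix v
    show "indicator {0..} v * ennreal (min 1 (exp (L - c * v))) \<le>
        indicator {0..L / c} v + ennreal (exp (L - c * v)) * indicator {L / c..} v"
    proof (cases "v \<le> L / c")
      case True
      have "ennreal (min 1 (exp (L - c * v))) \<le> ennreal 1" by (intro ennreal_leI) simp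
      then have "indicator {0..} v * ennreal (min 1 (exp (L - c * v))) \<le> indicator {0..L / c} v"
        using True by (simp add: indicator_def)
      then show ?thesis by (rule order_trans) simp
    next
      case False
      have "ennreal (min 1 (exp (L - c * v))) \<le> ennreal (exp (L - c * v))" by (intro ennreal_leI) simp
      with False show ?thesis by (simp add: indicator_def)
    qed
  qed
  also have "\<dots> = (\<integral>\<^sup>+v. indicator {0..L / c} v \<partial>lborel) +
      (\<integral>\<^sup>+v. ennreal (exp (L - c * v)) * indicator {L / c..} v \<partial>lborel)"
    by (rule nn_integral_add) simp_all
  also have "(\<integral>\<^sup>+v. ennreal (exp (L - c * v)) * indicator {L / c..} v \<partial>lborel) =
      ennreal (0 - (- exp (L - c * (L / c)) / c))"
  proof (rule nn_integral_FTC_atLeast)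
    show "DERIV (\<lambda>v. - exp (L - c * v) / c) x :> exp (L - c * x)" for x
      using c by (auto intro!: derivative_eq_intros)
    have "((\<lambda>v. exp (- (c * v))) \<longlongrightarrow> 0) at_top" by (rule exp_uminus_mult_tendsto_0[OF c])
    then have "((\<lambda>v. (- exp L / c) * exp (- (c * v))) \<longlongrightarrow> (- exp L / c) * 0) at_top"
      by (intro tendsto_intros)
    moreover have "(- exp L / c) * exp (- (c * v)) = - exp (L - c * v) / c" for v
      by (simp add: exp_diff exp_minus divide_inverse)
    ultimately show "((\<lambda>v. - exp (L - c * v) / c) \<longlongrightarrow> 0) at_top" by (simp only: mult_zero_right)
  qed simp_all
  also have "(\<integral>\<^sup>+v. indicator {0..L / c} v \<partial>lborel) = ennreal (L / c)"
    using c L by simp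
  finally show ?thesis
    using c L by (simp add: ennreal_plus[symmetric] del: ennreal_plus)
qed

text \<open>Fubini's theorem moves the expectation outside. For a fixed mark,
  \<open>1 - exp (- x)\<close> is at most both 1 and \<open>x\<close>, so with the decay of the flow
  the loss at time \<open>v\<close> is at most \<open>min 1 (exp (L w - decay * v))\<close>. Its
  time integral grows linearly in \<open>L w\<close>, hence in the logarithm of the jump size, and
  the logarithmic moment closes the estimate.\<close>

lemma loss_integrable:
  assumes s: "\<And>i. 0 \<le> s $ i"
  shows "set_integrable lborel {0..} (loss s)"
proof -
  obtain C where C: "1 \<le> C" "\<And>v p. 0 \<le> v \<Longrightarrow> p \<in> pos_orthant \<Longrightarrow>
      pull s v \<bullet> p \<le> C * exp (- (decay * v)) * norm (embed p)"
    using inner_pull_le[OF s] by blast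
  define L where "L w = ln (max 1 (norm (embed (P 1 w)))) + ln C" for w
  have P1[measurable]: "P 1 \<in> borel_measurable \<Omega>" by (rule mark_measurable) simp
  have [measurable]: "pull s \<in> borel_measurable borel"
    by (rule borel_measurable_continuous_onI[OF continuous_pull])
  note embed_measurable[measurable]
  let ?F = "\<lambda>v w. indicator {0..} v * ennreal (1 - exp (- (pull s v \<bullet> P 1 w)))"
  interpret LO: pair_sigma_finite lborel \<Omega> ..
  have "(\<integral>\<^sup>+v. ennreal (norm (indicator {0..} v *\<^sub>R loss s v)) \<partial>lborel) =
      (\<integral>\<^sup>+v. (\<integral>\<^sup>+w. ?F v w \<partial>\<Omega>) \<partial>lborel)"
  proof (rule nn_integral_cong)
    fix v :: real
    show "ennreal (norm (indicator {0..} v *\<^sub>R loss s v)) = (\<integral>\<^sup>+w. ?F v w \<partial>\<Omega>)"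
    proof (cases "0 \<le> v")
      case True
      have int: "integrable \<Omega> (\<lambda>w. exp (- (pull s v \<bullet> P 1 w)))"
        using pull_nonneg[OF s True] by (intro integrable_exp_mark) auto
      have "(\<integral>\<^sup>+w. ?F v w \<partial>\<Omega>) = (\<integral>\<^sup>+w. ennreal (1 - exp (- (pull s v \<bullet> P 1 w))) \<partial>\<Omega>)"
        using True by simp
      also have "\<dots> = ennreal (expectation (\<lambda>w. 1 - exp (- (pull s v \<bullet> P 1 w))))"
        using int AE_exp_mark_le_1[of 1 "pull s v"] pull_nonneg[OF s True]
        by (intro nn_integral_eq_integral) auto
      also have "expectation (\<lambda>w. 1 - exp (- (pull s v \<bullet> P 1 w))) = loss s v"
        using int expectation_exp_mark[of 1 "pull s v"] by (simp add: loss_def prob_space)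
      finally show ?thesis using True loss_bounds[OF s True] by simp
    qed simp
  qed
  also have "\<dots> = (\<integral>\<^sup>+w. (\<integral>\<^sup>+v. ?F v w \<partial>lborel) \<partial>\<Omega>)"
    by (rule LO.Fubini'[symmetric]) measurable
  also have "\<dots> \<le> (\<integral>\<^sup>+w. ennreal (L w / decay + 1 / decay) \<partial>\<Omega>)"
    using AE_good
  proof (intro nn_integral_mono_AE, eventually_elim)
    fix w assume "w \<in> space \<Omega> \<and> pos_marks w"
    then have p: "P 1 w \<in> pos_orthant" by simp
    have L: "0 \<le> L w" using C(1) by (simp add: L_def)
    have eL: "exp (L w) = max 1 (norm (embed (P 1 w))) * C"
      using C(1) by (simp add: L_def exp_add)
    have "?F v w \<le> indicator {0..} v * ennreal (min 1 (exp (L w - decay * v)))" for v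
    proof (cases "0 \<le> v")
      case True
      have "1 - exp (- (pull s v \<bullet> P 1 w)) \<le> pull s v \<bullet> P 1 w"
        using exp_ge_add_one_self[of "- (pull s v \<bullet> P 1 w)"] by simp
      also have "\<dots> \<le> C * exp (- (decay * v)) * norm (embed (P 1 w))" by (rule C(2)[OF True p])
      also have "\<dots> \<le> C * exp (- (decay * v)) * max 1 (norm (embed (P 1 w)))"
        using C(1) by (intro mult_left_mono) auto
      also have "\<dots> = exp (L w - decay * v)"
        unfolding exp_diff eL by (simp add: exp_minus field_simps)
      finally have "1 - exp (- (pull s v \<bullet> P 1 w)) \<le> min 1 (exp (L w - decay * v))" by simp
      then show ?thesis using True by (simp add: ennreal_leI)
    qed simp
    then have "(\<integral>\<^sup>+v. ?F v w \<partial>lborel) \<le>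
        (\<integral>\<^sup>+v. indicator {0..} v * ennreal (min 1 (exp (L w - decay * v))) \<partial>lborel)"
      by (rule nn_integral_mono)
    also have "\<dots> \<le> ennreal (L w / decay + 1 / decay)"
      by (rule nn_integral_min_exp[OF decay_pos L])
    finally show "(\<integral>\<^sup>+v. ?F v w \<partial>lborel) \<le> ennreal (L w / decay + 1 / decay)" .
  qed
  also have "\<dots> = (\<integral>\<^sup>+w. ennreal (ln (max 1 (norm (embed (P 1 w))))) * ennreal (1 / decay) +
      ennreal ((ln C + 1) / decay) \<partial>\<Omega>)"
  proof (rule nn_integral_cong)
    fix w
    have "ln (max 1 (norm (embed (P 1 w)))) \<ge> 0" "ln C \<ge> 0" using C(1) by simp_all
    then have "ennreal (ln (max 1 (norm (embed (P 1 w))))) * ennreal (1 / decay) + ennreal ((ln C + 1) / decay)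
        = ennreal (ln (max 1 (norm (embed (P 1 w)))) * (1 / decay) + (ln C + 1) / decay)"
      using decay_pos by (simp add: ennreal_mult[symmetric] ennreal_plus[symmetric] del: ennreal_plus)
    then show "ennreal (L w / decay + 1 / decay) =
        ennreal (ln (max 1 (norm (embed (P 1 w))))) * ennreal (1 / decay) + ennreal ((ln C + 1) / decay)"
      by (simp add: L_def add_divide_distrib add.assoc)
  qed
  also have "\<dots> = (\<integral>\<^sup>+w. ennreal (ln (max 1 (norm (embed (P 1 w))))) \<partial>\<Omega>) * ennreal (1 / decay) +
      ennreal ((ln C + 1) / decay)"
  proof -
    have m: "(\<lambda>w. ennreal (ln (max 1 (norm (embed (P 1 w)))))) \<in> borel_measurable \<Omega>" by measurable
    then have "(\<lambda>w. ennreal (ln (max 1 (norm (embed (P 1 w))))) * ennreal (1 / decay)) \<in> borel_measurable \<Omega>"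
      by measurable
    then show ?thesis
      by (subst nn_integral_add) (simp_all only: nn_integral_multc[OF m] nn_integral_const emeasure_space_1 borel_measurable_const mult_1_right)
  qed
  also have "\<dots> < \<infinity>"
    using log_moment by (simp add: ennreal_mult_less_top)
  finally have "(\<integral>\<^sup>+v. ennreal (norm (indicator {0..} v *\<^sub>R loss s v)) \<partial>lborel) < \<infinity>" .
  moreover have "(\<lambda>v. indicator {0..} v *\<^sub>R loss s v) \<in> borel_measurable lborel"
    using borel_measurable_continuous_on_indicator[OF _ continuous_loss[OF s]] by simp
  ultimately show ?thesis
    unfolding set_integrable_def by (intro integrableI_bounded)
qed

definition total_loss :: "real^('e + 'e) \<Rightarrow> real" where
  "total_loss s = (LBINT v:{0..}. loss s v)"

lemma integral_loss_tendsto: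
  assumes s: "\<And>i. 0 \<le> s $ i"
  shows "((\<lambda>t. integral {0..t} (loss s)) \<longlongrightarrow> total_loss s) at_top"
proof (rule Lim_transform_eventually)
  show "((\<lambda>t. LBINT v:{0..t}. loss s v) \<longlongrightarrow> total_loss s) at_top"
    unfolding total_loss_def by (rule tendsto_set_lebesgue_integral_at_top[OF _ loss_integrable[OF s]]) simp
  show "\<forall>\<^sub>F t in at_top. (LBINT v:{0..t}. loss s v) = integral {0..t} (loss s)"
    by (intro always_eventually allI set_borel_integral_eq_integral set_integrable_subset[OF loss_integrable[OF s]]) auto
qed

text \<open>It supplies the dominating function for the limit of small \<open>c\<close> in the next
  lemma.\<close>

lemma loss_scale_le:
  assumes s: "\<And>i. 0 \<le> s $ i" and c: "0 \<le> c" "c \<le> 1" and v: "0 \<le> v"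
  shows "loss (c *\<^sub>R s) v \<le> loss s v"
proof -
  let ?h = "pull s v"
  have h: "0 \<le> ?h $ i" "0 \<le> (c *\<^sub>R ?h) $ i" for i
    using pull_nonneg[OF s v] c by simp_all
  have "expectation (\<lambda>w. exp (- (?h \<bullet> P 1 w))) \<le> expectation (\<lambda>w. exp (- ((c *\<^sub>R ?h) \<bullet> P 1 w)))"
  proof (rule integral_mono_AE)
    show "AE w in \<Omega>. exp (- (?h \<bullet> P 1 w)) \<le> exp (- ((c *\<^sub>R ?h) \<bullet> P 1 w))"
      using AE_mark_pos
    proof eventually_elim
      fix w assume "pos_marks w"
      then have "0 \<le> ?h \<bullet> P 1 w"
        using h(1) unfolding inner_vec_def pos_orthant_def
        by (intro sum_nonneg) (auto intro!: mult_nonneg_nonneg intro: less_imp_le)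
      then show "exp (- (?h \<bullet> P 1 w)) \<le> exp (- ((c *\<^sub>R ?h) \<bullet> P 1 w))"
        using c by (simp add: mult_left_le_one_le)
    qed
  qed (rule integrable_exp_mark[OF order_refl h(1)], rule integrable_exp_mark[OF order_refl h(2)])
  then show ?thesis
    unfolding expectation_exp_mark[OF order_refl] by (simp add: loss_def pull_scaleR)
qed

text \<open>This is continuity at 0, along one ray, of the exponent of the limit law. It is what
  prevents mass from escaping to infinity.\<close>

lemma total_loss_scale_tendsto:
  assumes s: "\<And>i. 0 \<le> s $ i"
  shows "(\<lambda>k. total_loss ((1 / real (Suc k)) *\<^sub>R s)) \<longlonglongrightarrow> 0"
proof -
  let ?c = "\<lambda>k. 1 / real (Suc k)"
  have c: "0 \<le> ?c k" "?c k \<le> 1" for k by simp_all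
  have cs: "0 \<le> (?c k *\<^sub>R s) $ i" for k i using s by simp
  have "(\<lambda>k. \<integral>v. indicator {0..} v *\<^sub>R loss (?c k *\<^sub>R s) v \<partial>lborel) \<longlonglongrightarrow> (\<integral>v. 0 \<partial>(lborel :: real measure))"
  proof (rule integral_dominated_convergence[where w = "\<lambda>v. indicator {0..} v *\<^sub>R loss s v"])
    show "integrable lborel (\<lambda>v. indicator {0..} v *\<^sub>R loss s v)"
      using loss_integrable[OF s] by (simp add: set_integrable_def)
    show "(\<lambda>v. indicator {0..} v *\<^sub>R loss (?c k *\<^sub>R s) v) \<in> borel_measurable lborel" for k
      using loss_integrable[OF cs] by (auto simp: set_integrable_def dest: borel_measurable_integrable)
    show "AE v in lborel. norm (indicator {0..} v *\<^sub>R loss (?c k *\<^sub>R s) v) \<le> indicator {0..} v *\<^sub>R loss s v" for k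
      using loss_scale_le[OF s c] loss_bounds(1)[OF cs] by (intro AE_I2) (auto simp: indicator_def)
    show "AE v in lborel. (\<lambda>k. indicator {0..} v *\<^sub>R loss (?c k *\<^sub>R s) v) \<longlonglongrightarrow> 0"
    proof (rule AE_I2)
      fix v :: real
      show "(\<lambda>k. indicator {0..} v *\<^sub>R loss (?c k *\<^sub>R s) v) \<longlonglongrightarrow> 0"
      proof (cases "0 \<le> v")
        case True
        have "(\<lambda>k. ?c k *\<^sub>R pull s v) \<longlonglongrightarrow> 0 *\<^sub>R pull s v"
          by (intro tendsto_scaleR LIMSEQ_Suc[OF lim_const_over_n] tendsto_const)
        then have "(\<lambda>k. laplace_orthant f (?c k *\<^sub>R pull s v)) \<longlonglongrightarrow> laplace_orthant f 0"
          using pull_nonneg[OF s True]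
          by (intro continuous_on_tendsto_compose[OF continuous_laplace_orthant]) auto
        moreover have "laplace_orthant f 0 = 1"
          using expectation_exp_mark[of 1 0] by (simp add: prob_space)
        ultimately have "(\<lambda>k. 1 - laplace_orthant f (?c k *\<^sub>R pull s v)) \<longlonglongrightarrow> 1 - 1"
          by (intro tendsto_diff tendsto_const) simp
        then show ?thesis using True by (simp add: loss_def pull_scaleR)
      qed simp
    qed
  qed simp
  then show ?thesis by (simp add: total_loss_def set_lebesgue_integral_def)
qed

section \<open>The almost sure limit of the time-reversed noise\<close>

text \<open>Each entry of \<open>W\<close> is bounded by the sum, so boundedness of one increasing
  sequence controls all components. Sampling at \<open>Suc k\<close> keeps the times positive, as
  measurability of \<open>W\<close> requires.\<close>

definition mass :: "nat \<Rightarrow> 'w \<Rightarrow> real" where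
  "mass k w = (\<Sum>i\<in>UNIV. W (real (Suc k)) w $ i)"

lemma mass_inner: "mass k w = (\<chi> i. 1) \<bullet> W (real (Suc k)) w"
  by (simp add: mass_def inner_vec_def)

lemma mass_measurable: "mass k \<in> borel_measurable \<Omega>"
  unfolding mass_inner[abs_def] using W_measurable[of "real (Suc k)"] by simp

lemma mass_mono: "w \<in> space \<Omega> \<Longrightarrow> pos_marks w \<Longrightarrow> incseq (\<lambda>k. mass k w)"
  unfolding mass_def by (intro incseq_SucI sum_mono W_mono) auto

text \<open>Let \<open>A\<close> be the event that the masses stay bounded. Off \<open>A\<close> the
  variables \<open>exp (- \<epsilon> * mass k)\<close> tend to 0, so the limit of their
  expectations, known from the transform of \<open>W\<close>, is at most \<open>prob A\<close>. As
  \<epsilon> tends to 0 this limit tends to 1.\<close>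

lemma AE_mass_bounded: "AE w in \<Omega>. \<exists>B::nat. \<forall>k. mass k w \<le> real B"
proof -
  note mass_measurable[measurable]
  define A where "A = {w \<in> space \<Omega>. \<exists>B::nat. \<forall>k. mass k w \<le> real B}"
  have A[measurable]: "A \<in> sets \<Omega>" unfolding A_def by measurable
  have "exp (- (rate * total_loss ((1 / real (Suc j)) *\<^sub>R (\<chi> i. 1)))) \<le> prob A" for j
  proof -
    define \<epsilon> where "\<epsilon> = 1 / real (Suc j)"
    have \<epsilon>: "0 < \<epsilon>" by (simp add: \<epsilon>_def)
    let ?s = "\<epsilon> *\<^sub>R (\<chi> i. 1) :: real^('e + 'e)"
    have s: "0 \<le> ?s $ i" for i using \<epsilon> by simp
    define G where "G w = lim (\<lambda>k. exp (- (\<epsilon> * mass k w)))" for w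
    have good: "(\<lambda>k. exp (- (\<epsilon> * mass k w))) \<longlonglongrightarrow> G w \<and> G w \<le> indicator A w \<and>
        (\<forall>k. exp (- (\<epsilon> * mass k w)) \<le> 1)"
      if w: "w \<in> space \<Omega>" "pos_marks w" for w
    proof -
      have inc: "incseq (\<lambda>k. mass k w)" by (rule mass_mono[OF w])
      have nn: "0 \<le> mass k w" for k
        unfolding mass_def using W_nonneg[OF w] by (intro sum_nonneg) auto
      have le1: "exp (- (\<epsilon> * mass k w)) \<le> 1" for k using nn[of k] \<epsilon> by simp
      have "decseq (\<lambda>k. exp (- (\<epsilon> * mass k w)))"
        using inc \<epsilon> by (auto simp: decseq_def incseq_def)
      then obtain l where l: "(\<lambda>k. exp (- (\<epsilon> * mass k w))) \<longlonglongrightarrow> l"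
        using decseq_convergent[of "\<lambda>k. exp (- (\<epsilon> * mass k w))" 0] by (metis exp_ge_zero)
      then have G: "G w = l" unfolding G_def by (rule limI)
      have "l \<le> indicator A w"
      proof (cases "w \<in> A")
        case True
        have "l \<le> 1" using l le1 by (intro LIMSEQ_le_const2[OF l]) auto
        with True show ?thesis by simp
      next
        case False
        have "filterlim (\<lambda>k. mass k w) at_top sequentially"
          unfolding filterlim_at_top
        proof
          fix z :: real
          obtain B :: nat where B: "z \<le> real B" using real_arch_simple by blast
          obtain k where "real B < mass k w" using False w(1) unfolding A_def by (auto simp: not_le)
          then have "\<forall>m\<ge>k. z \<le> mass m w" using inc B unfolding incseq_def by (meson dual_order.trans less_imp_le)
          then show "\<forall>\<^sub>F k in sequentially. z \<le> mass k w" unfolding eventually_sequentially by blast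
        qed
        then have "filterlim (\<lambda>k. \<epsilon> * mass k w) at_top sequentially"
          using \<epsilon> by (intro filterlim_tendsto_pos_mult_at_top[OF tendsto_const])
        then have "filterlim (\<lambda>k. - (\<epsilon> * mass k w)) at_bot sequentially"
          by (simp add: filterlim_uminus_at_bot)
        then have "(\<lambda>k. exp (- (\<epsilon> * mass k w))) \<longlonglongrightarrow> 0"
          by (rule filterlim_compose[OF exp_at_bot])
        then have "l = 0" using l LIMSEQ_unique by blast
        with False show ?thesis by simp
      qed
      with l G le1 show ?thesis by simp
    qed
    have Gm: "G \<in> borel_measurable \<Omega>" unfolding G_def[abs_def] by measurable
    have "(\<lambda>k. expectation (\<lambda>w. exp (- (\<epsilon> * mass k w)))) \<longlonglongrightarrow> expectation G"
    proof (rule integral_dominated_convergence[where w = "\<lambda>_. 1"])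
      show "AE w in \<Omega>. (\<lambda>k. exp (- (\<epsilon> * mass k w))) \<longlonglongrightarrow> G w"
        by (rule eventually_mono[OF AE_good]) (use good in blast)
      show "AE w in \<Omega>. norm (exp (- (\<epsilon> * mass k w))) \<le> 1" for k
        by (rule eventually_mono[OF AE_good]) (use good in simp)
    qed (use Gm in simp_all)
    moreover have "expectation (\<lambda>w. exp (- (\<epsilon> * mass k w))) = exp (- (rate * integral {0..real (Suc k)} (loss ?s)))" for k
      using expectation_exp_W[of "real (Suc k)" ?s] s by (simp add: mass_inner)
    moreover have "(\<lambda>k. exp (- (rate * integral {0..real (Suc k)} (loss ?s)))) \<longlonglongrightarrow> exp (- (rate * total_loss ?s))"
      by (intro tendsto_intros filterlim_compose[OF integral_loss_tendsto[OF s]]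
        filterlim_compose[OF filterlim_real_sequentially filterlim_Suc])
    ultimately have "exp (- (rate * total_loss ?s)) = expectation G"
      using LIMSEQ_unique by simp
    also have "\<dots> \<le> expectation (indicator A)"
    proof (rule integral_mono_AE)
      have "AE w in \<Omega>. 0 \<le> G w \<and> G w \<le> 1"
      proof (rule eventually_mono[OF AE_good])
        fix w assume "w \<in> space \<Omega> \<and> pos_marks w"
        then have g: "(\<lambda>k. exp (- (\<epsilon> * mass k w))) \<longlonglongrightarrow> G w" "G w \<le> indicator A w" using good by blast+
        have "0 \<le> G w" by (rule LIMSEQ_le_const[OF g(1)]) auto
        moreover have "indicat_real A w \<le> 1" by (simp add: indicator_def)
        ultimately show "0 \<le> G w \<and> G w \<le> 1" using g(2) by linarith
      qed
      then show "integrable \<Omega> G"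
        using Gm by (intro integrable_const_bound[where B = 1]) (auto elim: eventually_mono)
      show "AE w in \<Omega>. G w \<le> indicator A w"
        by (rule eventually_mono[OF AE_good]) (use good in blast)
    qed (simp add: emeasure_eq_measure)
    finally show ?thesis by (simp add: \<epsilon>_def)
  qed
  then have "exp (- (rate * 0)) \<le> prob A"
    by (intro LIMSEQ_le_const2[OF tendsto_exp[OF tendsto_minus[OF tendsto_mult[OF tendsto_const
      total_loss_scale_tendsto[of "\<chi> i. 1"]]]]]) auto
  then have "prob A = 1" using prob_le_1[of A] by simp
  then have "AE w in \<Omega>. w \<in> A" using A by (simp add: prob_eq_1)
  then show ?thesis by (rule eventually_mono) (simp add: A_def)
qed

text \<open>The limit is taken along integer times, which makes it measurable. Where a component
  does not converge, the value is whatever \<open>lim\<close> returns.\<close>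

definition W_lim :: "'w \<Rightarrow> real^('e + 'e)" where
  "W_lim w = (\<chi> i. lim (\<lambda>k. W (real (Suc k)) w $ i))"

lemma W_lim_measurable: "W_lim \<in> borel_measurable \<Omega>"
  unfolding W_lim_def[abs_def]
  by (intro borel_measurable_vec_lambda borel_measurable_lim_metric measurable_compose[OF W_measurable]) simp_all

text \<open>Monotonicity extends convergence along integers to real times. The upper bound is
  recorded because strict positivity of \<open>W_lim\<close> is inferred from it.\<close>

lemma AE_W_tendsto:
  "AE w in \<Omega>. ((\<lambda>t. W t w) \<longlongrightarrow> W_lim w) at_top \<and> (\<forall>t\<ge>0. \<forall>i. W t w $ i \<le> W_lim w $ i)"
  using AE_good AE_mass_bounded
proof eventually_elim
  fix w assume "w \<in> space \<Omega> \<and> pos_marks w"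
  then have w: "w \<in> space \<Omega>" "pos_marks w" by auto
  assume "\<exists>B::nat. \<forall>k. mass k w \<le> real B"
  then obtain B :: nat where B: "\<And>k. mass k w \<le> real B" by blast
  have lim: "(\<lambda>k. W (real (Suc k)) w $ i) \<longlonglongrightarrow> W_lim w $ i" for i
  proof -
    have "W (real (Suc k)) w $ i \<le> real B" for k
    proof -
      have "W (real (Suc k)) w $ i \<le> mass k w"
        unfolding mass_def using W_nonneg[OF w] by (intro member_le_sum) auto
      then show ?thesis using B[of k] by simp
    qed
    moreover have "incseq (\<lambda>k. W (real (Suc k)) w $ i)"
      by (intro incseq_SucI W_mono[OF w]) auto
    ultimately have "convergent (\<lambda>k. W (real (Suc k)) w $ i)"
      using incseq_convergent by (metis convergent_def)
    then show ?thesis unfolding W_lim_def by (simp add: convergent_LIMSEQ_iff)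
  qed
  have le: "W t w $ i \<le> W_lim w $ i" if t: "0 \<le> t" for t i
  proof (rule LIMSEQ_le_const[OF lim])
    obtain n :: nat where n: "t \<le> real n" using real_arch_simple by blast
    show "\<exists>n. \<forall>k\<ge>n. W t w $ i \<le> W (real (Suc k)) w $ i"
      using n t by (intro exI[of _ n] allI impI W_mono[OF w]) auto
  qed
  have "((\<lambda>t. W t w $ i) \<longlongrightarrow> W_lim w $ i) at_top" for i
  proof (rule order_tendstoI)
    fix x assume "x < W_lim w $ i"
    then obtain k where k: "x < W (real (Suc k)) w $ i"
      using order_tendstoD(1)[OF lim] by (meson eventually_sequentially order_refl)
    show "\<forall>\<^sub>F t in at_top. x < W t w $ i"
      using eventually_ge_at_top[of "real (Suc k)"]
    proof eventually_elim
      fix t assume "real (Suc k) \<le> t"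
      then have "W (real (Suc k)) w $ i \<le> W t w $ i" by (intro W_mono[OF w]) auto
      with k show "x < W t w $ i" by simp
    qed
  next
    fix x assume x: "W_lim w $ i < x"
    show "\<forall>\<^sub>F t in at_top. W t w $ i < x"
      using eventually_ge_at_top[of 0] by eventually_elim (use le x in \<open>meson le_less_trans\<close>)
  qed
  then show "((\<lambda>t. W t w) \<longlongrightarrow> W_lim w) at_top \<and> (\<forall>t\<ge>0. \<forall>i. W t w $ i \<le> W_lim w $ i)"
    using le by (auto intro: vec_tendstoI)
qed

lemma expectation_exp_W_lim:
  assumes s: "\<And>i. 0 \<le> s $ i"
  shows "expectation (\<lambda>w. exp (- (s \<bullet> W_lim w))) = exp (- (rate * total_loss s))"
proof -
  let ?W = "\<lambda>k. W (real (Suc k))"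
  have seq: "filterlim (\<lambda>k. real (Suc k)) at_top sequentially"
    by (rule filterlim_compose[OF filterlim_real_sequentially filterlim_Suc])
  have "(\<lambda>k. expectation (\<lambda>w. exp (- (s \<bullet> ?W k w)))) \<longlonglongrightarrow> expectation (\<lambda>w. exp (- (s \<bullet> W_lim w)))"
  proof (rule integral_dominated_convergence[where w = "\<lambda>_. 1"])
    show "(\<lambda>w. exp (- (s \<bullet> W_lim w))) \<in> borel_measurable \<Omega>"
      using W_lim_measurable by measurable
    show "(\<lambda>w. exp (- (s \<bullet> ?W k w))) \<in> borel_measurable \<Omega>" for k
      using W_measurable[of "real (Suc k)"] by simp
    show "AE w in \<Omega>. (\<lambda>k. exp (- (s \<bullet> ?W k w))) \<longlonglongrightarrow> exp (- (s \<bullet> W_lim w))"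
      using AE_W_tendsto
      by eventually_elim (intro tendsto_intros, rule filterlim_compose[OF _ seq], blast)
    show "AE w in \<Omega>. norm (exp (- (s \<bullet> ?W k w))) \<le> 1" for k
    proof (rule eventually_mono[OF AE_good])
      fix w assume "w \<in> space \<Omega> \<and> pos_marks w"
      then have "0 \<le> s \<bullet> ?W k w"
        unfolding inner_vec_def using s W_nonneg by (intro sum_nonneg) (auto intro!: mult_nonneg_nonneg)
      then show "norm (exp (- (s \<bullet> ?W k w))) \<le> 1" by simp
    qed
  qed simp
  moreover have "(\<lambda>k. expectation (\<lambda>w. exp (- (s \<bullet> ?W k w)))) \<longlonglongrightarrow> exp (- (rate * total_loss s))"
  proof -
    have "expectation (\<lambda>w. exp (- (s \<bullet> ?W k w))) = exp (- (rate * integral {0..real (Suc k)} (loss s)))" for k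
      using s by (intro expectation_exp_W) auto
    then show ?thesis
      by (simp only:) (intro tendsto_intros filterlim_compose[OF integral_loss_tendsto[OF s] seq])
  qed
  ultimately show ?thesis by (rule LIMSEQ_unique)
qed

lemma AE_some_jump: "AE w in \<Omega>. \<exists>k. 1 \<le> N (real (Suc k)) w"
proof -
  define B where "B = {w \<in> space \<Omega>. \<forall>k. N (real (Suc k)) w = 0}"
  have sets: "{w \<in> space \<Omega>. N (real (Suc k)) w = 0} \<in> sets \<Omega>" for k
    by (rule no_jump_sets) simp
  have B: "B \<in> sets \<Omega>"
  proof -
    have "B = (\<Inter>k. {w \<in> space \<Omega>. N (real (Suc k)) w = 0})" by (auto simp: B_def)
    then show ?thesis using sets by auto
  qed
  have le: "prob B \<le> exp (- (rate * real (Suc k)))" for k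
  proof -
    have "prob B \<le> prob {w \<in> space \<Omega>. N (real (Suc k)) w = 0}"
      using sets by (intro finite_measure_mono) (auto simp: B_def)
    then show ?thesis by (simp add: prob_no_jump del: of_nat_Suc)
  qed
  have "(\<lambda>k. exp (- (rate * real (Suc k)))) \<longlonglongrightarrow> 0"
    by (rule filterlim_compose[OF exp_uminus_mult_tendsto_0[OF rate_pos]
      filterlim_compose[OF filterlim_real_sequentially filterlim_Suc]])
  then have "prob B \<le> 0" by (rule LIMSEQ_le_const) (use le in blast)
  then have "prob B = 0" by (simp add: measure_le_0_iff)
  then have "AE w in \<Omega>. w \<notin> B"
    using B by (simp add: prob_eq_0)
  with AE_space show ?thesis
    by eventually_elim (auto simp: B_def Suc_le_eq simp del: of_nat_Suc)
qed

text \<open>Whether \<open>i\<close> is a streamflow or a runoff, the runoff of the same link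
  already makes a positive contribution to it.\<close>

lemma flow_embed_pos:
  assumes p: "p \<in> pos_orthant" and v: "0 < v"
  shows "0 < (flow v *v embed p) $ i"
proof -
  obtain e where e: "0 < flow v $ i $ Inr e"
    using flow_pos_streamflow[OF v] flow_pos_runoff[of v] v by (cases i) auto
  have "0 < flow v $ i $ Inr e * embed p $ Inr e"
    using e p H_pos a_pos by (auto simp: embed_def pos_orthant_def intro!: mult_pos_pos)
  also have "\<dots> \<le> (flow v *v embed p) $ i"
    unfolding matrix_vector_mult_def vec_lambda_beta
    using p v by (intro member_le_sum[of "Inr e" UNIV "\<lambda>j. flow v $ i $ j * embed p $ j"])
      (auto intro!: mult_nonneg_nonneg flow_nonneg embed_nonneg)
  finally show ?thesis .
qed

text \<open>A single jump makes every component of \<open>W\<close> strictly positive, and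
  \<open>W_lim\<close> dominates \<open>W\<close>. An invariant distribution has to charge the open
  orthant, so nonnegativity would not be enough.\<close>

lemma AE_W_lim_pos: "AE w in \<Omega>. W_lim w \<in> pos_orthant"
  using AE_good AE_some_jump AE_W_tendsto
proof eventually_elim
  fix w
  assume g: "w \<in> space \<Omega> \<and> pos_marks w" and j: "\<exists>k. 1 \<le> N (real (Suc k)) w"
    and lim: "((\<lambda>t. W t w) \<longlongrightarrow> W_lim w) at_top \<and> (\<forall>t\<ge>0. \<forall>i. W t w $ i \<le> W_lim w $ i)"
  obtain k where k: "1 \<le> N (real (Suc k)) w" using j by blast
  let ?t = "real (Suc k)"
  have T: "0 < jump_time N n w" if "n \<in> {1..N ?t w}" for n
    by (rule jump_time_in(1)[OF _ _ that]) (use g in auto)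
  have "0 < W ?t w $ i" for i
  proof -
    have "0 < (flow (jump_time N 1 w) *v embed (P 1 w)) $ i"
      using g k by (intro flow_embed_pos T) auto
    also have "\<dots> \<le> W ?t w $ i"
      unfolding W_def shot_def sum_component using g k T
      by (intro member_le_sum[of 1 "{1..N ?t w}" "\<lambda>n. (flow (jump_time N n w) *v embed (P n w)) $ i"])
        (auto intro!: flow_embed_nonneg intro: less_imp_le)
    finally show ?thesis .
  qed
  moreover have "W ?t w $ i \<le> W_lim w $ i" for i using lim by (simp del: of_nat_Suc)
  ultimately show "W_lim w \<in> pos_orthant"
    unfolding pos_orthant_def by (blast intro: less_le_trans)
qed

section \<open>The invariant distribution\<close>

abbreviation pair_solution :: "((real^('e + 'e)) \<times> 'w \<Rightarrow> real^('e + 'e)) \<Rightarrow>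
    real \<Rightarrow> (real^('e + 'e)) \<times> 'w \<Rightarrow> real^('e + 'e)" where
  "pair_solution \<equiv> river_solution trib K H a (\<lambda>t. N t \<circ> snd) (\<lambda>n. P n \<circ> snd)"

lemma jump_eq_embed: "jump H a P n w = embed (P n w)"
  by (simp add: jump_def embed_def scaled_mark_def vec_eq_iff split: sum.split)

lemma river_solution_eq:
  "river_solution trib K H a N P X0 t w = flow t *v X0 w + Z t w"
  by (simp add: river_solution_def Z_def shot_def jump_eq_embed)

lemma jump_snd: "jump H a (\<lambda>n. P n \<circ> snd) n w' = embed (P n (snd w'))"
  by (simp add: jump_def embed_def scaled_mark_def vec_eq_iff split: sum.split)

lemma river_solution_snd:
  "pair_solution X0 t w' = flow t *v X0 w' + Z t (snd w')"
proof -
  have "jump_time (\<lambda>t. N t \<circ> snd) n w' = jump_time N n (snd w')" for n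
    by (simp add: jump_time_def)
  then show ?thesis
    by (simp add: river_solution_def Z_def shot_def jump_snd)
qed

lemma driving_process_snd:
  "driving_process H a (\<lambda>t. N t \<circ> snd) (\<lambda>n. P n \<circ> snd) t w' = driving_process H a N P t (snd w')"
  by (simp add: driving_process_def jump_snd jump_eq_embed)

text \<open>
  Independence of the initial state is only assumed of the driving process, so the noise has to be
  recovered from the path of that process, as a Riemann-Stieltjes integral.
\<close>

definition path_noise :: "real \<Rightarrow> (real \<Rightarrow> real^('e + 'e)) \<Rightarrow> real^('e + 'e)" where
  "path_noise t y = lim (\<lambda>m. \<Sum>i<m. flow (t - grid t m (Suc i)) *v
     (y (grid t m (Suc i)) - y (grid t m i)))"

lemma path_noise_measurable:
  assumes "0 \<le> t"
  shows "path_noise t \<in> borel_measurable (PiM {0..} (\<lambda>_. borel))"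
proof -
  have y: "(\<lambda>y. y (grid t m i)) \<in> borel_measurable (PiM {0..} (\<lambda>_. borel :: (real^('e + 'e)) measure))" for i m
    using assms by (intro measurable_component_singleton) simp
  have mult: "(*v) A \<in> borel_measurable borel" for A :: "real^('e + 'e)^('e + 'e)"
    by (intro borel_measurable_continuous_onI continuous_intros)
  show ?thesis
    unfolding path_noise_def[abs_def]
    by (intro borel_measurable_lim_metric borel_measurable_sum measurable_compose[OF _ mult]
      borel_measurable_diff y)
qed

text \<open>Over one cell the driving process grows by the jumps that fall into it. For each mesh
  the Riemann-Stieltjes sum is therefore the noise with each jump time moved to the right end of its
  cell, and continuity of the flow gives the limit.\<close>

lemma path_noise_eq:
  assumes w: "w \<in> space \<Omega>" and t: "0 < t"
  shows "path_noise t (\<lambda>u\<in>{0..}. driving_process H a N P u w) = Z t w"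
  unfolding path_noise_def
proof (rule limI, rule Lim_transform_eventually)
  let ?T = "\<lambda>n. jump_time N n w"
  let ?p = "\<lambda>m i. grid t m i"
  show "(\<lambda>m. \<Sum>n=1..N t w. flow (t - ?p m (Suc (cell t (?T n) m))) *v embed (P n w)) \<longlonglongrightarrow> Z t w"
    unfolding Z_def shot_def
  proof (rule tendsto_sum)
    fix n assume n: "n \<in> {1..N t w}"
    show "(\<lambda>m. flow (t - ?p m (Suc (cell t (?T n) m))) *v embed (P n w)) \<longlonglongrightarrow>
        flow (t - ?T n) *v embed (P n w)"
      by (rule tendsto_cell[OF jump_time_in[OF w less_imp_le[OF t] n], where \<xi> = "\<lambda>m i. ?p m (Suc i)"
          and G = "\<lambda>v. flow (t - v) *v embed (P n w)"])
        (use t in \<open>auto intro!: divide_right_mono mult_left_mono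
          continuous_on_compose2[OF continuous_flow_vec[of UNIV]] continuous_intros\<close>)
  qed
  show "\<forall>\<^sub>F m in sequentially. (\<Sum>n=1..N t w. flow (t - ?p m (Suc (cell t (?T n) m))) *v embed (P n w)) =
      (\<Sum>i<m. flow (t - ?p m (Suc i)) *v ((\<lambda>u\<in>{0..}. driving_process H a N P u w) (?p m (Suc i)) -
        (\<lambda>u\<in>{0..}. driving_process H a N P u w) (?p m i)))"
  proof (rule eventually_sequentiallyI[of 1])
    fix m :: nat assume "1 \<le> m"
    then have m: "0 < m" by simp
    let ?in = "\<lambda>i n. N (?p m i) w < n \<and> n \<le> N (?p m (Suc i)) w"
    have incr: "(\<lambda>u\<in>{0..}. driving_process H a N P u w) (?p m (Suc i)) -
        (\<lambda>u\<in>{0..}. driving_process H a N P u w) (?p m i) =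
        (\<Sum>n=1..N t w. if ?in i n then embed (P n w) else 0)" if i: "i < m" for i
    proof -
      have "t * real (Suc i) \<le> t * real m" using i t by (intro mult_left_mono) auto
      then have le: "?p m (Suc i) \<le> t" using m by (simp add: pos_divide_le_eq)
      have p0: "0 \<le> ?p m j" for j using t by simp
      have le_p: "?p m i \<le> ?p m (Suc i)" using t by (intro divide_right_mono mult_left_mono) auto
      have N1: "N (?p m i) w \<le> N (?p m (Suc i)) w" by (rule N_mono[OF w p0 le_p])
      have N2: "N (?p m (Suc i)) w \<le> N t w" by (rule N_mono[OF w p0 le])
      have "driving_process H a N P (?p m (Suc i)) w - driving_process H a N P (?p m i) w =
          (\<Sum>n\<in>{1..N (?p m (Suc i)) w} - {1..N (?p m i) w}. embed (P n w))"
        unfolding driving_process_def jump_eq_embed using N1 by (intro sum_diff[symmetric]) auto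
      also have "{1..N (?p m (Suc i)) w} - {1..N (?p m i) w} = {1..N t w} \<inter> {n. ?in i n}"
        using N2 by auto
      also have "(\<Sum>n\<in>{1..N t w} \<inter> {n. ?in i n}. embed (P n w)) =
          (\<Sum>n=1..N t w. if ?in i n then embed (P n w) else 0)"
        by (simp add: sum.If_cases)
      finally show ?thesis using p0[of i] p0[of "Suc i"] by simp
    qed
    have "(\<Sum>i<m. flow (t - ?p m (Suc i)) *v ((\<lambda>u\<in>{0..}. driving_process H a N P u w) (?p m (Suc i)) -
        (\<lambda>u\<in>{0..}. driving_process H a N P u w) (?p m i))) =
        (\<Sum>i<m. \<Sum>n=1..N t w. flow (t - ?p m (Suc i)) *v (if ?in i n then embed (P n w) else 0))"
      by (intro sum.cong refl) (simp only: incr lessThan_iff linear_sum[OF matrix_vector_mul_linear])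
    also have "\<dots> = (\<Sum>n=1..N t w. \<Sum>i<m. flow (t - ?p m (Suc i)) *v (if ?in i n then embed (P n w) else 0))"
      by (rule sum.swap)
    also have "\<dots> = (\<Sum>n=1..N t w. flow (t - ?p m (Suc (cell t (?T n) m))) *v embed (P n w))"
    proof (rule sum.cong[OF refl])
      fix n assume n: "n \<in> {1..N t w}"
      have c: "cell t (?T n) m < m"
        by (rule cell_less[OF jump_time_in[OF w less_imp_le[OF t] n] m])
      have "(\<Sum>i<m. flow (t - ?p m (Suc i)) *v (if ?in i n then embed (P n w) else 0)) =
          (\<Sum>i<m. if i = cell t (?T n) m then flow (t - ?p m (Suc i)) *v embed (P n w) else 0)"
        unfolding cell_jump_time_iff[OF w less_imp_le[OF t] n m]
        by (intro sum.cong refl) (simp del: of_nat_Suc)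
      also have "\<dots> = flow (t - ?p m (Suc (cell t (?T n) m))) *v embed (P n w)"
        using c by (simp del: of_nat_Suc)
      finally show "(\<Sum>i<m. flow (t - ?p m (Suc i)) *v (if ?in i n then embed (P n w) else 0)) =
          flow (t - ?p m (Suc (cell t (?T n) m))) *v embed (P n w)" .
    qed
    finally show "(\<Sum>n=1..N t w. flow (t - ?p m (Suc (cell t (?T n) m))) *v embed (P n w)) =
      (\<Sum>i<m. flow (t - ?p m (Suc i)) *v ((\<lambda>u\<in>{0..}. driving_process H a N P u w) (?p m (Suc i)) -
        (\<lambda>u\<in>{0..}. driving_process H a N P u w) (?p m i)))" by simp
  qed
qed

lemma driving_path_measurable:
  "(\<lambda>w. \<lambda>t\<in>{0..}. driving_process H a N P t w) \<in> measurable \<Omega> (PiM {0..} (\<lambda>_. borel))"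
proof (rule measurable_restrict)
  fix t :: real assume "t \<in> {0..}"
  show "driving_process H a N P t \<in> borel_measurable \<Omega>"
  \<comment> \<open>\<open>shot_measurable\<close> asks for a positive time; at time 0 nothing has
    jumped.\<close>
  proof (cases "t = 0")
    case True
    have "driving_process H a N P 0 w = 0" if "w \<in> space \<Omega>" for w
      using N_0[OF that] by (simp add: driving_process_def)
    with True show ?thesis by (simp cong: measurable_cong)
  next
    case False
    have "(\<lambda>(v, p). embed p) \<in> borel_measurable (borel \<Otimes>\<^sub>M borel)"
      unfolding case_prod_unfold by (rule measurable_compose[OF measurable_snd embed_measurable])
    then have "shot (\<lambda>v. embed) t \<in> borel_measurable \<Omega>"
      using False \<open>t \<in> {0..}\<close> by (intro shot_measurable) auto
    moreover have "shot (\<lambda>v. embed) t = driving_process H a N P t"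
      by (simp add: fun_eq_iff shot_def driving_process_def jump_eq_embed)
    ultimately show ?thesis by simp
  qed
qed

text \<open>The noise is a measurable function of the driving path and hence independent of
  \<open>X0\<close>, so the transform of the solution factors. Here \<nu> need not be invariant: the
  same formula serves both existence and uniqueness.\<close>

lemma solution_law:
  assumes \<nu>: "prob_space \<nu>" "sets \<nu> = sets borel" "AE x in \<nu>. \<forall>i. 0 \<le> x $ i" and t: "0 < t"
    and X0: "distr (\<nu> \<Otimes>\<^sub>M \<Omega>) borel X0 = \<nu>"
    and ind: "indep_rv (\<nu> \<Otimes>\<^sub>M \<Omega>) borel X0 (PiM {0..} (\<lambda>_. borel))
      (\<lambda>w. \<lambda>t\<in>{0..}. driving_process H a (\<lambda>t. N t \<circ> snd) (\<lambda>n. P n \<circ> snd) t w)"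
  defines "X \<equiv> pair_solution X0 t"
  shows "X \<in> borel_measurable (\<nu> \<Otimes>\<^sub>M \<Omega>)"
    and "AE x in distr (\<nu> \<Otimes>\<^sub>M \<Omega>) borel X. \<forall>i. 0 \<le> x $ i"
    and "\<And>s. (\<And>i. 0 \<le> s $ i) \<Longrightarrow> (\<integral>x. exp (- (s \<bullet> x)) \<partial>distr (\<nu> \<Otimes>\<^sub>M \<Omega>) borel X) =
      (\<integral>x. exp (- ((transpose (flow t) *v s) \<bullet> x)) \<partial>\<nu>) * exp (- (rate * integral {0..t} (loss s)))"
proof -
  interpret \<nu>: prob_space \<nu> by fact
  interpret \<nu>\<Omega>: pair_prob_space \<nu> \<Omega> ..
  let ?M = "\<nu> \<Otimes>\<^sub>M \<Omega>"
  let ?D = "\<lambda>w. \<lambda>t\<in>{0..}. driving_process H a (\<lambda>t. N t \<circ> snd) (\<lambda>n. P n \<circ> snd) t w"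
  have X0m[measurable]: "X0 \<in> borel_measurable ?M" using ind by (simp add: indep_rv_def)
  have snd_distr: "distr ?M \<Omega> snd = \<Omega>" by (rule distr_pair_snd[OF \<nu>(1)]) unfold_locales
  note Zm[measurable] = Z_measurable[OF t]
  have Zs[measurable]: "(\<lambda>w. Z t (snd w)) \<in> borel_measurable ?M"
    by (rule measurable_compose[OF measurable_snd Zm])
  have mult: "(*v) (flow t) \<in> borel_measurable borel"
    by (intro borel_measurable_continuous_onI continuous_intros)
  have X_eq: "X = (\<lambda>w. flow t *v X0 w + Z t (snd w))"
    by (simp add: fun_eq_iff X_def river_solution_snd)
  show Xm: "X \<in> borel_measurable ?M"
    unfolding X_eq by (intro borel_measurable_add Zs measurable_compose[OF X0m mult])
  have X0_nonneg: "AE w in ?M. \<forall>i. 0 \<le> X0 w $ i"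
    using \<nu>(3) by (subst (asm) X0[symmetric]) (rule AE_distrD[OF X0m])
  have "AE w in \<Omega>. \<forall>i. 0 \<le> Z t w $ i"
    by (rule eventually_mono[OF AE_good]) (use Z_nonneg t in \<open>auto intro: less_imp_le\<close>)
  then have Z_nonneg': "AE w in ?M. \<forall>i. 0 \<le> Z t (snd w) $ i"
    by (subst (asm) snd_distr[symmetric]) (rule AE_distrD[OF measurable_snd])
  have flow_X0: "0 \<le> (flow t *v x) $ i" if "\<forall>i. 0 \<le> x $ i" for x i
    unfolding matrix_vector_mult_def using that flow_nonneg[of t] t
    by (auto intro!: sum_nonneg mult_nonneg_nonneg)
  have "AE w in ?M. \<forall>i. 0 \<le> X w $ i"
    using X0_nonneg Z_nonneg' by eventually_elim (auto simp: X_eq intro!: add_nonneg_nonneg flow_X0)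
  then show "AE x in distr ?M borel X. \<forall>i. 0 \<le> x $ i"
    by (simp add: AE_distr_iff[OF Xm])
  fix s :: "real^('e + 'e)" assume s: "\<And>i. 0 \<le> s $ i"
  \<comment> \<open>Absolute values again bound the function by 1 on the whole product space; both
    inner products are almost surely nonnegative at the points where it is evaluated.\<close>
  define F where "F x = exp (- \<bar>s \<bullet> (flow t *v fst x)\<bar>) * exp (- \<bar>s \<bullet> path_noise t (snd x)\<bar>)"
    for x :: "(real^('e + 'e)) \<times> (real \<Rightarrow> real^('e + 'e))"
  have D_eq: "path_noise t (?D w) = Z t (snd w)" if "w \<in> space ?M" for w
    using that path_noise_eq[of "snd w" t] t unfolding driving_process_snd
    by (auto simp: space_pair_measure)
  have inner_nonneg: "0 \<le> s \<bullet> x" if "\<forall>i. 0 \<le> x $ i" for x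
    unfolding inner_vec_def using s that by (intro sum_nonneg) auto
  have expX0m: "(\<lambda>x. exp (- \<bar>s \<bullet> (flow t *v x)\<bar>)) \<in> borel_measurable borel"
    by (intro borel_measurable_continuous_onI continuous_intros)
  have Dm: "?D \<in> measurable ?M (PiM {0..} (\<lambda>_. borel))" using ind by (simp add: indep_rv_def)
  have pm: "(\<lambda>y. exp (- \<bar>s \<bullet> path_noise t y\<bar>)) \<in> borel_measurable (PiM {0..} (\<lambda>_. borel))"
    by (rule measurable_compose[OF path_noise_measurable[OF less_imp_le[OF t]], of "\<lambda>z. exp (- \<bar>s \<bullet> z\<bar>)"]) simp
  have Fm: "F \<in> borel_measurable (borel \<Otimes>\<^sub>M PiM {0..} (\<lambda>_. borel))"
    unfolding F_def[abs_def]
    by (intro borel_measurable_times measurable_compose[OF measurable_fst expX0m] measurable_compose[OF measurable_snd pm])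
  have "(\<integral>x. exp (- (s \<bullet> x)) \<partial>distr ?M borel X) = (\<integral>w. exp (- (s \<bullet> X w)) \<partial>?M)"
    using Xm by (simp add: integral_distr)
  also have "\<dots> = (\<integral>w. F (X0 w, ?D w) \<partial>?M)"
  proof (rule integral_cong_AE)
    show "(\<lambda>w. exp (- (s \<bullet> X w))) \<in> borel_measurable ?M" using Xm by simp
    show "(\<lambda>w. F (X0 w, ?D w)) \<in> borel_measurable ?M"
      by (rule measurable_compose[OF measurable_Pair[OF X0m Dm] Fm])
    show "AE w in ?M. exp (- (s \<bullet> X w)) = F (X0 w, ?D w)"
      using X0_nonneg Z_nonneg' AE_space
    proof eventually_elim
      fix w assume X0: "\<forall>i. 0 \<le> X0 w $ i" and Z: "\<forall>i. 0 \<le> Z t (snd w) $ i" and w: "w \<in> space ?M"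
      have "0 \<le> s \<bullet> (flow t *v X0 w)" "0 \<le> s \<bullet> Z t (snd w)"
        using inner_nonneg flow_X0[OF X0] Z by blast+
      then show "exp (- (s \<bullet> X w)) = F (X0 w, ?D w)"
        unfolding F_def fst_conv snd_conv D_eq[OF w] X_eq inner_add_right
        by (simp add: exp_diff exp_minus field_simps flip: exp_add)
    qed
  qed
  also have "\<dots> = (\<integral>w. (\<integral>w'. F (X0 w, ?D w') \<partial>?M) \<partial>?M)"
    by (rule indep_rv_decouple[OF \<nu>\<Omega>.prob_space_axioms ind Fm, where B = 1])
      (simp add: F_def flip: exp_add)
  also have "\<dots> = (\<integral>w. exp (- \<bar>s \<bullet> (flow t *v X0 w)\<bar>) \<partial>?M) * (\<integral>w. exp (- \<bar>s \<bullet> path_noise t (?D w)\<bar>) \<partial>?M)"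
    unfolding F_def fst_conv snd_conv by simp
  also have "(\<integral>w. exp (- \<bar>s \<bullet> (flow t *v X0 w)\<bar>) \<partial>?M) = (\<integral>x. exp (- \<bar>s \<bullet> (flow t *v x)\<bar>) \<partial>\<nu>)"
    by (subst (2) X0[symmetric]) (simp add: integral_distr[OF X0m expX0m])
  also have "\<dots> = (\<integral>x. exp (- ((transpose (flow t) *v s) \<bullet> x)) \<partial>\<nu>)"
  proof (rule integral_cong_AE)
    show "(\<lambda>x. exp (- \<bar>s \<bullet> (flow t *v x)\<bar>)) \<in> borel_measurable \<nu>"
      using expX0m by (simp add: measurable_cong_sets[OF \<nu>(2) refl])
    show "(\<lambda>x. exp (- ((transpose (flow t) *v s) \<bullet> x))) \<in> borel_measurable \<nu>"
      unfolding measurable_cong_sets[OF \<nu>(2) refl] by measurable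
    show "AE x in \<nu>. exp (- \<bar>s \<bullet> (flow t *v x)\<bar>) = exp (- ((transpose (flow t) *v s) \<bullet> x))"
      using \<nu>(3)
    proof eventually_elim
      fix x :: "real^('e + 'e)" assume "\<forall>i. 0 \<le> x $ i"
      then have "0 \<le> s \<bullet> (flow t *v x)" using inner_nonneg flow_X0 by blast
      then show "exp (- \<bar>s \<bullet> (flow t *v x)\<bar>) = exp (- ((transpose (flow t) *v s) \<bullet> x))"
        by (simp add: dot_lmul_matrix[symmetric] vector_transpose_matrix)
    qed
  qed
  also have "(\<integral>w. exp (- \<bar>s \<bullet> path_noise t (?D w)\<bar>) \<partial>?M) = (\<integral>w. exp (- (s \<bullet> Z t (snd w))) \<partial>?M)"
  proof (rule integral_cong_AE)
    show "(\<lambda>w. exp (- \<bar>s \<bullet> path_noise t (?D w)\<bar>)) \<in> borel_measurable ?M"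
      by (rule measurable_compose[OF Dm pm])
    show "AE w in ?M. exp (- \<bar>s \<bullet> path_noise t (?D w)\<bar>) = exp (- (s \<bullet> Z t (snd w)))"
      using Z_nonneg' AE_space by eventually_elim (use D_eq inner_nonneg in simp)
  qed simp
  also have "\<dots> = (\<integral>w. exp (- (s \<bullet> Z t w)) \<partial>distr ?M \<Omega> snd)"
    by (rule integral_distr[symmetric]) simp_all
  also have "\<dots> = expectation (\<lambda>w. exp (- (s \<bullet> Z t w)))"
    by (simp only: snd_distr)
  also have "\<dots> = exp (- (rate * integral {0..t} (loss s)))"
    using t s by (intro expectation_exp_Z) auto
  finally show "(\<integral>x. exp (- (s \<bullet> x)) \<partial>distr ?M borel X) =
      (\<integral>x. exp (- ((transpose (flow t) *v s) \<bullet> x)) \<partial>\<nu>) * exp (- (rate * integral {0..t} (loss s)))" .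
qed

text \<open>The losses after time \<open>t\<close> are, by \<open>pull_add\<close>, the losses from
  time 0 on for the argument \<open>transpose (flow t) *v s\<close>. Compared with the factorisation
  in \<open>solution_law\<close>, this is the invariance of the limit law.\<close>

lemma total_loss_split:
  assumes s: "\<And>i. 0 \<le> s $ i" and t: "0 \<le> t"
  shows "total_loss s = integral {0..t} (loss s) + total_loss (transpose (flow t) *v s)"
proof -
  let ?s = "transpose (flow t) *v s"
  have s': "0 \<le> ?s $ i" for i by (rule transpose_flow_nonneg[OF s t])
  have eq: "integral {0..t + b} (loss s) = integral {0..t} (loss s) + integral {0..b} (loss ?s)" if b: "0 \<le> b" for b
  proof -
    have "loss s integrable_on {0..t + b}"
      by (intro integrable_continuous_real continuous_on_subset[OF continuous_loss[OF s]]) auto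
    then have "integral {0..t + b} (loss s) = integral {0..t} (loss s) + integral {t..t + b} (loss s)"
      using Henstock_Kurzweil_Integration.integral_combine[of 0 t "t + b" "loss s"] t b by simp
    moreover have "integral {0..b} (loss s \<circ> (+) t) = integral {t..t + b} (loss s)"
      using integral_shift_Icc_real[of 0 b "loss s" t] by (simp add: add.commute)
    moreover have "loss s \<circ> (+) t = loss ?s"
      by (simp add: fun_eq_iff loss_def pull_add)
    ultimately show ?thesis by simp
  qed
  have "filterlim (\<lambda>b. t + b) at_top at_top"
    by (rule filterlim_tendsto_add_at_top[OF tendsto_const filterlim_ident])
  then have "((\<lambda>b. integral {0..t + b} (loss s)) \<longlongrightarrow> total_loss s) at_top"
    by (rule filterlim_compose[OF integral_loss_tendsto[OF s]])
  moreover have "((\<lambda>b. integral {0..t + b} (loss s)) \<longlongrightarrow> integral {0..t} (loss s) + total_loss ?s) at_top"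
  proof (rule Lim_transform_eventually)
    show "((\<lambda>b. integral {0..t} (loss s) + integral {0..b} (loss ?s)) \<longlongrightarrow> integral {0..t} (loss s) + total_loss ?s) at_top"
      by (intro tendsto_intros integral_loss_tendsto s')
    show "\<forall>\<^sub>F b in at_top. integral {0..t} (loss s) + integral {0..b} (loss ?s) = integral {0..t + b} (loss s)"
      using eventually_ge_at_top[of 0] by eventually_elim (simp only: eq)
  qed
  ultimately show ?thesis
    by (rule tendsto_unique[OF trivial_limit_at_top_linorder])
qed

definition law :: "(real^('e + 'e)) measure" where
  "law = distr \<Omega> borel W_lim"

lemma prob_space_law: "prob_space law"
  unfolding law_def by (rule prob_space_distr[OF W_lim_measurable])

lemma sets_law: "sets law = sets borel"
  by (simp add: law_def)

lemma law_pos: "AE x in law. x \<in> pos_orthant"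
proof -
  have "{x :: real^('e + 'e). x \<in> pos_orthant} \<in> sets borel" by (simp add: pos_orthant_def)
  then show ?thesis
    unfolding law_def using AE_W_lim_pos W_lim_measurable by (simp add: AE_distr_iff)
qed

lemma pos_orthant_nonneg: "AE x in \<nu>. x \<in> pos_orthant \<Longrightarrow> AE x in \<nu>. \<forall>i. 0 \<le> x $ i"
  by (erule eventually_mono) (auto simp: pos_orthant_def intro: less_imp_le)

lemma laplace_law:
  "(\<And>i. 0 \<le> s $ i) \<Longrightarrow> (\<integral>x. exp (- (s \<bullet> x)) \<partial>law) = exp (- (rate * total_loss s))"
  unfolding law_def using W_lim_measurable by (simp add: integral_distr expectation_exp_W_lim)

theorem invariant_law: "invariant_distribution trib K H a \<Omega> N P law"
  unfolding invariant_distribution_def Let_def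
proof (intro conjI allI impI prob_space_law sets_law law_pos)
  fix X0 :: "(real^('e + 'e)) \<times> 'w \<Rightarrow> real^('e + 'e)" and t :: real
  assume *: "distr (law \<Otimes>\<^sub>M \<Omega>) borel X0 = law \<and> indep_rv (law \<Otimes>\<^sub>M \<Omega>) borel X0 (PiM {0..} (\<lambda>_. borel))
    (\<lambda>w. \<lambda>t\<in>{0..}. driving_process H a (\<lambda>t. N t \<circ> snd) (\<lambda>n. P n \<circ> snd) t w)" and t: "0 < t"
  note sol = solution_law[OF prob_space_law sets_law pos_orthant_nonneg[OF law_pos] t
    conjunct1[OF *] conjunct2[OF *]]
  interpret law: prob_space law by (rule prob_space_law)
  interpret lo: pair_prob_space law \<Omega> ..
  show "pair_solution X0 t \<in> borel_measurable (law \<Otimes>\<^sub>M \<Omega>)"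
    by (rule sol(1))
  show "distr (law \<Otimes>\<^sub>M \<Omega>) borel (pair_solution X0 t) = law"
  proof (rule laplace_transform_unique[OF lo.prob_space_distr[OF sol(1)] _ sol(2) prob_space_law sets_law
      pos_orthant_nonneg[OF law_pos]])
    fix s :: "real^('e + 'e)" assume s: "\<And>i. 0 \<le> s $ i"
    have s': "0 \<le> (transpose (flow t) *v s) $ i" for i
      by (rule transpose_flow_nonneg[OF s less_imp_le[OF t]])
    show "(\<integral>x. exp (- (s \<bullet> x)) \<partial>distr (law \<Otimes>\<^sub>M \<Omega>) borel
        (pair_solution X0 t)) = (\<integral>x. exp (- (s \<bullet> x)) \<partial>law)"
      unfolding sol(3)[OF s] laplace_law[OF s] laplace_law[OF s'] total_loss_split[OF s less_imp_le[OF t]]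
      by (simp add: algebra_simps flip: exp_add)
  qed simp
qed

text \<open>The first projection has law \<nu> and is independent of the driving process, so the
  condition of invariance may be applied to it.\<close>

lemma invariant_step:
  assumes inv: "invariant_distribution trib K H a \<Omega> N P \<nu>" and t: "0 < t"
  shows "pair_solution fst t \<in> borel_measurable (\<nu> \<Otimes>\<^sub>M \<Omega>)"
    and "distr (\<nu> \<Otimes>\<^sub>M \<Omega>) borel (pair_solution fst t) = \<nu>"
    and "\<And>s. (\<And>i. 0 \<le> s $ i) \<Longrightarrow> (\<integral>x. exp (- (s \<bullet> x)) \<partial>\<nu>) =
      (\<integral>x. exp (- ((transpose (flow t) *v s) \<bullet> x)) \<partial>\<nu>) * exp (- (rate * integral {0..t} (loss s)))"
proof -
  have \<nu>: "prob_space \<nu>" "sets \<nu> = sets borel" "AE x in \<nu>. x \<in> pos_orthant"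
    using inv by (simp_all add: invariant_distribution_def)
  interpret \<nu>: prob_space \<nu> by fact
  have fst: "distr (\<nu> \<Otimes>\<^sub>M \<Omega>) borel fst = \<nu>"
    using distr_pair_fst[of \<nu>] distr_cong[OF refl \<nu>(2), of "\<nu> \<Otimes>\<^sub>M \<Omega>" fst fst]
    by simp
  have ind: "indep_rv (\<nu> \<Otimes>\<^sub>M \<Omega>) borel fst (PiM {0..} (\<lambda>_. borel))
      (\<lambda>w. \<lambda>t\<in>{0..}. driving_process H a (\<lambda>t. N t \<circ> snd) (\<lambda>n. P n \<circ> snd) t w)"
    unfolding driving_process_snd
    by (rule indep_rv_fst_snd[OF \<nu>(1) prob_space_axioms \<nu>(2)[symmetric] driving_path_measurable])
  show "pair_solution fst t \<in> borel_measurable (\<nu> \<Otimes>\<^sub>M \<Omega>)"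
    and d: "distr (\<nu> \<Otimes>\<^sub>M \<Omega>) borel (pair_solution fst t) = \<nu>"
    using inv fst ind t unfolding invariant_distribution_def Let_def by blast+
  show "(\<integral>x. exp (- (s \<bullet> x)) \<partial>\<nu>) =
      (\<integral>x. exp (- ((transpose (flow t) *v s) \<bullet> x)) \<partial>\<nu>) * exp (- (rate * integral {0..t} (loss s)))"
    if "\<And>i. 0 \<le> s $ i" for s
    using solution_law(3)[OF \<nu>(1,2) pos_orthant_nonneg[OF \<nu>(3)] t fst ind that] unfolding d .
qed

lemma flow_tendsto_0: "((\<lambda>t. flow t $ i $ j) \<longlongrightarrow> 0) at_top"
proof -
  obtain C where C: "1 \<le> C" "\<And>v i j. 0 \<le> v \<Longrightarrow> flow v $ i $ j \<le> C * exp (- (decay * v))"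
    using flow_decay by blast
  have "((\<lambda>v. C * exp (- (decay * v))) \<longlongrightarrow> C * 0) at_top"
    by (intro tendsto_intros exp_uminus_mult_tendsto_0 decay_pos)
  then have "((\<lambda>v. C * exp (- (decay * v))) \<longlongrightarrow> 0) at_top" by simp
  moreover have "\<forall>\<^sub>F v in at_top. norm (flow v $ i $ j) \<le> C * exp (- (decay * v))"
    using eventually_ge_at_top[of 0] by eventually_elim (simp add: C(2) flow_nonneg)
  ultimately show ?thesis by (rule Lim_null_comparison[rotated])
qed

lemma transpose_flow_tendsto_0: "((\<lambda>t. transpose (flow t) *v s) \<longlongrightarrow> 0) at_top"
proof (rule vec_tendstoI)
  fix i
  have "((\<lambda>t. \<Sum>j\<in>UNIV. flow t $ j $ i * s $ j) \<longlongrightarrow> (\<Sum>j\<in>UNIV. 0 * s $ j)) at_top"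
    by (intro tendsto_intros flow_tendsto_0)
  then show "((\<lambda>t. (transpose (flow t) *v s) $ i) \<longlongrightarrow> 0 $ i) at_top"
    unfolding matrix_vector_mult_def transpose_def by simp
qed

text \<open>For every \<open>t\<close> the transform of \<nu> at \<open>s\<close> is its transform
  at \<open>transpose (flow t) *v s\<close> times a factor that does not involve \<nu>. As
  \<open>t\<close> grows the argument tends to 0 and the first transform to 1, which leaves a value
  independent of \<nu>.\<close>

theorem invariant_unique:
  assumes inv: "invariant_distribution trib K H a \<Omega> N P \<nu>"
  shows "\<nu> = law"
proof -
  have \<nu>: "prob_space \<nu>" "sets \<nu> = sets borel" "AE x in \<nu>. x \<in> pos_orthant"
    using inv by (simp_all add: invariant_distribution_def)
  interpret \<nu>: prob_space \<nu> by fact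
  show ?thesis
  proof (rule laplace_transform_unique[OF \<nu>(1,2) pos_orthant_nonneg[OF \<nu>(3)] prob_space_law sets_law
      pos_orthant_nonneg[OF law_pos]])
    fix s :: "real^('e + 'e)" assume s: "\<And>i. 0 \<le> s $ i"
    let ?s = "\<lambda>k. transpose (flow (real (Suc k))) *v s"
    have seq: "filterlim (\<lambda>k. real (Suc k)) at_top sequentially"
      by (rule filterlim_compose[OF filterlim_real_sequentially filterlim_Suc])
    have "(\<lambda>k. \<integral>x. exp (- (?s k \<bullet> x)) \<partial>\<nu>) \<longlonglongrightarrow> (\<integral>x. exp (- (0 \<bullet> x)) \<partial>\<nu>)"
    proof (rule integral_dominated_convergence[where w = "\<lambda>_. 1"])
      show "(\<lambda>x. exp (- (0 \<bullet> x))) \<in> borel_measurable \<nu>" by simp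
      show "(\<lambda>x. exp (- (?s k \<bullet> x))) \<in> borel_measurable \<nu>" for k
        unfolding measurable_cong_sets[OF \<nu>(2) refl] by measurable
      show "AE x in \<nu>. (\<lambda>k. exp (- (?s k \<bullet> x))) \<longlonglongrightarrow> exp (- (0 \<bullet> x))"
        by (intro AE_I2 tendsto_intros filterlim_compose[OF transpose_flow_tendsto_0 seq])
      show "AE x in \<nu>. norm (exp (- (?s k \<bullet> x))) \<le> 1" for k
        using pos_orthant_nonneg[OF \<nu>(3)]
      proof eventually_elim
        fix x :: "real^('e + 'e)" assume "\<forall>i. 0 \<le> x $ i"
        then have "0 \<le> ?s k \<bullet> x"
          unfolding inner_vec_def using transpose_flow_nonneg[OF s, of "real (Suc k)"] by (intro sum_nonneg) auto
        then show "norm (exp (- (?s k \<bullet> x))) \<le> 1" by simp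
      qed
    qed simp
    then have "(\<lambda>k. (\<integral>x. exp (- (?s k \<bullet> x)) \<partial>\<nu>) * exp (- (rate * integral {0..real (Suc k)} (loss s))))
        \<longlonglongrightarrow> 1 * exp (- (rate * total_loss s))"
      by (intro tendsto_intros filterlim_compose[OF integral_loss_tendsto[OF s] seq]) (simp add: \<nu>.prob_space)
    moreover have "(\<integral>x. exp (- (?s k \<bullet> x)) \<partial>\<nu>) * exp (- (rate * integral {0..real (Suc k)} (loss s))) =
        (\<integral>x. exp (- (s \<bullet> x)) \<partial>\<nu>)" for k
      using invariant_step(3)[OF inv, of "real (Suc k)" s] s by simp
    ultimately have "(\<lambda>k. \<integral>x. exp (- (s \<bullet> x)) \<partial>\<nu>) \<longlonglongrightarrow> exp (- (rate * total_loss s))" by simp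
    then show "(\<integral>x. exp (- (s \<bullet> x)) \<partial>\<nu>) = (\<integral>x. exp (- (s \<bullet> x)) \<partial>law)"
      by (simp add: LIMSEQ_const_iff laplace_law[OF s])
  qed
qed

section \<open>The density of the streamflow\<close>

lemma pull_axis: "pull (axis (Inl e) c) v = c *\<^sub>R (\<chi> e'. H e' * a e' * flow v $ Inl e $ Inr e')"
  by (simp add: pull_def vec_eq_iff matrix_vector_mult_def transpose_def axis_def
      if_distrib[where f = "\<lambda>x. _ * x"] cong: if_cong)

text \<open>The shift \<open>y\<close> stands for the contribution of the initial state. The passage
  from \<open>Z\<close> to \<open>W\<close> matters: in \<open>W\<close> a jump at any time
  \<open>v > 0\<close> has a nonzero weight in the streamflow, whereas in \<open>Z\<close> the
  weight vanishes for a jump at time \<open>t\<close> itself.\<close>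

lemma emeasure_streamflow_noise_le:
  assumes t: "0 < t" and B: "B \<in> sets borel" "emeasure lborel B = 0"
  shows "emeasure \<Omega> {w \<in> space \<Omega>. y + Z t w $ Inl e \<in> B} \<le> ennreal (exp (- (rate * t)))"
proof -
  let ?B = "(\<lambda>q. y + q) -` B"
  have B'm: "?B \<in> sets borel"
    using measurable_sets[of "\<lambda>q. y + q" borel borel B] B by simp
  have "emeasure lborel ?B = emeasure (distr lborel borel ((+) y)) B"
    using B by (subst emeasure_distr) simp_all
  then have B'0: "emeasure lborel ?B = 0" using B by (simp add: lborel_distr_plus)
  define S where "S = {z :: real^('e + 'e). y + z $ Inl e \<in> B}"
  have S: "S \<in> sets borel"
    unfolding S_def using measurable_sets[OF _ B(1), of "\<lambda>z :: real^('e + 'e). y + z $ Inl e" borel]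
    by (simp add: vimage_def)
  have "emeasure \<Omega> {w \<in> space \<Omega>. y + Z t w $ Inl e \<in> B} = emeasure (distr \<Omega> borel (Z t)) S"
    using S Z_measurable[OF t] by (subst emeasure_distr) (auto simp: S_def intro!: arg_cong[where f = "emeasure \<Omega>"])
  also have "\<dots> = emeasure (distr \<Omega> borel (W t)) S" by (simp only: distr_Z_eq_W[OF t])
  also have "\<dots> = emeasure \<Omega> {w \<in> space \<Omega>. W t w $ Inl e \<in> ?B}"
    using S W_measurable[OF t] by (subst emeasure_distr) (auto simp: S_def intro!: arg_cong[where f = "emeasure \<Omega>"])
  also have "\<dots> \<le> emeasure \<Omega> {w \<in> space \<Omega>. N t w = 0}"
  proof (rule emeasure_mono_AE)
    show "{w \<in> space \<Omega>. N t w = 0} \<in> sets \<Omega>"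
      using t by (intro no_jump_sets) simp
    let ?c = "pull (axis (Inl e) 1)"
    have "?c v \<noteq> 0" if "0 < v" for v
    proof -
      have "0 < ?c v $ e"
        using flow_pos_streamflow[OF that] H_pos a_pos by (simp add: pull_axis)
      then show ?thesis by auto
    qed
    then have "AE w in \<Omega>. 1 \<le> N t w \<longrightarrow> shot (\<lambda>v p. ?c v \<bullet> p) t w \<notin> ?B"
      by (intro prob_shot_null t continuous_pull B'm B'0)
    moreover have "shot (\<lambda>v p. ?c v \<bullet> p) t w = W t w $ Inl e" for w
      using inner_shot[of "axis (Inl e) 1" "\<lambda>v p. flow v *v embed p" t w]
      by (simp add: W_def inner_flow_embed inner_axis')
    ultimately show "AE w in \<Omega>. w \<in> {w \<in> space \<Omega>. W t w $ Inl e \<in> ?B} \<longrightarrow> w \<in> {w \<in> space \<Omega>. N t w = 0}"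
      by (auto elim!: eventually_mono)
  qed
  also have "\<dots> = ennreal (exp (- (rate * t)))"
    by (simp add: emeasure_eq_measure prob_no_jump[OF t])
  finally show ?thesis .
qed

text \<open>
  Started from its invariant law, the streamflow at time \<open>t\<close> can only charge a null set if no jump
  has occurred before \<open>t\<close>, an event of arbitrarily small probability.
\<close>

lemma law_streamflow_null:
  assumes B: "B \<in> sets borel" "emeasure lborel B = 0"
  shows "emeasure law {x \<in> space law. x $ Inl e \<in> B} = 0"
proof -
  interpret law: prob_space law by (rule prob_space_law)
  interpret lo: pair_prob_space law \<Omega> ..
  define S where "S = {x :: real^('e + 'e). x $ Inl e \<in> B}"
  have S: "S \<in> sets borel"
    unfolding S_def using measurable_sets[OF _ B(1), of "\<lambda>z :: real^('e + 'e). z $ Inl e" borel]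
    by (simp add: vimage_def)
  have le: "emeasure law S \<le> ennreal (exp (- (rate * t)))" if t: "0 < t" for t
  proof -
    let ?X = "pair_solution fst t"
    note X = invariant_step[OF invariant_law t]
    let ?S = "?X -` S \<inter> space (law \<Otimes>\<^sub>M \<Omega>)"
    have S': "?S \<in> sets (law \<Otimes>\<^sub>M \<Omega>)" using X(1) S by (rule measurable_sets)
    have "emeasure law S = emeasure (law \<Otimes>\<^sub>M \<Omega>) ?S"
      by (subst X(2)[symmetric]) (rule emeasure_distr[OF X(1) S])
    \<comment> \<open>Sectioning at the initial state \<open>x\<close> leaves the noise alone as
      random; \<open>x\<close> merely translates \<open>B\<close>, and the bound is uniform in
      \<open>x\<close>.\<close>
    also have "\<dots> = (\<integral>\<^sup>+x. emeasure \<Omega> (Pair x -` ?S) \<partial>law)"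
      by (rule emeasure_pair_measure_alt[OF S'])
    also have "\<dots> \<le> (\<integral>\<^sup>+x. ennreal (exp (- (rate * t))) \<partial>law)"
    proof (rule nn_integral_mono)
      fix x assume x: "x \<in> space law"
      have "Pair x -` ?S = {w \<in> space \<Omega>. (flow t *v x) $ Inl e + Z t w $ Inl e \<in> B}"
        using x by (auto simp: S_def river_solution_snd space_pair_measure)
      then show "emeasure \<Omega> (Pair x -` ?S) \<le> ennreal (exp (- (rate * t)))"
        using emeasure_streamflow_noise_le[OF t B] by simp
    qed
    also have "\<dots> = ennreal (exp (- (rate * t)))" by (simp add: law.emeasure_space_1)
    finally show ?thesis .
  qed
  have "((\<lambda>t. exp (- (rate * t))) \<longlongrightarrow> 0) at_top" by (rule exp_uminus_mult_tendsto_0[OF rate_pos])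
  then have "((\<lambda>t. ennreal (exp (- (rate * t)))) \<longlongrightarrow> ennreal 0) at_top" by (rule tendsto_ennrealI)
  then have "emeasure law S \<le> ennreal 0"
    by (rule tendsto_lowerbound) (use le in \<open>auto intro!: eventually_mono[OF eventually_gt_at_top[of 0]]\<close>)
  then have "emeasure law S = 0" by simp
  moreover have "space law = UNIV" using sets_eq_imp_space_eq[OF sets_law] by simp
  ultimately show ?thesis by (simp add: S_def)
qed

lemma streamflow_density:
  obtains g where "density_on {0<..} g" "distributed law lborel (\<lambda>x. x $ Inl e) (\<lambda>q. ennreal (g q))"
proof -
  let ?Q = "\<lambda>x :: real^('e + 'e). x $ Inl e"
  interpret law: prob_space law by (rule prob_space_law)
  have Q: "?Q \<in> measurable law lborel"
    by (simp add: measurable_cong_sets[OF sets_law refl])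
  let ?D = "distr law lborel ?Q"
  interpret D: prob_space ?D by (rule law.prob_space_distr[OF Q])
  have "absolutely_continuous lborel ?D"
    unfolding absolutely_continuous_def
  proof
    fix B :: "real set" assume "B \<in> null_sets lborel"
    then have B: "B \<in> sets borel" "emeasure lborel B = 0" by auto
    have "?Q -` B \<inter> space law = {x \<in> space law. ?Q x \<in> B}" by auto
    then have "emeasure ?D B = 0"
      using B law_streamflow_null[OF B, of e] Q by (subst emeasure_distr) auto
    then show "B \<in> null_sets ?D" using B by auto
  qed
  from sigma_finite_measure.real_RN_deriv[OF sigma_finite_lborel D.finite_measure_axioms this sets_distr]
  obtain h where h: "h \<in> borel_measurable borel" "AE q in lborel. RN_deriv lborel ?D q = ennreal (h q)"
    "\<And>q. 0 \<le> h q" by auto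
  have "density lborel (RN_deriv lborel ?D) = ?D"
    by (rule sigma_finite_measure.density_RN_deriv[OF sigma_finite_lborel \<open>absolutely_continuous lborel ?D\<close> sets_distr])
  then have D_eq: "?D = density lborel (\<lambda>q. ennreal (h q))"
    using h(1,2) by (subst (asm) density_cong[OF _ _ h(2)]) auto
  \<comment> \<open>\<open>density_on\<close> requires the density to vanish outside
    \<open>{0<..}\<close> at every point. As the law charges only positive streamflows, cutting off
    changes \<open>h\<close> on a null set only.\<close>
  define g where "g q = indicator {0<..} q * h q" for q
  have gm: "g \<in> borel_measurable borel" unfolding g_def[abs_def] using h(1) by measurable
  have "AE q in ?D. 0 < q"
    using law_pos by (subst AE_distr_iff[OF Q]) (auto simp: pos_orthant_def elim: eventually_mono)
  then have "AE q in lborel. 0 < ennreal (h q) \<longrightarrow> 0 < q"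
    unfolding D_eq using h(1) by (subst (asm) AE_density) auto
  then have "AE q in lborel. ennreal (h q) = ennreal (g q)"
    by (rule eventually_mono) (use h(3) in \<open>force simp: g_def indicator_def less_le\<close>)
  then have D_g: "?D = density lborel (\<lambda>q. ennreal (g q))"
    unfolding D_eq using h(1) gm by (intro density_cong) auto
  have "distributed law lborel ?Q (\<lambda>q. ennreal (g q))"
    unfolding distributed_def using D_g Q gm by simp
  moreover have "density_on {0<..} g"
  proof -
    have "(\<integral>\<^sup>+q. ennreal (g q) \<partial>lborel) = emeasure (density lborel (\<lambda>q. ennreal (g q))) UNIV"
      using gm by (simp add: emeasure_density)
    also have "\<dots> = 1" unfolding D_g[symmetric] using D.emeasure_space_1 by simp
    finally show ?thesis
      unfolding density_on_def using gm h(3) by (auto simp: g_def)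
  qed
  ultimately show ?thesis using that by blast
qed

lemma laplace_half_line_streamflow:
  assumes g: "density_on {0<..} g" "distributed law lborel (\<lambda>x. x $ Inl e) (\<lambda>q. ennreal (g q))" and s: "0 \<le> s"
  shows "laplace_half_line g s = exp (- (rate * total_loss (axis (Inl e) s)))"
proof -
  have "laplace_half_line g s = (\<integral>q. g q * exp (- s * q) \<partial>lborel)"
    unfolding laplace_half_line_def set_lebesgue_integral_def
    using g(1) by (intro Bochner_Integration.integral_cong) (auto simp: density_on_def indicator_def)
  also have "\<dots> = (\<integral>x. exp (- s * x $ Inl e) \<partial>law)"
    using g(1) by (intro distributed_integral[OF g(2)]) (simp_all add: density_on_def)
  also have "\<dots> = (\<integral>x. exp (- (axis (Inl e) s \<bullet> x)) \<partial>law)"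
    by (simp add: inner_axis')
  also have "\<dots> = exp (- (rate * total_loss (axis (Inl e) s)))"
    using s by (intro laplace_law) (simp add: axis_def)
  finally show ?thesis .
qed

section \<open>Weak convergence to the invariant density\<close>

lemma expectation_Z_eq_W:
  fixes h :: "real^('e + 'e) \<Rightarrow> real"
  assumes "0 < t" "h \<in> borel_measurable borel"
  shows "expectation (\<lambda>w. h (Z t w)) = expectation (\<lambda>w. h (W t w))"
  using integral_distr[OF Z_measurable[OF assms(1)] assms(2)] integral_distr[OF W_measurable[OF assms(1)] assms(2)]
  by (simp only: distr_Z_eq_W[OF assms(1)])

text \<open>At each positive time the solution has the law of its deterministic part plus
  \<open>W\<close>. The former tends to 0 and the latter converges almost surely, so integrals of
  bounded continuous functions converge by domination.\<close>

lemma weak_convergence_streamflow: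
  assumes \<tau>: "filterlim \<tau> at_top sequentially"
  shows "weak_conv_m
    (\<lambda>n. distr \<Omega> borel (\<lambda>w. river_solution trib K H a N P (\<lambda>_. x) (\<tau> n) w $ Inl e))
    (distr \<Omega> borel (\<lambda>w. W_lim w $ Inl e))"
proof -
  let ?M = "distr \<Omega> borel (\<lambda>w. W_lim w $ Inl e)"
  let ?X = "\<lambda>n w. river_solution trib K H a N P (\<lambda>_. x) (\<tau> n) w $ Inl e"
  let ?y = "\<lambda>n. (flow (\<tau> n) *v x) $ Inl e"
  \<comment> \<open>Finitely many \<open>\<tau> n\<close> may fail to be positive. There the limit
    law is substituted, so that every member of the sequence is a probability distribution; the
    limit is unaffected.\<close>
  define M' where "M' n = (if 0 < \<tau> n then distr \<Omega> borel (?X n) else ?M)" for n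
  have lim_m: "(\<lambda>w. W_lim w $ Inl e) \<in> borel_measurable \<Omega>"
    by (rule measurable_compose[OF W_lim_measurable]) simp
  have X_m: "?X n \<in> borel_measurable \<Omega>" if "0 < \<tau> n" for n
    unfolding river_solution_eq vector_add_component
    by (intro borel_measurable_add borel_measurable_const measurable_compose[OF Z_measurable[OF that]]) simp
  have M: "real_distribution ?M"
    by (rule real_distribution_distr[OF lim_m])
  have M': "real_distribution (M' n)" for n
    using M X_m[of n] by (auto simp: M'_def intro!: real_distribution_distr)
  have pos: "\<forall>\<^sub>F n in sequentially. 0 < \<tau> n"
    using \<tau> by (simp add: filterlim_at_top_dense)
  have "weak_conv_m M' ?M"
  proof (rule integral_bdd_continuous_conv_imp_weak_conv[OF M' M])
    fix h :: "real \<Rightarrow> real"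
    assume h: "\<And>x. isCont h x" "\<And>x. \<bar>h x\<bar> \<le> 1"
    have hm: "h \<in> borel_measurable borel"
      using h(1) by (intro borel_measurable_continuous_onI continuous_at_imp_continuous_on) auto
    let ?h = "\<lambda>n w. if 0 < \<tau> n then h (?y n + W (\<tau> n) w $ Inl e) else h (W_lim w $ Inl e)"
    have int: "integral\<^sup>L (M' n) h = expectation (?h n)" for n
    proof (cases "0 < \<tau> n")
      case True
      have "(\<lambda>z :: real^('e + 'e). h (?y n + z $ Inl e)) \<in> borel_measurable borel"
        by (rule measurable_compose[OF _ hm]) simp
      then have "expectation (\<lambda>w. h (?y n + Z (\<tau> n) w $ Inl e)) = expectation (\<lambda>w. h (?y n + W (\<tau> n) w $ Inl e))"
        by (rule expectation_Z_eq_W[OF True])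
      then show ?thesis
        using True integral_distr[OF X_m[OF True] hm] by (simp add: M'_def river_solution_eq)
    next
      case False
      then show ?thesis using integral_distr[OF lim_m hm] by (simp add: M'_def)
    qed
    have "(\<lambda>n. expectation (?h n)) \<longlonglongrightarrow> expectation (\<lambda>w. h (W_lim w $ Inl e))"
    proof (rule integral_dominated_convergence[where w = "\<lambda>_. 1"])
      show "(\<lambda>w. h (W_lim w $ Inl e)) \<in> borel_measurable \<Omega>"
        by (rule measurable_compose[OF lim_m hm])
      show "?h n \<in> borel_measurable \<Omega>" for n
      proof (cases "0 < \<tau> n")
        case True
        have "(\<lambda>z :: real^('e + 'e). h (?y n + z $ Inl e)) \<in> borel_measurable borel"
          by (rule measurable_compose[OF _ hm]) simp
        from measurable_compose[OF W_measurable[OF True] this] True show ?thesis by simp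
      next
        case False
        then show ?thesis using measurable_compose[OF lim_m hm] by simp
      qed
      show "AE w in \<Omega>. norm (?h n w) \<le> 1" for n using h(2) by (intro AE_I2) simp
      show "AE w in \<Omega>. (\<lambda>n. ?h n w) \<longlonglongrightarrow> h (W_lim w $ Inl e)"
        using AE_W_tendsto
      proof eventually_elim
        fix w assume "((\<lambda>t. W t w) \<longlongrightarrow> W_lim w) at_top \<and> (\<forall>t\<ge>0. \<forall>i. W t w $ i \<le> W_lim w $ i)"
        then have "(\<lambda>n. W (\<tau> n) w $ Inl e) \<longlonglongrightarrow> W_lim w $ Inl e"
          by (intro tendsto_vec_nth filterlim_compose[OF _ \<tau>]) auto
        moreover have "?y \<longlonglongrightarrow> (\<Sum>j\<in>UNIV. 0 * x $ j)"
          unfolding matrix_vector_mult_def vec_lambda_beta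
          by (intro tendsto_intros filterlim_compose[OF flow_tendsto_0 \<tau>])
        ultimately have "(\<lambda>n. ?y n + W (\<tau> n) w $ Inl e) \<longlonglongrightarrow> 0 + W_lim w $ Inl e"
          by (intro tendsto_add) simp_all
        then have "(\<lambda>n. h (?y n + W (\<tau> n) w $ Inl e)) \<longlonglongrightarrow> h (W_lim w $ Inl e)"
          using isCont_tendsto_compose[OF h(1)] by simp
        then show "(\<lambda>n. ?h n w) \<longlonglongrightarrow> h (W_lim w $ Inl e)"
          by (rule Lim_transform_eventually) (use pos in eventually_elim, simp)
      qed
    qed simp
    then show "(\<lambda>n. integral\<^sup>L (M' n) h) \<longlonglongrightarrow> integral\<^sup>L ?M h"
      using integral_distr[OF lim_m hm] by (simp add: int)
  qed
  then show ?thesis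
    unfolding weak_conv_m_def weak_conv_def
  proof (intro allI impI)
    fix q assume *: "\<forall>q. isCont (cdf ?M) q \<longrightarrow> (\<lambda>n. cdf (M' n) q) \<longlonglongrightarrow> cdf ?M q" and q: "isCont (cdf ?M) q"
    have "(\<lambda>n. cdf (M' n) q) \<longlonglongrightarrow> cdf ?M q" using * q by blast
    then show "(\<lambda>n. cdf (distr \<Omega> borel (?X n)) q) \<longlonglongrightarrow> cdf ?M q"
      by (rule Lim_transform_eventually) (use pos in eventually_elim, simp add: M'_def)
  qed
qed

section \<open>The exponent as an integral over the unit interval\<close>

text \<open>The substitution \<open>u = exp (c * v)\<close> turns \<open>1 / u\<close> times the
  differential of \<open>u\<close> into \<open>c\<close> times that of \<open>v\<close>. It is
  carried out over negative \<open>v\<close>, where the map increases from 0 to 1, and is followed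
  by the reflection of \<open>v\<close>.\<close>

lemma total_loss_substitution:
  assumes s: "\<And>i. 0 \<le> s $ i" and c: "0 < c"
  shows "set_integrable lborel {0<..1} (\<lambda>u. loss s (- ln u / c) / u)"
    and "(LBINT u:{0<..1}. loss s (- ln u / c) / u) = c * total_loss s"
proof -
  let ?f = "\<lambda>u. loss s (- ln u / c) / u"
  let ?g = "\<lambda>v. exp (c * v)"
  let ?g' = "\<lambda>v. c * exp (c * v)"
  have ei: "einterval (- \<infinity>) 0 = {..<0}" "einterval 0 1 = {0<..<1::real}"
    by (auto simp: einterval_def)
  have fg: "?f (?g v) * ?g' v = c * loss s (- v)" for v using c by simp
  have int: "integrable lborel (\<lambda>v. indicator {0..} v * loss s v)"
    using loss_integrable[OF s] by (simp add: set_integrable_def)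
  have "integrable lborel (\<lambda>v. indicator {0..} (0 + (-1) * v) * loss s (0 + (-1) * v))"
    by (rule lborel_integrable_real_affine[OF int]) simp
  then have "set_integrable lborel {..0} (\<lambda>v. loss s (- v))"
    unfolding set_integrable_def
    by (rule Bochner_Integration.integrable_cong[THEN iffD1, OF refl, rotated]) (auto simp: indicator_def)
  then have int_neg: "set_integrable lborel {..<0} (\<lambda>v. c * loss s (- v))"
    by (intro set_integrable_mult_right) (rule set_integrable_subset, auto)
  have f_cont: "continuous_on {0<..<1} ?f"
    using c by (intro continuous_intros continuous_on_compose2[OF continuous_loss[OF s]]) (auto simp: divide_nonpos_pos)
  have lim0: "((\<lambda>v. exp (c * v)) \<longlongrightarrow> 0) at_bot"
    by (rule filterlim_compose[OF exp_at_bot filterlim_tendsto_pos_mult_at_bot[OF tendsto_const c filterlim_ident]])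
  have lim1: "((\<lambda>v. exp (c * v)) \<longlongrightarrow> exp (c * 0)) (at_left 0)"
    by (intro tendsto_intros)
  have int_fg: "set_integrable lborel (einterval (- \<infinity>) 0) (\<lambda>v. ?f (?g v) * ?g' v)"
    unfolding fg ei by (rule int_neg)
  have DERIV: "DERIV ?g v :> ?g' v" for v
    by (auto intro!: derivative_eq_intros)
  have cont_f: "isCont ?f (?g v)" if "ereal v < 0" for v
    using f_cont that c by (simp add: continuous_on_eq_continuous_at zero_ereal_def mult_pos_neg del: ln_exp)
  have cont_g': "isCont ?g' v" for v by (intro continuous_intros)
  have f_nonneg: "0 \<le> ?f (?g v)" if "ereal v < 0" for v
    using that c loss_bounds(1)[OF s, of "- v"] by (simp add: zero_ereal_def)
  have A: "((ereal \<circ> ?g \<circ> real_of_ereal) \<longlongrightarrow> 0) (at_right (-\<infinity>))"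
    unfolding zero_ereal_def ereal_tendsto_simps by (rule lim0)
  have B: "((ereal \<circ> ?g \<circ> real_of_ereal) \<longlongrightarrow> 1) (at_left 0)"
    unfolding zero_ereal_def one_ereal_def ereal_tendsto_simps using lim1 by simp
  have g'_nonneg: "0 \<le> ?g' v" for v using c by simp
  have neg: "- \<infinity> < (0::ereal)" by simp
  note subst = interval_integral_substitution_nonneg[where f = ?f, OF neg DERIV cont_f cont_g' f_nonneg g'_nonneg A B int_fg]
  have int01: "set_integrable lborel {0<..<1} ?f" using subst(1) by (simp only: ei)
  have one: "integrable lborel (\<lambda>u. indicator {1::real} u * ?f 1)" "(\<integral>u. indicator {1::real} u * ?f 1 \<partial>lborel) = 0"
    by simp_all
  \<comment> \<open>The substitution concerns the open interval; the endpoint 1 is added as a term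
    supported on a single point.\<close>
  have split: "indicator {0<..1} u *\<^sub>R ?f u = indicator {0<..<1} u *\<^sub>R ?f u + indicator {1::real} u * ?f 1" for u
    by (auto simp: indicator_def)
  show "set_integrable lborel {0<..1} ?f"
    unfolding set_integrable_def split
    by (rule Bochner_Integration.integrable_add[OF int01[unfolded set_integrable_def] one(1)])
  have "(LBINT u:{0<..1}. ?f u) = (LBINT u:{0<..<1}. ?f u)"
    unfolding set_lebesgue_integral_def split
    using Bochner_Integration.integral_add[OF int01[unfolded set_integrable_def] one(1)] one(2) by simp
  also have "\<dots> = (LBINT u=0..1. ?f u)"
    by (simp add: interval_lebesgue_integral_def ei)
  also have "\<dots> = (LBINT v=-\<infinity>..0. ?f (?g v) * ?g' v)" by (rule subst(2))
  also have "\<dots> = (LBINT v:{..<0}. c * loss s (- v))"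
    unfolding fg by (simp add: interval_lebesgue_integral_def ei)
  also have "\<dots> = c * (\<integral>v. indicator {..<0} v * loss s (- v) \<partial>lborel)"
    by (simp add: set_lebesgue_integral_def)
  also have "(\<integral>v. indicator {..<0} v * loss s (- v) \<partial>lborel) = (\<integral>v. indicator {0..} (0 + (-1) * v) * loss s (0 + (-1) * v) \<partial>lborel)"
  proof (rule integral_cong_AE)
    have "set_integrable lborel {..<0} (\<lambda>v. (1 / c) * (c * loss s (- v)))"
      by (intro set_integrable_mult_right int_neg)
    then show "(\<lambda>v. indicator {..<0} v * loss s (- v)) \<in> borel_measurable lborel"
      using c by (auto simp: set_integrable_def dest: borel_measurable_integrable)
    show "(\<lambda>v. indicator {0..} (0 + (-1) * v) * loss s (0 + (-1) * v)) \<in> borel_measurable lborel"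
      by (rule borel_measurable_integrable, rule lborel_integrable_real_affine[OF int]) simp
    show "AE v in lborel. indicator {..<0} v * loss s (- v) = indicator {0..} (0 + (-1) * v) * loss s (0 + (-1) * v)"
      using AE_lborel_singleton[of "0::real"] by eventually_elim (auto simp: indicator_def)
  qed
  also have "\<dots> = total_loss s"
    using lborel_integral_real_affine[of "-1" "\<lambda>v. indicator {0..} v * loss s v" 0]
    by (simp add: total_loss_def set_lebesgue_integral_def)
  finally show "(LBINT u:{0<..1}. ?f u) = c * total_loss s" .
qed

text \<open>A column of the exponential of the transpose is a row of the flow, and the two signs
  combine to the time \<open>- ln u / H r\<close>, which is nonnegative for
  \<open>0 < u \<le> 1\<close>.\<close>

lemma m_vec_eq:
  "m_vec r trib K H e u $ e' = flow (- ln u / H r) $ Inl e $ Inr e'"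
proof -
  have "ln u *\<^sub>R ((- 1 / H r) *\<^sub>R transpose (river_matrix trib K H)) =
      (- ln u / H r) *\<^sub>R transpose (river_matrix trib K H)" by simp
  then show ?thesis
    unfolding m_vec_def mat_powr_def by (simp only: mat_exp_transpose) (simp add: column_def transpose_def)
qed

theorem limiting_density:
  "\<exists>g. limiting_invariant_density trib K H a \<Omega> N P e g \<and>
    (\<forall>s>0.
       set_integrable lborel {0<..1}
         (\<lambda>u. (1 - laplace_orthant f (s *\<^sub>R (\<chi> e'. H e' * a e' * m_vec r trib K H e u $ e'))) / u) \<and>
       laplace_half_line g s =
         exp (- (rate / H r) *
           (LBINT u:{0<..1}.
             (1 - laplace_orthant f (s *\<^sub>R (\<chi> e'. H e' * a e' * m_vec r trib K H e u $ e'))) / u)))"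
proof -
  let ?F = "\<lambda>s u. (1 - laplace_orthant f (s *\<^sub>R (\<chi> e'. H e' * a e' * m_vec r trib K H e u $ e'))) / u"
  obtain g where g: "density_on {0<..} g" "distributed law lborel (\<lambda>x. x $ Inl e) (\<lambda>q. ennreal (g q))"
    using streamflow_density by blast
  have "density lborel (\<lambda>q. ennreal (g q)) = distr law lborel (\<lambda>x. x $ Inl e)"
    by (rule distributed_distr_eq_density[OF g(2), symmetric])
  also have "\<dots> = distr law borel (\<lambda>x. x $ Inl e)" by (intro distr_cong) simp_all
  also have "\<dots> = distr \<Omega> borel (\<lambda>w. W_lim w $ Inl e)"
    unfolding law_def by (subst distr_distr[OF _ W_lim_measurable]) (simp_all add: comp_def)
  finally have g_distr: "density lborel (\<lambda>q. ennreal (g q)) = distr \<Omega> borel (\<lambda>w. W_lim w $ Inl e)" .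
  have "limiting_invariant_density trib K H a \<Omega> N P e g"
    unfolding limiting_invariant_density_def g_distr
    using g invariant_law invariant_unique weak_convergence_streamflow by blast
  moreover have "set_integrable lborel {0<..1} (?F s) \<and>
      laplace_half_line g s = exp (- (rate / H r) * (LBINT u:{0<..1}. ?F s u))"
    if s: "0 < s" for s
  proof -
    have s': "0 \<le> axis (Inl e) s $ i" for i :: "'e + 'e" using s by (simp add: axis_def)
    \<comment> \<open>The Laplace variable \<open>axis (Inl e) s\<close> selects the streamflow of
      \<open>e\<close>; its image under \<open>pull\<close> is \<open>s\<close> times the scaled
      vector of the statement.\<close>
    have eq: "1 - laplace_orthant f (s *\<^sub>R (\<chi> e'. H e' * a e' * m_vec r trib K H e u $ e')) =
        loss (axis (Inl e) s) (- ln u / H r)" for u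
      by (simp add: loss_def pull_axis m_vec_eq)
    show ?thesis
      unfolding eq laplace_half_line_streamflow[OF g less_imp_le[OF s]] total_loss_substitution(2)[OF s' H_pos]
      using total_loss_substitution(1)[OF s' H_pos] H_pos[of r] by simp
  qed
  ultimately show ?thesis by blast
qed

end

theorem corollary4p1:
  fixes r :: "'e::finite" and trib :: "'e \<Rightarrow> 'e set"
    and K H a :: "'e \<Rightarrow> real" and rate :: real
    and f_P f_Y2 :: "real^'e \<Rightarrow> real"
    and \<Omega> :: "'w measure" and N :: "real \<Rightarrow> 'w \<Rightarrow> nat" and P :: "nat \<Rightarrow> 'w \<Rightarrow> real^'e"
  assumes "river_network r trib"
    and "\<And>e. K e > 0" and "\<And>e. H e > 0" and "\<And>e. a e > 0"
    and "rate > 0"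
    and "density_on pos_orthant f_P"
    and "marked_poisson \<Omega> rate f_P N P"
    and "distributed \<Omega> lborel (scaled_mark H a P 1) (\<lambda>y. ennreal (f_Y2 y))"
    and "(\<integral>\<^sup>+y\<in>{y. norm y \<ge> 1}. ennreal (ln (norm y)) * ennreal (f_Y2 y) \<partial>lborel) < \<infinity>"
  shows "\<forall>e. \<exists>g. limiting_invariant_density trib K H a \<Omega> N P e g \<and>
    (\<forall>s>0.
       set_integrable lborel {0<..1}
         (\<lambda>u. (1 - laplace_orthant f_P (s *\<^sub>R (\<chi> e'. H e' * a e' * m_vec r trib K H e u $ e'))) / u) \<and>
       laplace_half_line g s =
         exp (- (rate / H r) *
           (LBINT u:{0<..1}.
             (1 - laplace_orthant f_P (s *\<^sub>R (\<chi> e'. H e' * a e' * m_vec r trib K H e u $ e'))) / u)))"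
proof -
  have net: "river r trib K H a" using assms(1-4) by (simp add: river_def)
  interpret prob_space \<Omega> using assms(7) by (simp add: marked_poisson_def)
  have noise: "shot_noise \<Omega> rate N P f_P"
    using assms(5-7) prob_space_axioms
    by (simp add: shot_noise_def shot_noise_axioms_def poisson_clock_def poisson_clock_axioms_def marked_poisson_def)
  \<comment> \<open>\<open>embed\<close> only pads the scaled mark with zeros in the streamflow
    entries.\<close>
  have norm_embed: "norm (river.embed H a (P 1 w)) = norm (scaled_mark H a P 1 w)" for w
    by (simp add: norm_vec_def L2_set_def sum_UNIV_sum river.embed_def[OF net] scaled_mark_def)
  have "(\<integral>\<^sup>+w. ennreal (ln (max 1 (norm (scaled_mark H a P 1 w)))) \<partial>\<Omega>) =
      (\<integral>\<^sup>+y. ennreal (f_Y2 y) * ennreal (ln (max 1 (norm y))) \<partial>lborel)"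
    by (rule distributed_nn_integral[OF assms(8), symmetric]) measurable
  \<comment> \<open>On the unit ball \<open>ln (max 1 (norm y))\<close> is zero, so restricting to
    \<open>norm y \<ge> 1\<close> loses nothing.\<close>
  also have "\<dots> = (\<integral>\<^sup>+y\<in>{y. norm y \<ge> 1}. ennreal (ln (norm y)) * ennreal (f_Y2 y) \<partial>lborel)"
    by (intro nn_integral_cong) (auto simp: indicator_def max_def mult.commute)
  finally have "(\<integral>\<^sup>+w. ennreal (ln (max 1 (norm (river.embed H a (P 1 w))))) \<partial>\<Omega>) < \<infinity>"
    using assms(9) by (simp only: norm_embed)
  then interpret river_noise r trib K H a \<Omega> rate N P f_P
    using net noise by (simp add: river_noise_def river_noise_axioms_def)
  show ?thesis using limiting_density by blast
qed

end
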